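(* Let $n\ge 1$ be an integer, $a<b$ real numbers, $0<\alpha\le 1$ and $\beta>0$, and let $\varphi:\mathbb{R}^n\times\mathbb{R}^n\to\mathbb{R}$ and $L:\mathbb{R}^n\times\mathbb{R}^n\times[a,b]\to\mathbb{R}$ be of class $C^2$. Define $\mathcal{L}:{}_{c}AC^{\alpha,\infty}_{a+}\to\mathbb{R}$ by $$\mathcal{L}(x):=\varphi(x(a),x(b))+I^{\beta}_{a+}\left[L(x,{}_{c}D^\alpha_{a+}[x],\cdot)\right](b).$$ If $x\in{}_{c}AC^{\alpha,\infty}_{a+}$ is a minimizer of $\mathcal{L}$ over the whole space ${}_{c}AC^{\alpha,\infty}_{a+}$ (i.e. $\mathcal{L}(x)\le\mathcal{L}(X)$ for all $X\in{}_{c}AC^{\alpha,\infty}_{a+}$), then: (i) (Euler-Lagrange equation) the function $\frac{(b-\cdot)^{\beta-1}}{\Gamma(\beta)}\partial_2L(x,{}_{c}D^\alpha_{a+}[x],\cdot)$ belongs to $AC^\alpha_{b-}$ and $$D^\alpha_{b-}\left[\frac{(b-\cdot)^{\beta-1}}{\Gamma(\beta)}\partial_2L(x,{}_{c}D^\alpha_{a+}[x],\cdot)\right](t)=-\frac{(b-t)^{\beta-1}}{\Gamma(\beta)}\partial_1L(x(t),{}_{c}D^\alpha_{a+}[x](t),t)$$ for almost every $t\in[a,b]$; (ii) (Transversality conditions) both equalities $$I^{1-\alpha}_{b-}\left[\frac{(b-\cdot)^{\beta-1}}{\Gamma(\beta)}\partial_2L(x,{}_{c}D^\alpha_{a+}[x],\cdot)\right](a)=\partial_1\varphi(x(a),x(b)),$$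 $$-I^{1-\alpha}_{b-}\left[\frac{(b-\cdot)^{\beta-1}}{\Gamma(\beta)}\partial_2L(x,{}_{c}D^\alpha_{a+}[x],\cdot)\right](b)=\partial_2\varphi(x(a),x(b))$$ hold; (iii) (Legendre condition) the matrix $\frac{(b-t)^{\beta-1}}{\Gamma(\beta)}\partial^2_{22}L(x(t),{}_{c}D^\alpha_{a+}[x](t),t)\in\mathbb{R}^{n\times n}$ is positive semi-definite for almost every $t\in[a,b]$.
   Context: All functions are defined (a.e.) on $[a,b]$ with values in $\mathbb{R}^n$. $L^1$, $L^\infty$ are the usual Lebesgue spaces, $C$ the continuous functions, $AC$ the absolutely continuous functions. $\Gamma$ is the Gamma function. Fractional integrals: for $\gamma>0$ and $f\in L^1$ (scalar or vector valued), $I^\gamma_{a+}[f](t):=\int_a^t\frac{(t-s)^{\gamma-1}}{\Gamma(\gamma)}f(s)\,ds$ and $I^\gamma_{b-}[f](t):=\int_t^b\frac{(s-t)^{\gamma-1}}{\Gamma(\gamma)}f(s)\,ds$ (whenever these exist; they do for a.e. $t$); $I^0_{a+}[f]=I^0_{b-}[f]:=f$. If a fractional integral is a.e. equal to a continuous function it is identified with its continuous representative, and pointwise values (e.g. at $a$ and $b$) refer to that representative. Fractional derivatives, for $0\le\alpha\le1$: $AC^\alpha_{a+}$ is the set of $f\in L^1$ with $I^{1-\alpha}_{a+}[f]\in AC$, and then $D^\alpha_{a+}[f]:=\frac{d}{dt}I^{1-\alpha}_{a+}[f]$ a.e.; $AC^\alpha_{b-}$ is the set of $f\in L^1$ with $I^{1-\alpha}_{b-}[f]\in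 AC$, and then $D^\alpha_{b-}[f]:=-\frac{d}{dt}I^{1-\alpha}_{b-}[f]$ a.e. The space ${}_{c}AC^\alpha_{a+}$ is the set of $x\in C$ with $x-x(a)\in AC^\alpha_{a+}$, and then the left Caputo derivative is ${}_{c}D^\alpha_{a+}[x]:=D^\alpha_{a+}[x-x(a)]\in L^1$. Finally ${}_{c}AC^{\alpha,\infty}_{a+}:=\{x\in{}_{c}AC^\alpha_{a+}\mid {}_{c}D^\alpha_{a+}[x]\in L^\infty\}$. Notation: $L(x,{}_{c}D^\alpha_{a+}[x],\cdot)$ denotes the function $t\mapsto L(x(t),{}_{c}D^\alpha_{a+}[x](t),t)$, and similarly for derivatives of $L$. $\partial_1,\partial_2$ denote gradients (in $\mathbb{R}^n$) with respect to the first and second $\mathbb{R}^n$-variable, and $\partial^2_{22}L$ is the $n\times n$ Hessian with respect to the second variable. *)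

theory Defs
  imports "HOL-Analysis.Analysis"
begin

text \<open>
  Functions "defined almost everywhere on the interval" are rendered as total functions on the
  reals; only their values on \<open>{a..b}\<close> up to Lebesgue null sets matter.
\<close>

definition Linfinity_on :: "real \<Rightarrow> real \<Rightarrow> (real \<Rightarrow> 'v::euclidean_space) \<Rightarrow> bool" where
  "Linfinity_on a b f \<longleftrightarrow>
     set_borel_measurable lebesgue {a..b} f \<and> (\<exists>C. AE t\<in>{a..b} in lebesgue. norm (f t) \<le> C)"

text \<open>
  The families of non-overlapping subintervals in the usual epsilon-delta definition are finite
  sets of pairs (left endpoint, right endpoint).
\<close>

definition abs_continuous_on :: "real \<Rightarrow> real \<Rightarrow> (real \<Rightarrow> 'v::euclidean_space) \<Rightarrow> bool" where
  "abs_continuous_on a b f \<longleftrightarrow>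
     (\<forall>\<epsilon>>0. \<exists>\<delta>>0. \<forall>P :: (real \<times> real) set.
        finite P \<longrightarrow>
        (\<forall>(u, v)\<in>P. a \<le> u \<and> u \<le> v \<and> v \<le> b) \<longrightarrow>
        pairwise (\<lambda>(u, v) (u', v'). {u<..<v} \<inter> {u'<..<v'} = {}) P \<longrightarrow>
        (\<Sum>(u, v)\<in>P. v - u) < \<delta> \<longrightarrow>
        (\<Sum>(u, v)\<in>P. norm (f v - f u)) < \<epsilon>)"

text \<open>
  For \<open>a < b\<close> the values of the continuous representative on \<open>{a..b}\<close> do not depend on the
  choice made by \<open>SOME\<close>; functions without such a representative are left unchanged.
\<close>

definition cont_rep :: "real \<Rightarrow> real \<Rightarrow> (real \<Rightarrow> 'v::euclidean_space) \<Rightarrow> real \<Rightarrow> 'v" where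
  "cont_rep a b f =
     (if \<exists>g. continuous_on {a..b} g \<and> (AE t\<in>{a..b} in lebesgue. f t = g t)
      then SOME g. continuous_on {a..b} g \<and> (AE t\<in>{a..b} in lebesgue. f t = g t)
      else f)"

text \<open>
  The identification of a fractional integral with its continuous representative is built into the
  following two operators (also in the case \<open>\<gamma> = 0\<close>), so that their values at single points,
  in particular at \<open>a\<close> and \<open>b\<close>, are values of that representative.
\<close>

definition frac_int_left ::
  "real \<Rightarrow> real \<Rightarrow> real \<Rightarrow> (real \<Rightarrow> 'v::euclidean_space) \<Rightarrow> real \<Rightarrow> 'v" where
  "frac_int_left a b \<gamma> f = cont_rep a b
     (if \<gamma> = 0 then f
      else (\<lambda>t. LINT s:{a..t}|lebesgue. ((t - s) powr (\<gamma> - 1) / Gamma \<gamma>) *\<^sub>R f s))"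

definition frac_int_right ::
  "real \<Rightarrow> real \<Rightarrow> real \<Rightarrow> (real \<Rightarrow> 'v::euclidean_space) \<Rightarrow> real \<Rightarrow> 'v" where
  "frac_int_right a b \<gamma> f = cont_rep a b
     (if \<gamma> = 0 then f
      else (\<lambda>t. LINT s:{t..b}|lebesgue. ((s - t) powr (\<gamma> - 1) / Gamma \<gamma>) *\<^sub>R f s))"

definition AC_left :: "real \<Rightarrow> real \<Rightarrow> real \<Rightarrow> (real \<Rightarrow> 'v::euclidean_space) set" where
  "AC_left a b \<alpha> =
     {f. set_integrable lebesgue {a..b} f \<and> abs_continuous_on a b (frac_int_left a b (1 - \<alpha>) f)}"

definition AC_right :: "real \<Rightarrow> real \<Rightarrow> real \<Rightarrow> (real \<Rightarrow> 'v::euclidean_space) set" where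
  "AC_right a b \<alpha> =
     {f. set_integrable lebesgue {a..b} f \<and> abs_continuous_on a b (frac_int_right a b (1 - \<alpha>) f)}"

text \<open>
  The two derivatives below are meaningful almost everywhere on \<open>{a..b}\<close>, for \<open>f\<close> in
  \<open>AC_left a b \<alpha>\<close> and \<open>AC_right a b \<alpha>\<close> respectively.
\<close>

definition frac_deriv_left ::
  "real \<Rightarrow> real \<Rightarrow> real \<Rightarrow> (real \<Rightarrow> 'v::euclidean_space) \<Rightarrow> real \<Rightarrow> 'v" where
  "frac_deriv_left a b \<alpha> f t = vector_derivative (frac_int_left a b (1 - \<alpha>) f) (at t)"

definition frac_deriv_right ::
  "real \<Rightarrow> real \<Rightarrow> real \<Rightarrow> (real \<Rightarrow> 'v::euclidean_space) \<Rightarrow> real \<Rightarrow> 'v" where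
  "frac_deriv_right a b \<alpha> f t = - vector_derivative (frac_int_right a b (1 - \<alpha>) f) (at t)"

definition caputo_AC_left :: "real \<Rightarrow> real \<Rightarrow> real \<Rightarrow> (real \<Rightarrow> 'v::euclidean_space) set" where
  "caputo_AC_left a b \<alpha> = {x. continuous_on {a..b} x \<and> (\<lambda>t. x t - x a) \<in> AC_left a b \<alpha>}"

definition caputo_deriv_left ::
  "real \<Rightarrow> real \<Rightarrow> real \<Rightarrow> (real \<Rightarrow> 'v::euclidean_space) \<Rightarrow> real \<Rightarrow> 'v" where
  "caputo_deriv_left a b \<alpha> x = frac_deriv_left a b \<alpha> (\<lambda>t. x t - x a)"

definition caputo_AC_inf_left :: "real \<Rightarrow> real \<Rightarrow> real \<Rightarrow> (real \<Rightarrow> 'v::euclidean_space) set" where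
  "caputo_AC_inf_left a b \<alpha> =
     {x \<in> caputo_AC_left a b \<alpha>. Linfinity_on a b (caputo_deriv_left a b \<alpha> x)}"

text \<open>
  Derivatives are taken within \<open>S\<close>, so that for the closed slab on which a Lagrangian is
  defined, time derivatives at the two end points are one-sided. On a convex set with nonempty
  interior such derivatives are unique.
\<close>

definition C2_on :: "('v::euclidean_space \<Rightarrow> real) \<Rightarrow> 'v set \<Rightarrow> bool" where
  "C2_on f S \<longleftrightarrow>
     (\<exists>(f' :: 'v \<Rightarrow> 'v \<Rightarrow>\<^sub>L real) (f'' :: 'v \<Rightarrow> 'v \<Rightarrow>\<^sub>L 'v \<Rightarrow>\<^sub>L real).
        (\<forall>z\<in>S. (f has_derivative blinfun_apply (f' z)) (at z within S)) \<and>
        (\<forall>z\<in>S. (f' has_derivative blinfun_apply (f'' z)) (at z within S)) \<and>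
        continuous_on S f'')"

definition gradient :: "('v::euclidean_space \<Rightarrow> real) \<Rightarrow> 'v \<Rightarrow> 'v" where
  "gradient f z = (THE D. GDERIV f z :> D)"

definition hessian :: "(real ^ 'n \<Rightarrow> real) \<Rightarrow> real ^ 'n \<Rightarrow> real ^ 'n ^ 'n" where
  "hessian f z = jacobian (gradient f) (at z)"

definition pos_semidefinite :: "real ^ 'n ^ 'n \<Rightarrow> bool" where
  "pos_semidefinite A \<longleftrightarrow> transpose A = A \<and> (\<forall>v. 0 \<le> v \<bullet> (A *v v))"

definition bolza ::
  "real \<Rightarrow> real \<Rightarrow> real \<Rightarrow> real \<Rightarrow> ('v::euclidean_space \<Rightarrow> 'v \<Rightarrow> real) \<Rightarrow>
   ('v \<Rightarrow> 'v \<Rightarrow> real \<Rightarrow> real) \<Rightarrow> (real \<Rightarrow> 'v) \<Rightarrow> real" where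
  "bolza a b \<alpha> \<beta> \<phi> L x =
     \<phi> (x a) (x b) + frac_int_left a b \<beta> (\<lambda>t. L (x t) (caputo_deriv_left a b \<alpha> x t) t) b"

end

theory Submission
  imports Defs
begin

text \<open>
  Write \<open>y\<close> for the Caputo derivative of the minimizer \<open>x\<close>, \<open>w\<close> for the weight
  \<open>(b - t) powr (\<beta> - 1) / Gamma \<beta>\<close>, and \<open>k\<close> for the kernel \<open>(t - s) powr (\<alpha> - 1) / Gamma \<alpha>\<close>
  on \<open>s < t\<close> (\<open>frac_kernel\<close>). All arguments of \<open>L\<close> and its derivatives are
  \<open>(x t, y t, t)\<close> unless shown.

  The essential competitors are the needle variations \<open>x + J\<close> with
  \<open>J t = (\<integral> s\<in>E. k s t) *\<^sub>R v\<close>, where \<open>v\<close> is a fixed vector and \<open>E\<close> a measurable set at a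
  positive distance from \<open>b\<close>. The Caputo derivative of \<open>x + J\<close> is \<open>y + v\<close> on \<open>E\<close> and \<open>y\<close>
  elsewhere (\<open>caputo_variation\<close>). When the measure of \<open>E\<close> tends to zero, \<open>J\<close> tends to zero
  uniformly, and both \<open>J b\<close> and the integral of \<open>w * norm J\<close> are bounded by a multiple of that
  measure. So the cost changes by the integral over \<open>E\<close> of
    \<open>excess v s = w s * (L (x s) (y s + v) s - L (x s) (y s) s) + v \<bullet> A s\<close>
  up to an error that is small compared with the measure of \<open>E\<close>. Here
    \<open>A s = k s b *\<^sub>R \<partial>\<^sub>2\<phi> + (\<integral> t. k s t *\<^sub>R w t *\<^sub>R \<partial>\<^sub>1L)\<close>
  arises from exchanging the order of integration (\<open>needle_duality\<close>). Minimality
  forces \<open>excess v s \<ge> 0\<close> for almost every \<open>s\<close> and all \<open>v\<close> simultaneously, which is a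
  Weierstrass condition (\<open>weierstrass_condition\<close>).

  As a function of \<open>v\<close> the excess vanishes at \<open>v = 0\<close> and is minimal there. Its second derivative
  at \<open>0\<close> gives the Legendre condition. Its gradient at \<open>0\<close> gives \<open>w *\<^sub>R \<partial>\<^sub>2L = - A\<close> almost
  everywhere. Applying the right fractional integral of order \<open>1 - \<alpha>\<close> to this identity and using
  the semigroup law of the kernels turns the right-hand side into
    \<open>- \<partial>\<^sub>2\<phi> - (\<integral> s = t..b. w s *\<^sub>R \<partial>\<^sub>1L)\<close>
  (\<open>frac_int_right_of_stationary\<close>). This function of \<open>t\<close> is absolutely continuous with
  derivative \<open>w *\<^sub>R \<partial>\<^sub>1L\<close>, which is the Euler-Lagrange equation, and its value at \<open>b\<close> is the
  second transversality condition. The first one follows from its value at \<open>a\<close> and from the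
  constant variations \<open>x + h0\<close>, which give \<open>\<partial>\<^sub>1\<phi> + \<partial>\<^sub>2\<phi> + (\<integral> t. w t *\<^sub>R \<partial>\<^sub>1L) = 0\<close>
  (\<open>natural_boundary_condition\<close>).

  Two classical theorems are proved on the way. The semigroup law of the kernels is
  Euler's beta integral. Absolutely continuous functions are differentiable almost everywhere;
  this is needed because \<open>vector_derivative\<close> is additive only where both
  derivatives exist. It is obtained from a Jordan decomposition, the Radon-Nikodym theorem and
  Lebesgue's differentiation theorem.
\<close>

section \<open>The fractional kernel and its semigroup law\<close>

text \<open>
  Extending the kernel by zero to \<open>t \<le> s\<close> lets left and right fractional integrals be written as
  integrals over the whole line, with the two arguments of the kernel exchanged.
\<close>

definition frac_kernel :: "real \<Rightarrow> real \<Rightarrow> real \<Rightarrow> real" where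
  "frac_kernel \<gamma> s t = (if s < t then (t - s) powr (\<gamma> - 1) / Gamma \<gamma> else 0)"

abbreviation left_frac :: "real \<Rightarrow> (real \<Rightarrow> 'v::euclidean_space) \<Rightarrow> real \<Rightarrow> 'v" where
  "left_frac \<gamma> f t \<equiv> (LINT s|lebesgue. frac_kernel \<gamma> s t *\<^sub>R f s)"

abbreviation right_frac :: "real \<Rightarrow> (real \<Rightarrow> 'v::euclidean_space) \<Rightarrow> real \<Rightarrow> 'v" where
  "right_frac \<gamma> f t \<equiv> (LINT s|lebesgue. frac_kernel \<gamma> t s *\<^sub>R f s)"

lemma frac_kernel_nonneg [simp]: "0 < \<gamma> \<Longrightarrow> 0 \<le> frac_kernel \<gamma> s t"
  by (auto simp: frac_kernel_def intro!: divide_nonneg_nonneg less_imp_le[OF Gamma_real_pos])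

lemma frac_kernel_one: "frac_kernel 1 s t = (if s < t then 1 else 0)"
  by (simp add: frac_kernel_def)

lemma frac_kernel_measurable [measurable (raw)]:
  assumes [measurable]: "f \<in> borel_measurable M" "g \<in> borel_measurable M"
  shows "(\<lambda>z. frac_kernel \<gamma> (f z) (g z)) \<in> borel_measurable M"
  unfolding frac_kernel_def by measurable

text \<open>
  The substitution \<open>r = s + (t - s) * z\<close> turns the integral into
  \<open>(t - s) powr (\<gamma> + \<delta> - 1)\<close> times Euler's beta integral, and \<open>Beta \<gamma> \<delta>\<close> cancels the Gamma
  factors. The special cases with one index equal to \<open>1\<close> serve as the integrals of the kernel
  itself.
\<close>

lemma nn_integral_frac_kernel_comp:
  assumes "0 < \<gamma>" "0 < \<delta>"
  shows "(\<integral>\<^sup>+ r. ennreal (frac_kernel \<gamma> s r * frac_kernel \<delta> r t) \<partial>lborel)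
    = ennreal (frac_kernel (\<gamma> + \<delta>) s t)"
proof (cases "s < t")
  case False
  then have "frac_kernel \<gamma> s r * frac_kernel \<delta> r t = 0" for r
    by (auto simp: frac_kernel_def)
  then have "(\<integral>\<^sup>+ r. ennreal (frac_kernel \<gamma> s r * frac_kernel \<delta> r t) \<partial>lborel) = 0"
    by (simp only: ennreal_0 nn_integral_0_iff_AE) simp
  with False show ?thesis by (simp add: frac_kernel_def)
next
  case True
  define c where "c = t - s"
  have c: "c > 0" using True by (simp add: c_def)
  let ?B = "\<lambda>z::real. z powr (\<gamma> - 1) * (1 - z) powr (\<delta> - 1)"
  define K where "K = c powr (\<gamma> + \<delta> - 2) / (Gamma \<gamma> * Gamma \<delta>)"
  have G: "Gamma \<gamma> > 0" "Gamma \<delta> > 0" "Gamma (\<gamma> + \<delta>) > 0" using assms by auto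
  have K: "K \<ge> 0" using G by (simp add: K_def)
  have eq: "frac_kernel \<gamma> s (s + c * z) * frac_kernel \<delta> (s + c * z) t
      = K * (indicator {0..1} z * ?B z)" for z
  proof (cases "0 < z \<and> z < 1")
    case True
    have "c * z < c" "0 < c * z" using True c by simp_all
    then have "s < s + c * z" "s + c * z < t" unfolding c_def by linarith+
    moreover have "t - (s + c * z) = c * (1 - z)" by (simp add: c_def algebra_simps)
    moreover have "s + c * z - s = c * z" by simp
    ultimately have "frac_kernel \<gamma> s (s + c * z) * frac_kernel \<delta> (s + c * z) t
      = ((c * z) powr (\<gamma> - 1) / Gamma \<gamma>) * ((c * (1 - z)) powr (\<delta> - 1) / Gamma \<delta>)"
      unfolding frac_kernel_def by presburger
    also have "\<dots> = (c powr (\<gamma> - 1) * c powr (\<delta> - 1)) / (Gamma \<gamma> * Gamma \<delta>) * ?B z"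
      using True c by (simp add: powr_mult)
    also have "c powr (\<gamma> - 1) * c powr (\<delta> - 1) = c powr (\<gamma> + \<delta> - 2)"
      using c by (simp flip: powr_add)
    finally show ?thesis using True by (simp add: K_def)
  next
    case False
    then have "z \<le> 0 \<or> z \<ge> 1" by auto
    then have "frac_kernel \<gamma> s (s + c * z) * frac_kernel \<delta> (s + c * z) t = 0"
    proof
      assume "z \<le> 0" 
      then have "c * z \<le> 0" using c by (simp add: mult_nonneg_nonpos)
      then show ?thesis by (simp add: frac_kernel_def)
    next
      assume "z \<ge> 1" 
      then have "c * z \<ge> c * 1" using c by (intro mult_left_mono) auto
      then show ?thesis by (simp add: frac_kernel_def c_def)
    qed
    moreover have "indicator {0..1} z * ?B z = 0"
      using False by (cases "z = 0 \<or> z = 1") (auto simp: indicator_def)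
    ultimately show ?thesis by (simp only: mult_zero_right)
  qed
  have "(\<integral>\<^sup>+ r. ennreal (frac_kernel \<gamma> s r * frac_kernel \<delta> r t) \<partial>lborel)
     = ennreal \<bar>c\<bar> * (\<integral>\<^sup>+ z. ennreal (frac_kernel \<gamma> s (s + c * z) * frac_kernel \<delta> (s + c * z) t) \<partial>lborel)"
    by (rule nn_integral_real_affine) (use c in auto)
  also have "\<dots> = ennreal c * (\<integral>\<^sup>+ z. ennreal K * ennreal (indicator {0..1} z * ?B z) \<partial>lborel)"
    using c K by (simp add: eq ennreal_mult')
  also have "\<dots> = ennreal c * (ennreal K * (\<integral>\<^sup>+ z. ennreal (indicator {0..1} z * ?B z) \<partial>lborel))"
    by (subst nn_integral_cmult) auto
  also have "(\<integral>\<^sup>+ z. ennreal (indicator {0..1} z * ?B z) \<partial>lborel) = ennreal (Beta \<gamma> \<delta>)"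
  proof (rule nn_integral_has_integral_lborel)
    show "((\<lambda>z. indicator {0..1} z * ?B z) has_integral Beta \<gamma> \<delta>) UNIV"
      using has_integral_Beta_real[OF assms] 
      by (subst (asm) has_integral_restrict_UNIV [symmetric])
        (auto simp: indicator_def if_distrib intro: has_integral_eq[rotated])
  qed (auto simp: indicator_def)
  also have "ennreal c * (ennreal K * ennreal (Beta \<gamma> \<delta>)) = ennreal (c * (K * Beta \<gamma> \<delta>))"
  proof -
    have "Beta \<gamma> \<delta> \<ge> 0" using G by (simp add: Beta_def)
    then show ?thesis using c K by (simp flip: ennreal_mult)
  qed
  also have "c * (K * Beta \<gamma> \<delta>) = frac_kernel (\<gamma> + \<delta>) s t"
  proof -
    have "c * c powr (\<gamma> + \<delta> - 2) = c powr (\<gamma> + \<delta> - 1)"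
      using c powr_add[of c 1 "\<gamma> + \<delta> - 2"] by simp
    then show ?thesis using G True by (simp add: K_def Beta_def frac_kernel_def c_def field_simps)
  qed
  finally show ?thesis .
qed


lemma ident_measurable_lebesgue [measurable]: "(\<lambda>x. x) \<in> borel_measurable (lebesgue :: real measure)"
  by (simp add: measurable_completion)

lemma sigma_finite_lebesgue: "sigma_finite_measure (lebesgue :: 'a::euclidean_space measure)"
proof
  obtain A :: "'a set set" where A: "countable A" "A \<subseteq> sets lborel" "\<Union>A = space lborel"
      "\<forall>a\<in>A. emeasure lborel a \<noteq> \<infinity>"
    using lborel.sigma_finite_countable by blast
  then show "\<exists>A. countable A \<and> A \<subseteq> sets (lebesgue :: 'a measure) \<and> \<Union>A = space lebesgue
      \<and> (\<forall>a\<in>A. emeasure lebesgue a \<noteq> \<infinity>)"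
    by (intro exI[of _ A]) (auto simp: subset_eq)
qed

text \<open>
  All exchanges of integrals below have one nonnegative scalar kernel and one vector-valued
  factor. Integrability on the product then reduces to integrability of \<open>M r *\<^sub>R f r\<close>, where
  \<open>M r\<close> is the mass of the kernel at \<open>r\<close>.
\<close>

lemma fubini_nonneg_kernel:
  fixes f :: "real \<Rightarrow> 'v::euclidean_space" and K :: "real \<Rightarrow> real \<Rightarrow> real"
  assumes K [measurable]: "(\<lambda>(s, r). K s r) \<in> borel_measurable (lebesgue \<Otimes>\<^sub>M lebesgue)"
    and nonneg: "\<And>s r. 0 \<le> K s r" "\<And>r. 0 \<le> M r"
    and f [measurable]: "f \<in> borel_measurable lebesgue"
    and M: "\<And>r. (\<integral>\<^sup>+ s. ennreal (K s r) \<partial>lebesgue) = ennreal (M r)"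
    and int: "integrable lebesgue (\<lambda>r. M r *\<^sub>R f r)"
  shows "integrable lebesgue (\<lambda>s. LINT r|lebesgue. K s r *\<^sub>R f r)"
    and "(LINT s|lebesgue. LINT r|lebesgue. K s r *\<^sub>R f r) = (LINT r|lebesgue. M r *\<^sub>R f r)"
proof -
  interpret L: sigma_finite_measure "lebesgue :: real measure" by (rule sigma_finite_lebesgue)
  interpret P: pair_sigma_finite "lebesgue :: real measure" "lebesgue :: real measure" ..
  have slice: "(LINT s|lebesgue. K s r *\<^sub>R f r) = M r *\<^sub>R f r" for r
  proof -
    have "(LINT s|lebesgue. K s r) = M r"
      using M[of r] nonneg by (intro integral_eq_nn_integral[THEN trans]) auto
    moreover have "integrable lebesgue (\<lambda>s. K s r)"
      using M[of r] nonneg by (intro integrableI_nonneg) auto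
    ultimately show ?thesis by simp
  qed
  have pair: "integrable (lebesgue \<Otimes>\<^sub>M lebesgue) (\<lambda>(s, r). K s r *\<^sub>R f r)"
  proof (rule integrableI_bounded)
    have "(\<integral>\<^sup>+ z. norm (case z of (s, r) \<Rightarrow> K s r *\<^sub>R f r) \<partial>(lebesgue \<Otimes>\<^sub>M lebesgue))
        = (\<integral>\<^sup>+ r. \<integral>\<^sup>+ s. ennreal (K s r) * ennreal (norm (f r)) \<partial>lebesgue \<partial>lebesgue)"
      using nonneg
      by (subst P.nn_integral_snd[symmetric, of "\<lambda>z. ennreal (norm (case z of (s, r) \<Rightarrow> K s r *\<^sub>R f r))"])
        (auto simp: ennreal_mult')
    also have "\<dots> = (\<integral>\<^sup>+ r. norm (M r *\<^sub>R f r) \<partial>lebesgue)"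
      using nonneg by (intro nn_integral_cong) (auto simp: nn_integral_multc M ennreal_mult')
    also have "\<dots> < \<infinity>" using int by (simp add: integrable_iff_bounded)
    finally show "(\<integral>\<^sup>+ z. norm (case z of (s, r) \<Rightarrow> K s r *\<^sub>R f r) \<partial>(lebesgue \<Otimes>\<^sub>M lebesgue)) < \<infinity>" .
  qed measurable
  show "integrable lebesgue (\<lambda>s. LINT r|lebesgue. K s r *\<^sub>R f r)"
    using P.integrable_fst[OF pair] by simp
  show "(LINT s|lebesgue. LINT r|lebesgue. K s r *\<^sub>R f r) = (LINT r|lebesgue. M r *\<^sub>R f r)"
    using P.Fubini_integral[OF pair] slice by simp
qed

lemma
  fixes f :: "real \<Rightarrow> 'v::euclidean_space"
  assumes "0 < \<gamma>" "0 < \<delta>" and f [measurable]: "f \<in> borel_measurable lebesgue"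
  shows frac_kernel_semigroup_left:
      "integrable lebesgue (\<lambda>r. frac_kernel (\<gamma> + \<delta>) r t *\<^sub>R f r) \<Longrightarrow>
       (left_frac \<delta> (left_frac \<gamma> f) t)
         = left_frac (\<gamma> + \<delta>) f t"
    and frac_kernel_semigroup_right:
      "integrable lebesgue (\<lambda>r. frac_kernel (\<gamma> + \<delta>) t r *\<^sub>R f r) \<Longrightarrow>
       (right_frac \<delta> (right_frac \<gamma> f) t)
         = right_frac (\<gamma> + \<delta>) f t"
    and integrable_frac_kernel_comp_right:
      "integrable lebesgue (\<lambda>r. frac_kernel (\<gamma> + \<delta>) t r *\<^sub>R f r) \<Longrightarrow>
       integrable lebesgue (\<lambda>s. frac_kernel \<delta> t s *\<^sub>R (right_frac \<gamma> f s))"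
proof -
  { assume int: "integrable lebesgue (\<lambda>r. frac_kernel (\<gamma> + \<delta>) r t *\<^sub>R f r)"
    have "(\<integral>\<^sup>+ s. ennreal (frac_kernel \<delta> s t * frac_kernel \<gamma> r s) \<partial>lebesgue)
       = ennreal (frac_kernel (\<gamma> + \<delta>) r t)" for r
      using nn_integral_frac_kernel_comp[OF assms(1,2), of r t]
      by (simp add: nn_integral_completion mult.commute)
    from fubini_nonneg_kernel(2)[OF _ _ _ f this int] assms(1,2)
    show "(left_frac \<delta> (left_frac \<gamma> f) t)
         = left_frac (\<gamma> + \<delta>) f t"
      by (simp flip: scaleR_scaleR) }
  { assume int: "integrable lebesgue (\<lambda>r. frac_kernel (\<gamma> + \<delta>) t r *\<^sub>R f r)"
    have "(\<integral>\<^sup>+ s. ennreal (frac_kernel \<delta> t s * frac_kernel \<gamma> s r) \<partial>lebesgue)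
       = ennreal (frac_kernel (\<gamma> + \<delta>) t r)" for r
      using nn_integral_frac_kernel_comp[OF assms(2,1), of t r]
      by (simp add: nn_integral_completion add.commute)
    note * = fubini_nonneg_kernel[OF _ _ _ f this int]
    show "(right_frac \<delta> (right_frac \<gamma> f) t)
         = right_frac (\<gamma> + \<delta>) f t"
      "integrable lebesgue (\<lambda>s. frac_kernel \<delta> t s *\<^sub>R (right_frac \<gamma> f s))"
      using *(1,2) assms(1,2) by (simp_all flip: scaleR_scaleR) }
qed

section \<open>Lebesgue differentiation\<close>

text \<open>
  The averages of \<open>f\<close> over \<open>{t..t + h}\<close> converge to \<open>f t\<close> outside a null set. Applying this to
  \<open>f\<close> and to its reflection gives the right and the left derivative.
\<close>

lemma lebesgue_differentiation:
  fixes f F :: "real \<Rightarrow> 'v::euclidean_space"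
  assumes int: "\<And>u v. f integrable_on {u..v}"
    and F: "\<And>u v. u \<le> v \<Longrightarrow> F v - F u = integral {u..v} f"
  shows "AE t in lebesgue. (F has_vector_derivative f t) (at t)"
proof -
  have int': "(\<lambda>x. f (- x)) integrable_on {u..v}" for u v
    using int[of "-v" "-u"] Henstock_Kurzweil_Integration.integrable_reflect_real[of f "-u" "-v"] by simp
  obtain N1 where N1: "negligible N1"
    "\<And>x e. \<lbrakk>x \<notin> N1; 0 < e\<rbrakk> \<Longrightarrow> \<exists>d>0. \<forall>h. 0 < h \<and> h < d \<longrightarrow>
        norm (integral {x..x + h} f /\<^sub>R h - f x) < e"
    using integrable_ccontinuous_explicit[of f] int by (auto simp: box_real)
  obtain N2 where N2: "negligible N2"
    "\<And>x e. \<lbrakk>x \<notin> N2; 0 < e\<rbrakk> \<Longrightarrow> \<exists>d>0. \<forall>h. 0 < h \<and> h < d \<longrightarrow>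
        norm (integral {x..x + h} (\<lambda>x. f (- x)) /\<^sub>R h - f (- x)) < e"
    using integrable_ccontinuous_explicit[of "\<lambda>x. f (- x)"] int' by (auto simp: box_real)
  have "negligible (uminus ` N2)"
    using N2 by (intro negligible_differentiable_image_negligible) (auto intro!: derivative_intros)
  with N1 have "negligible (N1 \<union> uminus ` N2)" by simp
  moreover have "(F has_vector_derivative f t) (at t)" if t: "t \<notin> N1 \<union> uminus ` N2" for t
    unfolding has_vector_derivative_def has_derivative_at_alt
  proof (intro conjI allI impI)
    fix e :: real assume e: "e > 0"
    have "t \<notin> N1" "- t \<notin> N2" using t by (auto simp: image_iff)
    obtain d1 where d1: "d1 > 0" "\<And>h. 0 < h \<Longrightarrow> h < d1 \<Longrightarrow> norm (integral {t..t + h} f /\<^sub>R h - f t) < e"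
      using N1(2)[OF \<open>t \<notin> N1\<close> e] by blast
    obtain d2 where d2: "d2 > 0"
      "\<And>h. 0 < h \<Longrightarrow> h < d2 \<Longrightarrow> norm (integral {-t..-t + h} (\<lambda>x. f (- x)) /\<^sub>R h - f t) < e"
      using N2(2)[OF \<open>-t \<notin> N2\<close> e] by auto
    have scale: "norm (I - h *\<^sub>R D) \<le> e * h" if "0 < h" "norm (I /\<^sub>R h - D) < e" for I D :: 'v and h
    proof -
      have "I - h *\<^sub>R D = h *\<^sub>R (I /\<^sub>R h - D)" using that by (simp add: scaleR_diff_right)
      then have "norm (I - h *\<^sub>R D) = h * norm (I /\<^sub>R h - D)" using that by simp
      then show ?thesis using that by (simp add: mult.commute)
    qed
    show "\<exists>d>0. \<forall>y. norm (y - t) < d \<longrightarrow> norm (F y - F t - (y - t) *\<^sub>R f t) \<le> e * norm (y - t)"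
    proof (intro exI[of _ "min d1 d2"] conjI allI impI)
      fix y assume y: "norm (y - t) < min d1 d2"
      consider "y = t" | "t < y" | "y < t" by linarith
      then show "norm (F y - F t - (y - t) *\<^sub>R f t) \<le> e * norm (y - t)"
      proof cases
        case 2
        then show ?thesis using scale[OF _ d1(2)[of "y - t"]] y F[of t y] by simp
      next
        case 3
        have "integral {-t..-y} (\<lambda>x. f (- x)) = F t - F y"
          using F[of y t] 3 Henstock_Kurzweil_Integration.integral_reflect_real[of t y f] by simp
        then have "norm ((F t - F y) - (t - y) *\<^sub>R f t) \<le> e * (t - y)"
          using scale[OF _ d2(2)[of "t - y"]] y 3 by simp
        moreover have "F y - F t - (y - t) *\<^sub>R f t = - ((F t - F y) - (t - y) *\<^sub>R f t)"
          by (simp add: algebra_simps)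
        ultimately show ?thesis using 3 by (metis norm_minus_cancel real_norm_def abs_minus_commute abs_of_pos diff_gt_0_iff_gt)
      qed auto
    qed (use d1 d2 in auto)
  qed (rule bounded_linear_scaleR_left)
  ultimately show ?thesis
    by (intro AE_I'[of "N1 \<union> uminus ` N2"]) (auto simp: negligible_iff_null_sets)
qed

section \<open>Absolutely continuous functions\<close>

text \<open>
  Families are indexed, so that an interval may be repeated when it is degenerate: cutting the
  intervals of a family down to a window produces many degenerate copies, which would collapse
  in a set of pairs.
\<close>

definition nonoverlapping :: "real \<Rightarrow> real \<Rightarrow> 'i set \<Rightarrow> ('i \<Rightarrow> real) \<Rightarrow> ('i \<Rightarrow> real) \<Rightarrow> bool" where
  "nonoverlapping a b I u v \<longleftrightarrow> finite I \<and> (\<forall>i\<in>I. a \<le> u i \<and> u i \<le> v i \<and> v i \<le> b) \<and>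
     (\<forall>i\<in>I. \<forall>j\<in>I. i \<noteq> j \<longrightarrow> {u i<..<v i} \<inter> {u j<..<v j} = {})"

lemma abs_continuous_on_iff:
  "abs_continuous_on a b f \<longleftrightarrow> (\<forall>\<epsilon>>0. \<exists>\<delta>>0. \<forall>P. nonoverlapping a b P fst snd \<longrightarrow>
     (\<Sum>p\<in>P. snd p - fst p) < \<delta> \<longrightarrow> (\<Sum>p\<in>P. norm (f (snd p) - f (fst p))) < \<epsilon>)"
  unfolding abs_continuous_on_def nonoverlapping_def case_prod_beta pairwise_def
  by (simp only: imp_conjL)

lemma sum_nonoverlapping_le_measure:
  assumes I: "nonoverlapping a b I u v" and sub: "\<And>i. i \<in> I \<Longrightarrow> {u i<..<v i} \<subseteq> T"
    and T: "T \<in> lmeasurable"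
  shows "(\<Sum>i\<in>I. v i - u i) \<le> measure lebesgue T"
proof -
  have "(\<Sum>i\<in>I. v i - u i) = (\<Sum>i\<in>I. measure lebesgue {u i<..<v i})"
    using I by (intro sum.cong) (auto simp: nonoverlapping_def)
  also have "\<dots> = measure lebesgue (\<Union>i\<in>I. {u i<..<v i})"
    using I by (intro measure_UNION'[symmetric])
      (simp_all add: nonoverlapping_def pairwise_def disjnt_def)
  also have "\<dots> \<le> measure lebesgue T"
    using I sub T by (intro measure_mono_fmeasurable) (auto simp: nonoverlapping_def)
  finally show ?thesis .
qed

lemma sum_nonoverlapping_le:
  assumes "nonoverlapping a b I u v" "a \<le> b"
  shows "(\<Sum>i\<in>I. v i - u i) \<le> b - a"
proof -
  have "{u i<..<v i} \<subseteq> {a..b}" if "i \<in> I" for i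
    using assms(1) that by (force simp: nonoverlapping_def)
  from sum_nonoverlapping_le_measure[OF assms(1) this] assms(2) show ?thesis by simp
qed

lemma abs_continuous_onE:
  assumes "abs_continuous_on a b f" "\<epsilon> > 0"
  obtains \<delta> where "\<delta> > 0"
    "\<And>P. nonoverlapping a b P fst snd \<Longrightarrow> (\<Sum>p\<in>P. snd p - fst p) < \<delta> \<Longrightarrow>
       (\<Sum>p\<in>P. norm (f (snd p) - f (fst p))) < \<epsilon>"
  using assms unfolding abs_continuous_on_iff by blast

text \<open>
  Passing from indexed families to sets of pairs: dropping the degenerate members
  makes the indexing injective, and degenerate members contribute nothing to either sum.
\<close>

lemma abs_continuous_onD:
  fixes f :: "real \<Rightarrow> 'v::euclidean_space"
  assumes "abs_continuous_on a b f" "\<epsilon> > 0"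
  shows "\<exists>\<delta>>0. \<forall>(I :: 'i set) u v. nonoverlapping a b I u v \<longrightarrow> (\<Sum>i\<in>I. v i - u i) < \<delta> \<longrightarrow>
     (\<Sum>i\<in>I. norm (f (v i) - f (u i))) < \<epsilon>"
proof -
  obtain \<delta> where \<delta>: "\<delta> > 0" and P: "\<And>P. nonoverlapping a b P fst snd \<Longrightarrow>
      (\<Sum>p\<in>P. snd p - fst p) < \<delta> \<Longrightarrow> (\<Sum>p\<in>P. norm (f (snd p) - f (fst p))) < \<epsilon>"
    using abs_continuous_onE[OF assms] by blast
  show ?thesis
  proof (intro exI[of _ \<delta>] conjI allI impI)
    fix I :: "'i set" and u v
    assume I: "nonoverlapping a b I u v" and sum: "(\<Sum>i\<in>I. v i - u i) < \<delta>"
    have fin: "finite I" and uv: "\<And>i. i \<in> I \<Longrightarrow> a \<le> u i \<and> u i \<le> v i \<and> v i \<le> b"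
      and disj: "\<And>i j. i \<in> I \<Longrightarrow> j \<in> I \<Longrightarrow> i \<noteq> j \<Longrightarrow> {u i<..<v i} \<inter> {u j<..<v j} = {}"
      using I unfolding nonoverlapping_def by blast+
    define J where "J = {i \<in> I. u i < v i}"
    have J: "finite J" "J \<subseteq> I" using fin by (auto simp: J_def)
    have inj: "inj_on (\<lambda>i. (u i, v i)) J"
    proof (rule inj_onI)
      fix i j assume ij: "i \<in> J" "j \<in> J" "(u i, v i) = (u j, v j)"
      then have "{u i<..<v i} \<inter> {u j<..<v j} \<noteq> {}" by (auto simp: J_def)
      then show "i = j" using disj ij J by blast
    qed
    have red: "(\<Sum>i\<in>I. g (u i) (v i)) = (\<Sum>p\<in>(\<lambda>i. (u i, v i)) ` J. g (fst p) (snd p))"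
      if "\<And>s. g s s = 0" for g :: "real \<Rightarrow> real \<Rightarrow> real"
    proof -
      have "(\<Sum>i\<in>I. g (u i) (v i)) = (\<Sum>i\<in>J. g (u i) (v i))"
      proof (rule sum.mono_neutral_right)
        show "\<forall>i\<in>I - J. g (u i) (v i) = 0"
        proof
          fix i assume "i \<in> I - J"
          then have "u i = v i" using uv[of i] by (auto simp: J_def)
          then show "g (u i) (v i) = 0" by (simp add: that)
        qed
      qed (use fin J in auto)
      also have "\<dots> = (\<Sum>p\<in>(\<lambda>i. (u i, v i)) ` J. g (fst p) (snd p))"
        by (subst sum.reindex[OF inj]) simp
      finally show ?thesis .
    qed
    have "(\<Sum>p\<in>(\<lambda>i. (u i, v i)) ` J. norm (f (snd p) - f (fst p))) < \<epsilon>"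
    proof (rule P)
      show "nonoverlapping a b ((\<lambda>i. (u i, v i)) ` J) fst snd"
        unfolding nonoverlapping_def
      proof (intro conjI ballI impI)
        fix p q assume pq: "p \<in> (\<lambda>i. (u i, v i)) ` J" "q \<in> (\<lambda>i. (u i, v i)) ` J" "p \<noteq> q"
        then obtain i j where "p = (u i, v i)" "q = (u j, v j)" "i \<in> I" "j \<in> I" "i \<noteq> j"
          using J by auto
        then show "{fst p<..<snd p} \<inter> {fst q<..<snd q} = {}"
          using disj by simp
      qed (use J uv in auto)
    qed (use sum red[of "\<lambda>s t. t - s"] in auto)
    then show "(\<Sum>i\<in>I. norm (f (v i) - f (u i))) < \<epsilon>"
      using red[of "\<lambda>s t. norm (f t - f s)"] by simp
  qed (rule \<delta>)
qed

lemma abs_continuous_on_dominated: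
  fixes f :: "real \<Rightarrow> 'v::euclidean_space" and g :: "real \<Rightarrow> 'w::euclidean_space"
  assumes f: "abs_continuous_on a b f" and sub: "a \<le> c" "d \<le> b"
    and le: "\<And>u v. c \<le> u \<Longrightarrow> u \<le> v \<Longrightarrow> v \<le> d \<Longrightarrow> norm (g v - g u) \<le> norm (f v - f u)"
  shows "abs_continuous_on c d g"
  unfolding abs_continuous_on_iff
proof (intro allI impI)
  fix \<epsilon> :: real assume e: "\<epsilon> > 0"
  obtain \<delta> where \<delta>: "\<delta> > 0" and P: "\<And>P. nonoverlapping a b P fst snd \<Longrightarrow>
      (\<Sum>p\<in>P. snd p - fst p) < \<delta> \<Longrightarrow> (\<Sum>p\<in>P. norm (f (snd p) - f (fst p))) < \<epsilon>"
    using abs_continuous_onE[OF f e] by blast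
  show "\<exists>\<delta>>0. \<forall>P. nonoverlapping c d P fst snd \<longrightarrow> (\<Sum>p\<in>P. snd p - fst p) < \<delta> \<longrightarrow>
      (\<Sum>p\<in>P. norm (g (snd p) - g (fst p))) < \<epsilon>"
  proof (intro exI[of _ \<delta>] conjI allI impI)
    fix P assume *: "nonoverlapping c d P fst snd" "(\<Sum>p\<in>P. snd p - fst p) < \<delta>"
    have "nonoverlapping a b P fst snd"
      using *(1) sub unfolding nonoverlapping_def by (meson order_trans)
    then have "(\<Sum>p\<in>P. norm (f (snd p) - f (fst p))) < \<epsilon>" by (intro P *)
    moreover have "(\<Sum>p\<in>P. norm (g (snd p) - g (fst p))) \<le> (\<Sum>p\<in>P. norm (f (snd p) - f (fst p)))"
      using * by (intro sum_mono le) (auto simp: nonoverlapping_def)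
    ultimately show "(\<Sum>p\<in>P. norm (g (snd p) - g (fst p))) < \<epsilon>" by linarith
  qed (rule \<delta>)
qed

lemma abs_continuous_on_cong:
  assumes "\<And>t. t \<in> {a..b} \<Longrightarrow> f t = g t"
  shows "abs_continuous_on a b f \<longleftrightarrow> abs_continuous_on a b g"
  using abs_continuous_on_dominated[of a b f a b g] abs_continuous_on_dominated[of a b g a b f]
  by (auto simp: assms)

lemma abs_continuous_on_add:
  fixes f g :: "real \<Rightarrow> 'v::euclidean_space"
  assumes "abs_continuous_on a b f" "abs_continuous_on a b g"
  shows "abs_continuous_on a b (\<lambda>t. f t + g t)"
  unfolding abs_continuous_on_iff
proof (intro allI impI)
  fix \<epsilon> :: real assume "\<epsilon> > 0"
  then have e: "\<epsilon> / 2 > 0" by simp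
  obtain \<delta>1 where \<delta>1: "\<delta>1 > 0" and P1: "\<And>P. nonoverlapping a b P fst snd \<Longrightarrow>
      (\<Sum>p\<in>P. snd p - fst p) < \<delta>1 \<Longrightarrow> (\<Sum>p\<in>P. norm (f (snd p) - f (fst p))) < \<epsilon> / 2"
    using abs_continuous_onE[OF assms(1) e] by blast
  obtain \<delta>2 where \<delta>2: "\<delta>2 > 0" and P2: "\<And>P. nonoverlapping a b P fst snd \<Longrightarrow>
      (\<Sum>p\<in>P. snd p - fst p) < \<delta>2 \<Longrightarrow> (\<Sum>p\<in>P. norm (g (snd p) - g (fst p))) < \<epsilon> / 2"
    using abs_continuous_onE[OF assms(2) e] by blast
  have le: "(\<Sum>p\<in>P. norm ((f (snd p) + g (snd p)) - (f (fst p) + g (fst p))))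
      \<le> (\<Sum>p\<in>P. norm (f (snd p) - f (fst p))) + (\<Sum>p\<in>P. norm (g (snd p) - g (fst p)))" for P
    unfolding sum.distrib[symmetric]
    by (intro sum_mono) (metis add_diff_add norm_triangle_ineq)
  show "\<exists>\<delta>>0. \<forall>P. nonoverlapping a b P fst snd \<longrightarrow> (\<Sum>p\<in>P. snd p - fst p) < \<delta> \<longrightarrow>
      (\<Sum>p\<in>P. norm ((f (snd p) + g (snd p)) - (f (fst p) + g (fst p)))) < \<epsilon>"
  proof (intro exI[of _ "min \<delta>1 \<delta>2"] conjI allI impI)
    fix P assume "nonoverlapping a b P fst snd" "(\<Sum>p\<in>P. snd p - fst p) < min \<delta>1 \<delta>2"
    then show "(\<Sum>p\<in>P. norm ((f (snd p) + g (snd p)) - (f (fst p) + g (fst p)))) < \<epsilon>"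
      using le[of P] P1[of P] P2[of P] by linarith
  qed (use \<delta>1 \<delta>2 in auto)
qed

lemma abs_continuous_on_imp_continuous_on:
  fixes f :: "real \<Rightarrow> 'v::euclidean_space"
  assumes "abs_continuous_on a b f"
  shows "continuous_on {a..b} f"
  unfolding continuous_on_iff
proof (intro ballI allI impI)
  fix t e :: real assume t: "t \<in> {a..b}" and e: "e > 0"
  obtain \<delta> where \<delta>: "\<delta> > 0" and P: "\<And>P. nonoverlapping a b P fst snd \<Longrightarrow>
      (\<Sum>p\<in>P. snd p - fst p) < \<delta> \<Longrightarrow> (\<Sum>p\<in>P. norm (f (snd p) - f (fst p))) < e"
    using abs_continuous_onE[OF assms e] by blast
  have "dist (f s) (f t) < e" if "s \<in> {a..b}" "dist s t < \<delta>" for s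
  proof (cases "s \<le> t")
    case True
    then show ?thesis using P[of "{(s, t)}"] that t
      by (simp add: nonoverlapping_def dist_norm norm_minus_commute)
  next
    case False
    then show ?thesis using P[of "{(t, s)}"] that t by (simp add: nonoverlapping_def dist_norm)
  qed
  then show "\<exists>d>0. \<forall>s\<in>{a..b}. dist s t < d \<longrightarrow> dist (f s) (f t) < e"
    using \<delta> by blast
qed

section \<open>Differentiability almost everywhere\<close>

text \<open>
  The Stieltjes measure of a monotone absolutely continuous function vanishes on Lebesgue null
  sets: such a set is covered by countably many nonoverlapping intervals of small total length,
  on which the function grows little. By Radon-Nikodym the function is the indefinite integral
  of a density, and Lebesgue differentiation applies.
\<close>

lemma monotone_abs_continuous_on_imp_AE_differentiable:
  fixes G :: "real \<Rightarrow> real"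
  assumes cd: "c < d" and ac: "abs_continuous_on c d G"
    and mono: "\<And>s t. c \<le> s \<Longrightarrow> s \<le> t \<Longrightarrow> t \<le> d \<Longrightarrow> G s \<le> G t"
  shows "AE t in lebesgue. t \<in> {c<..<d} \<longrightarrow> G differentiable (at t)"
proof -
  \<comment> \<open>extension by constants, so that the Stieltjes measure lives on \<open>{c<..d}\<close>\<close>
  define H where "H t = G (max c (min d t))" for t
  have monoH: "H s \<le> H t" if "s \<le> t" for s t
    unfolding H_def using that cd by (intro mono max.mono min.mono order_refl) (simp_all add: max.coboundedI1)
  have contH: "continuous_on UNIV H"
    unfolding H_def
  proof (rule continuous_on_compose2[OF abs_continuous_on_imp_continuous_on[OF ac]])
    show "continuous_on UNIV (\<lambda>t. max c (min d t))" by (intro continuous_intros)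
    show "range (\<lambda>t. max c (min d t)) \<subseteq> {c..d}" using cd by (simp add: image_subset_iff)
  qed
  have rcontH: "continuous (at_right t) H" for t
    by (rule continuous_at_imp_continuous_at_within) (use contH in \<open>simp add: continuous_on_eq_continuous_at\<close>)
  define \<mu> where "\<mu> = interval_measure H"
  have sets\<mu> [measurable_cong]: "sets \<mu> = sets borel" by (simp add: \<mu>_def)
  have Ioc: "emeasure \<mu> {u<..v} = ennreal (H v - H u)" if "u \<le> v" for u v
    unfolding \<mu>_def using emeasure_interval_measure_Ioc[OF that monoH rcontH] .
  have Icc: "emeasure \<mu> {u..v} = ennreal (H v - H u)" if "u \<le> v" for u v
    unfolding \<mu>_def using emeasure_interval_measure_Icc[OF that monoH contH] .
  have outside: "emeasure \<mu> (- {c<..d}) = 0"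
  proof -
    have "{- real n<..c} \<in> null_sets \<mu>" "{d<..real n} \<in> null_sets \<mu>" for n
    proof -
      have "emeasure \<mu> {u<..v} = 0" if "u \<ge> d \<or> v \<le> c" for u v
      proof (cases "u \<le> v")
        case True
        then have "H v = H u" using that cd by (auto simp: H_def)
        then show ?thesis using Ioc[OF True] by simp
      qed auto
      then show "{- real n<..c} \<in> null_sets \<mu>" "{d<..real n} \<in> null_sets \<mu>"
        by (auto simp: null_sets_def sets\<mu>)
    qed
    then have nl: "(\<Union>n. {- real n<..c}) \<union> (\<Union>n. {d<..real n}) \<in> null_sets \<mu>"
      by (intro null_sets.Un null_sets_UN) auto
    have sub: "- {c<..d} \<subseteq> (\<Union>n. {- real n<..c}) \<union> (\<Union>n. {d<..real n})"
    proof
      fix t assume t: "t \<in> - {c<..d}"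
      obtain n where n: "real n > \<bar>t\<bar>" using reals_Archimedean2 by blast
      show "t \<in> (\<Union>n. {- real n<..c}) \<union> (\<Union>n. {d<..real n})"
        using t n by (cases "t \<le> c") (auto intro!: exI[of _ n])
    qed
    have "- {c<..d} \<in> null_sets \<mu>"
      by (rule null_sets_subset[OF nl _ sub]) (simp add: sets\<mu>)
    then show ?thesis by auto
  qed
  have "absolutely_continuous lborel \<mu>"
    unfolding absolutely_continuous_def
  proof
    fix N :: "real set" assume N: "N \<in> null_sets lborel"
    then have Nb: "N \<in> sets borel" "emeasure lborel N = 0" by auto
    have "emeasure \<mu> (N \<inter> {c..d}) \<le> 0 + ennreal e" if e: "e > 0" for e
    proof -
      obtain \<delta> where \<delta>: "\<delta> > 0" "\<And>(I :: real set set) u v. nonoverlapping c d I u v \<Longrightarrow>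
          (\<Sum>i\<in>I. v i - u i) < \<delta> \<Longrightarrow> (\<Sum>i\<in>I. norm (G (v i) - G (u i))) < e"
        using abs_continuous_onD[OF ac e] by blast
      obtain U where U: "open U" "N \<subseteq> U" "emeasure lborel (U - N) < \<delta>"
        using outer_regular_lborel[OF Nb(1) \<delta>(1)] .
      have "emeasure lborel U \<le> emeasure lborel (U - N) + emeasure lborel N"
        using U Nb by (intro order_trans[OF emeasure_mono emeasure_subadditive]) auto
      then have em: "emeasure lebesgue U < ennreal \<delta>" using U Nb by simp
      have fm: "U \<in> lmeasurable" using U(1) less_trans[OF em ennreal_less_top] by (intro fmeasurableI) auto
      have lU: "U \<in> lmeasurable" "measure lebesgue U < \<delta>"
        using fm em \<delta>(1) by (auto simp: emeasure_eq_measure2 ennreal_less_iff)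
      have "\<forall>x\<in>N. \<exists>r>0. ball x r \<subseteq> U" using U open_contains_ball by blast
      then obtain r where r: "\<And>x. x \<in> N \<Longrightarrow> r x > 0 \<and> ball x (r x) \<subseteq> U" by metis
      \<comment> \<open>the gauge forces the covering intervals into the open set \<open>U\<close>\<close>
      define g where "g x = (if x \<in> N then ball x (r x) else ball x 1)" for x
      have g: "gauge g" using r by (auto simp: gauge_def g_def)
      have sub: "N \<inter> {c..d} \<subseteq> cbox c d" "box c d \<noteq> {}" using cd by (auto simp: box_real)
      obtain \<D> where \<D>: "countable \<D>"  "\<Union>\<D> \<subseteq> cbox c d"
        and cbox: "\<And>K. K \<in> \<D> \<Longrightarrow> interior K \<noteq> {} \<and> (\<exists>u v. K = cbox u v)"
        and disj: "pairwise (\<lambda>A B. interior A \<inter> interior B = {}) \<D>"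
        and fine: "\<And>K. K \<in> \<D> \<Longrightarrow> \<exists>x \<in> (N \<inter> {c..d}) \<inter> K. K \<subseteq> g x"
        and covers: "N \<inter> {c..d} \<subseteq> \<Union>\<D>"
        by (rule covering_lemma[OF sub g]) (rule that, assumption+)
      have "\<forall>K\<in>\<D>. \<exists>u v. {u..v} = K \<and> u < v"
      proof
        fix K assume "K \<in> \<D>"
        from cbox[OF this] obtain u v where uv: "{u..v} = K" "interior K \<noteq> {}" by (auto simp: box_real)
        then have "interior {u..v} \<noteq> {}" by blast
        then have "u < v" by (auto simp: interior_atLeastAtMost_real)
        with uv show "\<exists>u v. {u..v} = K \<and> u < v" by blast
      qed
      then obtain u v where uv: "\<And>K. K \<in> \<D> \<Longrightarrow> {u K..v K} = K" "\<And>K. K \<in> \<D> \<Longrightarrow> u K < v K" by metis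
      have ints: "interior K = {u K<..<v K}" if "K \<in> \<D>" for K
        using interior_atLeastAtMost_real[of "u K" "v K"] unfolding uv(1)[OF that] .
      have Kb: "K \<in> sets \<mu>" if "K \<in> \<D>" for K
        unfolding sets\<mu> using uv(1)[OF that] by (metis atLeastAtMost_borel)
      have finite_bound: "emeasure \<mu> (\<Union>F) \<le> ennreal e" if F: "finite F" "F \<subseteq> \<D>" for F
      proof -
        have cd': "c \<le> u K \<and> u K \<le> v K \<and> v K \<le> d" if "K \<in> F" for K
        proof -
          have K: "K \<in> \<D>" using that F by auto
          have "K \<subseteq> {c..d}" using K \<D>(2) by (auto simp: box_real)
          then have "{u K..v K} \<subseteq> {c..d}" unfolding uv(1)[OF K] .
          with uv(2)[OF K] show ?thesis by auto
        qed
        have dj: "{u K<..<v K} \<inter> {u K'<..<v K'} = {}" if "K \<in> F" "K' \<in> F" "K \<noteq> K'" for K K'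
        proof -
          have "interior K \<inter> interior K' = {}" using disj that F by (auto simp: pairwise_def)
          moreover have "interior K = {u K<..<v K}" "interior K' = {u K'<..<v K'}"
            using ints that F by blast+
          ultimately show ?thesis by simp
        qed
        have inU: "{u K<..<v K} \<subseteq> U" if "K \<in> F" for K
        proof -
          have "K \<in> \<D>" using that F by auto
          from fine[OF this] obtain x where "x \<in> N" "K \<subseteq> g x" by blast
          then have "K \<subseteq> U" using r by (auto simp: g_def)
          moreover have "{u K<..<v K} \<subseteq> K"
            using interior_subset[of K] unfolding ints[OF \<open>K \<in> \<D>\<close>] .
          ultimately show ?thesis by blast
        qed
        have no: "nonoverlapping c d F u v"
          unfolding nonoverlapping_def using F(1) cd' dj by blast
        have "(\<Sum>K\<in>F. v K - u K) \<le> measure lebesgue U"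
          using sum_nonoverlapping_le_measure[OF no inU lU(1)] .
        then have "(\<Sum>K\<in>F. v K - u K) < \<delta>" using lU by simp
        from \<delta>(2)[OF no this] have le: "(\<Sum>K\<in>F. norm (G (v K) - G (u K))) < e" .
        have "emeasure \<mu> (\<Union>F) \<le> (\<Sum>K\<in>F. emeasure \<mu> K)"
          using emeasure_subadditive_finite[of F "\<lambda>K. K" \<mu>] F Kb by auto
        also have "\<dots> = (\<Sum>K\<in>F. ennreal (norm (G (v K) - G (u K))))"
        proof (rule sum.cong)
          fix K assume K: "K \<in> F"
          have "emeasure \<mu> K = ennreal (H (v K) - H (u K))" 
            using uv[of K] K F Icc[of "u K" "v K"] by auto
          also have "H (v K) - H (u K) = norm (G (v K) - G (u K))"
            using cd'[OF K] mono[of "u K" "v K"] by (simp add: H_def)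
          finally show "emeasure \<mu> K = ennreal (norm (G (v K) - G (u K)))" .
        qed simp
        also have "\<dots> = ennreal (\<Sum>K\<in>F. norm (G (v K) - G (u K)))" by simp
        also have "\<dots> \<le> ennreal e" using le by (intro ennreal_leI) simp
        finally show ?thesis .
      qed
      have "emeasure \<mu> (\<Union>\<D>) \<le> ennreal e"
      proof (cases "\<D> = {}")
        case False
        define E where "E = from_nat_into \<D>"
        have E: "range E = \<D>" unfolding E_def using False \<D>(1) by (rule range_from_nat_into)
        have Es: "E n \<in> sets \<mu>" for n
          using E Kb by blast
        have "emeasure \<mu> (\<Union>\<D>) = emeasure \<mu> (\<Union>n. \<Union>i\<le>n. E i)"
          unfolding E[symmetric] by (intro arg_cong[where f="emeasure \<mu>"]) auto
        also have "\<dots> = (SUP n. emeasure \<mu> (\<Union>i\<le>n. E i))"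
          using Es by (intro SUP_emeasure_incseq[symmetric]) (force simp: incseq_def)+
        also have "\<dots> \<le> ennreal e"
          using E by (intro SUP_least finite_bound) auto
        finally show ?thesis .
      qed simp
      moreover have "\<Union>\<D> \<in> sets \<mu>"
        using \<D>(1) Kb by (intro sets.countable_Union) auto
      ultimately show ?thesis using covers by (auto intro: order_trans[OF emeasure_mono])
    qed
    then have "emeasure \<mu> (N \<inter> {c..d}) = 0"
      using ennreal_le_epsilon[of 0 "emeasure \<mu> (N \<inter> {c..d})"] by auto
    then have nl: "(N \<inter> {c..d}) \<union> - {c<..d} \<in> null_sets \<mu>"
      using outside Nb by (intro null_sets.Un) (auto simp: null_sets_def sets\<mu>)
    show "N \<in> null_sets \<mu>"
      by (rule null_sets_subset[OF nl]) (use Nb in \<open>auto simp: sets\<mu>\<close>)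
  qed
  then obtain f where f [measurable]: "f \<in> borel_measurable lborel" and dens: "density lborel f = \<mu>"
    using sigma_finite_measure.Radon_Nikodym[OF sigma_finite_lborel, of \<mu>] by (auto simp: sets\<mu>)
  have fin: "AE s in lborel. f s \<noteq> \<infinity>"
    using sigma_finite_measure.sigma_finite_iff_density_finite[OF sigma_finite_lborel f] sigma_finite_interval_measure[OF monoH rcontH]
    by (simp add: dens \<mu>_def)
  define g where "g s = enn2real (f s)" for s
  have gm [measurable]: "g \<in> borel_measurable lborel" unfolding g_def by measurable
  have gint: "set_integrable lborel {p<..q} g \<and> (LINT s:{p<..q}|lborel. g s) = H q - H p"
    if "p \<le> q" for p q
  proof -
    have "(\<integral>\<^sup>+ s. ennreal (indicator {p<..q} s *\<^sub>R g s) \<partial>lborel) = (\<integral>\<^sup>+ s. f s * indicator {p<..q} s \<partial>lborel)"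
      using fin by (intro nn_integral_cong_AE) (auto elim!: eventually_mono simp: g_def less_top indicator_def)
    also have "\<dots> = emeasure \<mu> {p<..q}" by (simp add: dens[symmetric] emeasure_density)
    also have "\<dots> = ennreal (H q - H p)" using Ioc[OF that] .
    finally have nn: "(\<integral>\<^sup>+ s. ennreal (indicator {p<..q} s *\<^sub>R g s) \<partial>lborel) = ennreal (H q - H p)" .
    have nonneg: "0 \<le> indicator {p<..q} s *\<^sub>R g s" for s by (simp add: g_def)
    have "integrable lborel (\<lambda>s. indicator {p<..q} s *\<^sub>R g s)"
      using nn nonneg by (intro integrableI_nonneg) auto
    moreover have "(LINT s|lborel. indicator {p<..q} s *\<^sub>R g s) = H q - H p"
      using nn nonneg monoH[OF that] by (intro integral_eq_nn_integral[THEN trans]) auto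
    ultimately show ?thesis by (simp add: set_integrable_def set_lebesgue_integral_def)
  qed
  have hint: "(g has_integral H q - H p) {p..q}" if "p \<le> q" for p q
  proof -
    have "(g has_integral H q - H p) {p<..q}"
      using gint[OF that] set_borel_integral_eq_integral[of "{p<..q}" g] by (metis integrable_integral)
    moreover have "negligible {x \<in> {p<..q} - {p..q}. g x \<noteq> 0}" "negligible {x \<in> {p..q} - {p<..q}. g x \<noteq> 0}"
      by (rule negligible_subset[of "{p}"]; force)+
    ultimately show ?thesis using has_integral_spike_set_eq by blast
  qed
  have "AE t in lebesgue. (H has_vector_derivative g t) (at t)"
  proof (rule lebesgue_differentiation)
    show "g integrable_on {p..q}" for p q
      using hint[of p q] by (cases "p \<le> q") auto
  qed (use hint in \<open>simp add: integral_unique[symmetric]\<close>)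
  then show ?thesis
  proof (rule AE_mp, intro AE_I2 impI)
    fix t assume Ht: "(H has_vector_derivative g t) (at t)" and t: "t \<in> {c<..<d}"
    have "(G has_vector_derivative g t) (at t)"
      by (rule has_vector_derivative_transform_within_open[OF Ht open_greaterThanLessThan t]) (simp add: H_def)
    then show "G differentiable (at t)"
      unfolding has_vector_derivative_def by (rule differentiableI)
  qed
qed

lemma nonoverlapping_shrink:
  assumes "nonoverlapping a b I u v"
    and "\<And>i. i \<in> I \<Longrightarrow> c \<le> u' i \<and> u' i \<le> v' i \<and> v' i \<le> d"
    and sub: "\<And>i. i \<in> I \<Longrightarrow> {u' i<..<v' i} \<subseteq> {u i<..<v i}"
  shows "nonoverlapping c d I u' v'"
proof -
  have "{u' i<..<v' i} \<inter> {u' j<..<v' j} = {}" if "i \<in> I" "j \<in> I" "i \<noteq> j" for i j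
    using sub[OF that(1)] sub[OF that(2)] assms(1) that unfolding nonoverlapping_def by blast
  moreover have "finite I" using assms(1) by (simp add: nonoverlapping_def)
  ultimately show ?thesis using assms(2) unfolding nonoverlapping_def by (intro conjI ballI impI) simp_all
qed

text \<open>
  \<open>V t\<close> is the variation of \<open>F\<close> over \<open>{c..t}\<close>: the supremum of the sums of increments of \<open>F\<close>
  over nonoverlapping families whose intervals are cut off at \<open>t\<close>. The inequality in
  the conclusion makes both \<open>V\<close> and \<open>V - F\<close> monotone. The bound by \<open>1\<close> on the sums,
  which makes the supremum finite, holds on every short enough interval.
\<close>

lemma abs_continuous_on_jordan_short:
  fixes F :: "real \<Rightarrow> real"
  assumes cd: "c \<le> d" and ac: "abs_continuous_on c d F"
    and bound: "\<And>(I :: nat set) u v. nonoverlapping c d I u v \<Longrightarrow> (\<Sum>i\<in>I. \<bar>F (v i) - F (u i)\<bar>) \<le> 1"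
  obtains V where "abs_continuous_on c d V"
    "\<And>s t. c \<le> s \<Longrightarrow> s \<le> t \<Longrightarrow> t \<le> d \<Longrightarrow> V s + \<bar>F t - F s\<bar> \<le> V t"
proof -
  define Fam :: "(nat \<times> (nat \<Rightarrow> real) \<times> (nat \<Rightarrow> real)) set"
    where "Fam = {(n, u, v). nonoverlapping c d {..<n} u v}"
  \<comment> \<open>cutting off at \<open>t\<close> instead of restricting the families makes \<open>Fam\<close> independent of \<open>t\<close>\<close>
  define S where "S = (\<lambda>(n, u, v) t. \<Sum>i<(n::nat). \<bar>F (min (v i) t) - F (min (u i) t)\<bar>)"
  define V where "V t = (SUP \<phi>\<in>Fam. S \<phi> t)" for t
  have S_le: "S \<phi> t \<le> 1" if \<phi>: "\<phi> \<in> Fam" and t: "c \<le> t" "t \<le> d" for \<phi> t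
  proof -
    obtain n u v where \<phi>: "\<phi> = (n, u, v)" and no: "nonoverlapping c d {..<n} u v"
      using \<phi> by (auto simp: Fam_def)
    have "nonoverlapping c d {..<n} (\<lambda>i. min (u i) t) (\<lambda>i. min (v i) t)"
    proof (rule nonoverlapping_shrink[OF no])
      fix i assume "i \<in> {..<n}"
      then have "c \<le> u i" "u i \<le> v i" "v i \<le> d" using no by (auto simp: nonoverlapping_def)
      then show "c \<le> min (u i) t \<and> min (u i) t \<le> min (v i) t \<and> min (v i) t \<le> d"
        "{min (u i) t<..<min (v i) t} \<subseteq> {u i<..<v i}"
        using t by (auto simp: min_def)
    qed
    from bound[OF this] show ?thesis by (simp add: S_def \<phi>)
  qed
  have bdd: "bdd_above ((\<lambda>\<phi>. S \<phi> t) ` Fam)" if "c \<le> t" "t \<le> d" for t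
    using S_le that by (intro bdd_aboveI[of _ 1]) auto
  have "(0, (\<lambda>_. c), (\<lambda>_. c)) \<in> Fam" by (simp add: Fam_def nonoverlapping_def)
  then have ne: "Fam \<noteq> {}" by blast
  have V_upper: "S \<phi> t \<le> V t" if "\<phi> \<in> Fam" "c \<le> t" "t \<le> d" for \<phi> t
    unfolding V_def using bdd that by (intro cSUP_upper) auto
  have step: "V s + \<bar>F t - F s\<bar> \<le> V t" if st: "c \<le> s" "s \<le> t" "t \<le> d" for s t
  proof -
    have "S \<phi> s \<le> V t - \<bar>F t - F s\<bar>" if \<phi>F: "\<phi> \<in> Fam" for \<phi>
    proof -
      obtain n u v where \<phi>: "\<phi> = (n, u, v)" and no: "nonoverlapping c d {..<n} u v"
        using \<phi>F by (auto simp: Fam_def)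
      have uv: "c \<le> u i \<and> u i \<le> v i \<and> v i \<le> d" if "i < n" for i
        using no that by (simp add: nonoverlapping_def)
      \<comment> \<open>cut the family off at \<open>s\<close> and append the interval \<open>{s..t}\<close>\<close>
      define u' v' where "u' i = (if i < n then min (u i) s else s)"
        and "v' i = (if i < n then min (v i) s else t)" for i
      have no': "nonoverlapping c d {..<n} u' v'"
      proof (rule nonoverlapping_shrink[OF no])
        fix i assume i: "i \<in> {..<n}"
        then have "c \<le> u i" "u i \<le> v i" "v i \<le> d" using no by (auto simp: nonoverlapping_def)
        then show "c \<le> u' i \<and> u' i \<le> v' i \<and> v' i \<le> d" "{u' i<..<v' i} \<subseteq> {u i<..<v i}"
          using st i by (auto simp: u'_def v'_def min_def)
      qed
      have "nonoverlapping c d {..<Suc n} u' v'"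
        unfolding nonoverlapping_def
      proof (intro conjI ballI impI)
        fix i assume "i \<in> {..<Suc n}"
        then show "c \<le> u' i" "u' i \<le> v' i" "v' i \<le> d"
          using no' st by (cases "i = n"; force simp: nonoverlapping_def u'_def v'_def)+
      next
        fix i j assume ij: "i \<in> {..<Suc n}" "j \<in> {..<Suc n}" "i \<noteq> j"
        have below: "{u' k<..<v' k} \<subseteq> {..<s}" if "k < n" for k
          using that by (auto simp: v'_def)
        have last: "{u' n<..<v' n} = {s<..<t}" by (simp add: u'_def v'_def)
        consider "i < n" "j < n" | "i = n" "j < n" | "i < n" "j = n" using ij by fastforce
        then show "{u' i<..<v' i} \<inter> {u' j<..<v' j} = {}"
        proof cases
          case 1
          then show ?thesis using no' ij(3) unfolding nonoverlapping_def by blast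
        next
          case 2
          then show ?thesis using below[of j] last by fastforce
        next
          case 3
          then show ?thesis using below[of i] last by fastforce
        qed
      qed simp
      then have mem: "(Suc n, u', v') \<in> Fam" by (simp add: Fam_def)
      have "S (Suc n, u', v') t = (\<Sum>i<n. \<bar>F (min (v' i) t) - F (min (u' i) t)\<bar>) + \<bar>F t - F s\<bar>"
        using st by (simp add: S_def u'_def v'_def min_absorb1)
      also have "(\<Sum>i<n. \<bar>F (min (v' i) t) - F (min (u' i) t)\<bar>) = S \<phi> s"
        unfolding S_def \<phi> prod.case using st
        by (intro sum.cong) (auto simp: u'_def v'_def min.assoc min_absorb1)
      finally have "S \<phi> s + \<bar>F t - F s\<bar> = S (Suc n, u', v') t" by simp
      also have "\<dots> \<le> V t" using st by (intro V_upper[OF mem]) auto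
      finally show ?thesis by simp
    qed
    then have "V s \<le> V t - \<bar>F t - F s\<bar>" unfolding V_def[of s] using ne by (intro cSUP_least)
    then show ?thesis by simp
  qed
  have incr: "\<bar>F (min v t) - F (min u t)\<bar> - \<bar>F (min v s) - F (min u s)\<bar>
      \<le> \<bar>F (max s (min v t)) - F (max s (min u t))\<bar>" if "u \<le> v" "s \<le> t" for u v s t
  proof -
    consider "v \<le> s" | "s \<le> u" | "u < s" "s < v" by linarith
    then show ?thesis
    proof cases
      case 1
      then have "min v t = v" "min u t = u" "min v s = v" "min u s = u" using that by linarith+
      then show ?thesis by simp
    next
      case 2
      then have "max s (min v t) = min v t" "max s (min u t) = min u t" using that by linarith+
      then show ?thesis by simp
    next
      case 3
      then have "max s (min v t) = min v t" "max s (min u t) = s" "min u t = u" "min u s = u" "min v s = s"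
        using that by linarith+
      then show ?thesis by simp
    qed
  qed
  have "abs_continuous_on c d V"
    unfolding abs_continuous_on_iff
  proof (intro allI impI)
    fix e :: real assume "e > 0"
    then have e: "e / 2 > 0" by simp
    obtain \<delta> where \<delta>: "\<delta> > 0" "\<And>(I :: ((real \<times> real) \<times> nat) set) u v. nonoverlapping c d I u v \<Longrightarrow>
          (\<Sum>i\<in>I. v i - u i) < \<delta> \<Longrightarrow> (\<Sum>i\<in>I. norm (F (v i) - F (u i))) < e / 2"
      using abs_continuous_onD[OF ac e] by blast
    show "\<exists>\<delta>>0. \<forall>P. nonoverlapping c d P fst snd \<longrightarrow> (\<Sum>p\<in>P. snd p - fst p) < \<delta> \<longrightarrow>
      (\<Sum>p\<in>P. norm (V (snd p) - V (fst p))) < e"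
    proof (intro exI[of _ \<delta>] conjI allI impI)
      fix P assume P: "nonoverlapping c d P fst snd" and len: "(\<Sum>p\<in>P. snd p - fst p) < \<delta>"
      have finP: "finite P" and Pcd: "\<And>p. p \<in> P \<Longrightarrow> c \<le> fst p \<and> fst p \<le> snd p \<and> snd p \<le> d"
        and Pdisj: "\<And>p q. p \<in> P \<Longrightarrow> q \<in> P \<Longrightarrow> p \<noteq> q \<Longrightarrow> {fst p<..<snd p} \<inter> {fst q<..<snd q} = {}"
        using P unfolding nonoverlapping_def by blast+
      \<comment> \<open>tolerance per member of \<open>P\<close>, so that all suprema together lose at most \<open>e / 2\<close>\<close>
      define \<eta> where "\<eta> = e / (2 * (real (card P) + 1))"
      have \<eta>: "\<eta> > 0" using \<open>e > 0\<close> by (simp add: \<eta>_def)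
      have "\<exists>\<phi>\<in>Fam. V (snd p) - \<eta> < S \<phi> (snd p)" if "p \<in> P" for p
        using less_cSUP_iff[OF ne bdd, of "snd p" "V (snd p) - \<eta>"] Pcd[OF that] \<eta>
        by (simp add: V_def)
      then obtain \<phi> where \<phi>: "\<And>p. p \<in> P \<Longrightarrow> \<phi> p \<in> Fam \<and> V (snd p) - \<eta> < S (\<phi> p) (snd p)"
        by metis
      define n u v where "n p = fst (\<phi> p)" and "u p = fst (snd (\<phi> p))" and "v p = snd (snd (\<phi> p))" for p
      have no: "nonoverlapping c d {..<n p} (u p) (v p)" if "p \<in> P" for p
        using \<phi>[OF that] by (auto simp: Fam_def n_def u_def v_def)
      have uv: "u p i \<le> v p i" if "p \<in> P" "i < n p" for p i
        using no[OF that(1)] that(2) by (simp add: nonoverlapping_def)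
      have S: "S (\<phi> p) t = (\<Sum>i<n p. \<bar>F (min (v p i) t) - F (min (u p i) t)\<bar>)" for p t
        by (simp add: S_def n_def u_def v_def split_beta)
      \<comment> \<open>near-optimal families for all members of \<open>P\<close>, each cut down to its window, form one family\<close>
      define u' v' where "u' = (\<lambda>(p, i). max (fst p) (min (u p i) (snd p)))"
        and "v' = (\<lambda>(p, i). max (fst p) (min (v p i) (snd p)))"
      have clip: "fst p \<le> u' (p, i)" "u' (p, i) \<le> v' (p, i)" "v' (p, i) \<le> snd p"
          "{u' (p, i)<..<v' (p, i)} \<subseteq> {u p i<..<v p i}" if "p \<in> P" "i < n p" for p i
        using Pcd[OF that(1)] uv[OF that] by (auto simp: u'_def v'_def max_def min_def)
      have each: "nonoverlapping (fst p) (snd p) {..<n p} (\<lambda>i. u' (p, i)) (\<lambda>i. v' (p, i))" if "p \<in> P" for p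
        by (rule nonoverlapping_shrink[OF no[OF that]]) (use clip[OF that] in auto)
      have all: "nonoverlapping c d (Sigma P (\<lambda>p. {..<n p})) u' v'"
        unfolding nonoverlapping_def
      proof (intro conjI ballI impI)
        show "finite (Sigma P (\<lambda>p. {..<n p}))" using finP by simp
        fix z assume "z \<in> Sigma P (\<lambda>p. {..<n p})"
        then obtain p i where z: "z = (p, i)" "p \<in> P" "i < n p" by auto
        then show "c \<le> u' z" "u' z \<le> v' z" "v' z \<le> d"
          using clip[OF z(2,3)] Pcd[OF z(2)] by auto
      next
        fix z w assume "z \<in> Sigma P (\<lambda>p. {..<n p})" "w \<in> Sigma P (\<lambda>p. {..<n p})" and zw: "z \<noteq> w"
        then obtain p i q j where z: "z = (p, i)" "p \<in> P" "i < n p" and w: "w = (q, j)" "q \<in> P" "j < n q"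
          by (elim SigmaE) simp
        show "{u' z<..<v' z} \<inter> {u' w<..<v' w} = {}"
        proof (cases "p = q")
          case True
          then have "i \<noteq> j" using z w zw by auto
          then show ?thesis using each[OF z(2)] z w True unfolding nonoverlapping_def by blast
        next
          case False
          have "{u' z<..<v' z} \<subseteq> {fst p<..<snd p}" "{u' w<..<v' w} \<subseteq> {fst q<..<snd q}"
            using clip(1,3)[OF z(2,3)] clip(1,3)[OF w(2,3)] z w by auto
          then show ?thesis using Pdisj[OF z(2) w(2) False] by blast
        qed
      qed
      have "(\<Sum>z\<in>Sigma P (\<lambda>p. {..<n p}). v' z - u' z) = (\<Sum>p\<in>P. \<Sum>i<n p. v' (p, i) - u' (p, i))"
        using finP by (subst sum.Sigma) auto
      also have "\<dots> \<le> (\<Sum>p\<in>P. snd p - fst p)"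
        using sum_nonoverlapping_le[OF each] Pcd by (intro sum_mono) blast
      also note len
      finally have "(\<Sum>z\<in>Sigma P (\<lambda>p. {..<n p}). norm (F (v' z) - F (u' z))) < e / 2"
        by (intro \<delta>(2)[OF all])
      moreover have "(\<Sum>z\<in>Sigma P (\<lambda>p. {..<n p}). norm (F (v' z) - F (u' z)))
          = (\<Sum>p\<in>P. \<Sum>i<n p. \<bar>F (v' (p, i)) - F (u' (p, i))\<bar>)"
        using finP by (subst sum.Sigma) auto
      moreover have "(\<Sum>p\<in>P. norm (V (snd p) - V (fst p)))
          \<le> (\<Sum>p\<in>P. (\<Sum>i<n p. \<bar>F (v' (p, i)) - F (u' (p, i))\<bar>) + \<eta>)"
      proof (rule sum_mono)
        fix p assume p: "p \<in> P"
        have "V (snd p) - V (fst p) \<le> S (\<phi> p) (snd p) - S (\<phi> p) (fst p) + \<eta>"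
        proof -
          have "S (\<phi> p) (fst p) \<le> V (fst p)" using \<phi>[OF p] Pcd[OF p] by (intro V_upper) auto
          then show ?thesis using \<phi>[OF p] by linarith
        qed
        also have "S (\<phi> p) (snd p) - S (\<phi> p) (fst p) \<le> (\<Sum>i<n p. \<bar>F (v' (p, i)) - F (u' (p, i))\<bar>)"
          unfolding S sum_subtractf[symmetric] u'_def v'_def prod.case
          using uv[OF p] Pcd[OF p] by (intro sum_mono incr) auto
        finally show "norm (V (snd p) - V (fst p)) \<le> (\<Sum>i<n p. \<bar>F (v' (p, i)) - F (u' (p, i))\<bar>) + \<eta>"
          using step[of "fst p" "snd p"] Pcd[OF p] by simp
      qed
      moreover have "(\<Sum>p\<in>P. (\<Sum>i<n p. \<bar>F (v' (p, i)) - F (u' (p, i))\<bar>) + \<eta>)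
          = (\<Sum>p\<in>P. \<Sum>i<n p. \<bar>F (v' (p, i)) - F (u' (p, i))\<bar>) + card P * \<eta>"
        by (simp add: sum.distrib)
      moreover have "card P * \<eta> \<le> e / 2"
        using \<open>e > 0\<close> by (simp add: \<eta>_def field_simps)
      ultimately show "(\<Sum>p\<in>P. norm (V (snd p) - V (fst p))) < e" by linarith
    qed (rule \<delta>)
  qed
  with step show ?thesis by (rule that[rotated])
qed

text \<open>
  Differentiability is a local property, so countably many intervals suffice on which the
  variation is at most \<open>1\<close>; there each coordinate is a difference of two monotone absolutely
  continuous functions.
\<close>

theorem abs_continuous_on_imp_AE_differentiable:
  fixes F :: "real \<Rightarrow> 'v::euclidean_space"
  assumes ab: "a < b" and ac: "abs_continuous_on a b F"
  shows "AE t in lebesgue. t \<in> {a<..<b} \<longrightarrow> F differentiable (at t)"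
proof -
  have real: "AE t in lebesgue. t \<in> {a<..<b} \<longrightarrow> f differentiable (at t)"
    if ac: "abs_continuous_on a b f" for f :: "real \<Rightarrow> real"
  proof -
    obtain \<delta> where \<delta>: "\<delta> > 0" "\<And>(I :: nat set) u v. nonoverlapping a b I u v \<Longrightarrow>
          (\<Sum>i\<in>I. v i - u i) < \<delta> \<Longrightarrow> (\<Sum>i\<in>I. norm (f (v i) - f (u i))) < 1"
      using abs_continuous_onD[OF ac zero_less_one] by blast
    have short: "AE t in lebesgue. t \<in> {c<..<d} \<longrightarrow> f differentiable (at t)"
      if cd: "a \<le> c" "d \<le> b" "d - c < \<delta>" for c d
    proof (cases "c < d")
      case True
      have ac': "abs_continuous_on c d f"
        by (rule abs_continuous_on_dominated[OF ac]) (use cd in auto)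
      have "(\<Sum>i\<in>I. \<bar>f (v i) - f (u i)\<bar>) \<le> 1" if no: "nonoverlapping c d I u v" for I :: "nat set" and u v
      proof -
        have "nonoverlapping a b I u v"
          using no cd by (intro nonoverlapping_shrink[OF no]) (auto simp: nonoverlapping_def)
        moreover have "(\<Sum>i\<in>I. v i - u i) < \<delta>"
          using sum_nonoverlapping_le[OF no] True cd by linarith
        ultimately show ?thesis using \<delta>(2) by (simp add: less_imp_le)
      qed
      then obtain V where V: "abs_continuous_on c d V"
        "\<And>s t. c \<le> s \<Longrightarrow> s \<le> t \<Longrightarrow> t \<le> d \<Longrightarrow> V s + \<bar>f t - f s\<bar> \<le> V t"
        using abs_continuous_on_jordan_short[OF less_imp_le[OF True] ac'] by blast
      have "abs_continuous_on c d (\<lambda>t. - f t)"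
        by (rule abs_continuous_on_dominated[OF ac']) auto
      from abs_continuous_on_add[OF V(1) this] have ac2: "abs_continuous_on c d (\<lambda>t. V t + - f t)" .
      have "AE t in lebesgue. t \<in> {c<..<d} \<longrightarrow> V differentiable (at t)"
        by (rule monotone_abs_continuous_on_imp_AE_differentiable[OF True V(1)]) (smt (verit) V(2))
      moreover have "AE t in lebesgue. t \<in> {c<..<d} \<longrightarrow> (\<lambda>t. V t + - f t) differentiable (at t)"
        by (rule monotone_abs_continuous_on_imp_AE_differentiable[OF True ac2]) (smt (verit) V(2))
      ultimately show ?thesis
      proof eventually_elim
        case (elim t)
        show ?case
        proof
          assume "t \<in> {c<..<d}"
          then have "(\<lambda>t. V t - (V t + - f t)) differentiable (at t)"
            using elim by (intro differentiable_diff) auto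
          then show "f differentiable (at t)" by simp
        qed
      qed
    qed auto
    \<comment> \<open>intervals shorter than \<open>\<delta>\<close> around the rationals\<close>
    define c d where "c q = max a (q - \<delta> / 3)" and "d q = min b (q + \<delta> / 3)" for q :: real
    have "AE t in lebesgue. t \<in> {c q<..<d q} \<longrightarrow> f differentiable (at t)" for q
      using \<delta>(1) by (intro short) (auto simp: c_def d_def)
    then have "AE t in lebesgue. \<forall>q\<in>\<rat>. t \<in> {c q<..<d q} \<longrightarrow> f differentiable (at t)"
      by (subst AE_ball_countable[OF countable_rat]) blast
    then show ?thesis
    proof (rule AE_mp, intro AE_I2 impI)
      fix t assume *: "\<forall>q\<in>\<rat>. t \<in> {c q<..<d q} \<longrightarrow> f differentiable (at t)" and t: "t \<in> {a<..<b}"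
      obtain q where "q \<in> \<rat>" "t - \<delta> / 3 < q" "q < t + \<delta> / 3"
        using Rats_dense_in_real[of "t - \<delta> / 3" "t + \<delta> / 3"] \<delta>(1) by auto
      then have "q - \<delta> / 3 < t" "t < q + \<delta> / 3" by linarith+
      with * t \<open>q \<in> \<rat>\<close> show "f differentiable (at t)" by (auto simp: c_def d_def)
    qed
  qed
  have "abs_continuous_on a b (\<lambda>t. F t \<bullet> i)" if "i \<in> Basis" for i
    by (rule abs_continuous_on_dominated[OF ac]) (use that in \<open>auto simp flip: inner_diff_left intro: Basis_le_norm\<close>)
  then have "AE t in lebesgue. \<forall>i\<in>Basis. t \<in> {a<..<b} \<longrightarrow> (\<lambda>t. F t \<bullet> i) differentiable (at t)"
    using real by (subst AE_ball_countable) (auto intro: countable_finite)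
  then show ?thesis
    by (rule AE_mp, intro AE_I2 impI) (subst differentiable_componentwise_within, blast)
qed

section \<open>Indefinite integrals\<close>

lemma indefinite_integral_diff:
  fixes f :: "real \<Rightarrow> 'v::euclidean_space"
  assumes f: "integrable lebesgue f" and uv: "u \<le> v"
  shows "(left_frac 1 f v) - (left_frac 1 f u)
    = (LINT s:{u..<v}|lebesgue. f s)"
proof -
  have int: "integrable lebesgue (\<lambda>s. frac_kernel 1 s t *\<^sub>R f s)" for t
    by (rule Bochner_Integration.integrable_bound[OF f]) (use f in \<open>auto simp: frac_kernel_one\<close>)
  have "frac_kernel 1 s v *\<^sub>R f s - frac_kernel 1 s u *\<^sub>R f s = indicator {u..<v} s *\<^sub>R f s" for s
    using uv by (auto simp: frac_kernel_one indicator_def)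
  then show ?thesis
    using Bochner_Integration.integral_diff[OF int int, of v u] by (simp add: set_lebesgue_integral_def)
qed

text \<open>
  Split \<open>norm f\<close> into a part bounded by \<open>N\<close> and a remainder \<open>h\<close> of small integral. The bounded
  part contributes at most \<open>N\<close> times the total length of the family. The remainder contributes
  at most its whole integral, because the intervals are disjoint.
\<close>

lemma indefinite_integral_abs_continuous:
  fixes f :: "real \<Rightarrow> 'v::euclidean_space"
  assumes f: "integrable lebesgue f"
  shows "abs_continuous_on a b (\<lambda>t. LINT s|lebesgue. frac_kernel 1 s t *\<^sub>R f s)"
  unfolding abs_continuous_on_iff
proof (intro allI impI)
  fix e :: real assume e: "e > 0"
  let ?g = "\<lambda>s. norm (f s)"
  have g: "integrable lebesgue ?g" using f by simp
  have [measurable]: "f \<in> borel_measurable lebesgue" using f by auto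
  have trunc: "integrable lebesgue (\<lambda>s. min (?g s) (real n))" for n
    by (rule Bochner_Integration.integrable_bound[OF g]) auto
  have "(\<lambda>n. LINT s|lebesgue. min (?g s) (real n)) \<longlonglongrightarrow> (LINT s|lebesgue. ?g s)"
  proof (rule integral_dominated_convergence[where w="?g"])
    show "AE s in lebesgue. (\<lambda>n. min (?g s) (real n)) \<longlonglongrightarrow> ?g s"
    proof (intro AE_I2)
      fix s
      obtain N where N: "?g s \<le> real N" using real_arch_simple by blast
      have "eventually (\<lambda>n. min (?g s) (real n) = ?g s) sequentially"
        using eventually_ge_at_top[of N] by eventually_elim (use N in \<open>simp add: min_def\<close>)
      then show "(\<lambda>n. min (?g s) (real n)) \<longlonglongrightarrow> ?g s" by (rule tendsto_eventually)
    qed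
  qed (use g in auto)
  then have "eventually (\<lambda>n. dist (LINT s|lebesgue. min (?g s) (real n)) (LINT s|lebesgue. ?g s) < e / 2) sequentially"
    using e by (intro tendstoD) auto
  then obtain N where N: "dist (LINT s|lebesgue. min (?g s) (real N)) (LINT s|lebesgue. ?g s) < e / 2"
    by (auto simp: eventually_sequentially)
  define h where "h s = ?g s - min (?g s) (real N)" for s
  have h: "integrable lebesgue h" "\<And>s. 0 \<le> h s"
    unfolding h_def using g trunc by auto
  have hlt: "(LINT s|lebesgue. h s) < e / 2"
  proof -
    have "(LINT s|lebesgue. h s) = (LINT s|lebesgue. ?g s) - (LINT s|lebesgue. min (?g s) (real N))"
      unfolding h_def using g trunc by (rule Bochner_Integration.integral_diff)
    then show ?thesis using N unfolding dist_real_def by linarith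
  qed
  define \<delta> where "\<delta> = e / (2 * (real N + 1))"
  have \<delta>: "\<delta> > 0" using e by (simp add: \<delta>_def)
  show "\<exists>\<delta>>0. \<forall>P. nonoverlapping a b P fst snd \<longrightarrow> (\<Sum>p\<in>P. snd p - fst p) < \<delta> \<longrightarrow>
      (\<Sum>p\<in>P. norm (left_frac 1 f (snd p) - left_frac 1 f (fst p))) < e"
  proof (intro exI[of _ \<delta>] conjI allI impI)
    fix P assume P: "nonoverlapping a b P fst snd" and len: "(\<Sum>p\<in>P. snd p - fst p) < \<delta>"
    have finP: "finite P" and Pab: "\<And>p. p \<in> P \<Longrightarrow> fst p \<le> snd p"
      and Pdisj: "\<And>p q. p \<in> P \<Longrightarrow> q \<in> P \<Longrightarrow> p \<noteq> q \<Longrightarrow> {fst p<..<snd p} \<inter> {fst q<..<snd q} = {}"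
      using P unfolding nonoverlapping_def by blast+
    let ?I = "\<lambda>p s. indicat_real {fst p..<snd p} s"
    have "disjoint_family_on (\<lambda>p. {fst p..<snd p}) P"
      unfolding disjoint_family_on_def
    proof (intro ballI impI)
      fix p q assume pq: "p \<in> P" "q \<in> P" "p \<noteq> q"
      show "{fst p..<snd p} \<inter> {fst q..<snd q} = {}"
      proof (rule ccontr)
        assume "{fst p..<snd p} \<inter> {fst q..<snd q} \<noteq> {}"
        then obtain s where "s \<in> {fst p..<snd p} \<inter> {fst q..<snd q}" by blast
        then have "fst p \<le> s" "s < snd p" "fst q \<le> s" "s < snd q" by simp_all
        then have "(s + min (snd p) (snd q)) / 2 \<in> {fst p<..<snd p} \<inter> {fst q<..<snd q}"
          by (auto simp: min_def)
        then show False using Pdisj[OF pq] by blast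
      qed
    qed
    note disj = this
    have le1: "(\<Sum>p\<in>P. ?I p s) \<le> 1" for s
    proof -
      have "(\<Sum>p\<in>P. ?I p s) = indicat_real (\<Union>p\<in>P. {fst p..<snd p}) s"
        by (rule indicator_UN_disjoint[OF finP disj, symmetric])
      then show ?thesis by (simp add: indicator_def)
    qed
    have ip: "integrable lebesgue (\<lambda>s. ?I p s * k s)" if "integrable lebesgue k" for p and k :: "real \<Rightarrow> real"
      using integrable_mult_indicator[of "{fst p..<snd p}" lebesgue k] that by simp
    have each: "norm (left_frac 1 f (snd p) - left_frac 1 f (fst p))
        \<le> (LINT s|lebesgue. ?I p s * h s) + real N * (snd p - fst p)" if p: "p \<in> P" for p
    proof -
      have iN: "integrable lebesgue (\<lambda>s. real N * ?I p s)"
        using Pab[OF p] by (intro integrable_mult_right integrable_real_indicator) auto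
      have "norm (left_frac 1 f (snd p) - left_frac 1 f (fst p)) = norm (LINT s|lebesgue. ?I p s *\<^sub>R f s)"
        using indefinite_integral_diff[OF f Pab[OF p]] by (simp add: set_lebesgue_integral_def)
      also have "\<dots> \<le> (LINT s|lebesgue. norm (?I p s *\<^sub>R f s))" by (rule integral_norm_bound)
      also have "\<dots> \<le> (LINT s|lebesgue. ?I p s * h s + real N * ?I p s)"
      proof (rule integral_mono)
        show "integrable lebesgue (\<lambda>s. norm (?I p s *\<^sub>R f s))"
          using ip[OF g] by simp
        show "integrable lebesgue (\<lambda>s. ?I p s * h s + real N * ?I p s)"
          using ip[OF h(1)] iN by (intro Bochner_Integration.integrable_add)
        show "norm (?I p s *\<^sub>R f s) \<le> ?I p s * h s + real N * ?I p s" for s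
          by (auto simp: indicator_def h_def)
      qed
      also have "\<dots> = (LINT s|lebesgue. ?I p s * h s) + (LINT s|lebesgue. real N * ?I p s)"
        using ip[OF h(1)] iN by (intro Bochner_Integration.integral_add)
      also have "(LINT s|lebesgue. real N * ?I p s) = real N * (snd p - fst p)"
        using Pab[OF p] by simp
      finally show ?thesis .
    qed
    have "(\<Sum>p\<in>P. norm (left_frac 1 f (snd p) - left_frac 1 f (fst p)))
       \<le> (\<Sum>p\<in>P. (LINT s|lebesgue. ?I p s * h s) + real N * (snd p - fst p))"
      by (intro sum_mono each)
    also have "\<dots> = (LINT s|lebesgue. (\<Sum>p\<in>P. ?I p s * h s)) + real N * (\<Sum>p\<in>P. snd p - fst p)"
      using ip[OF h(1)] by (simp add: sum.distrib sum_distrib_left)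
    also have "\<dots> \<le> (LINT s|lebesgue. h s) + real N * \<delta>"
    proof (intro add_mono mult_left_mono integral_mono)
      show "(\<Sum>p\<in>P. ?I p s * h s) \<le> h s" for s
        using mult_right_mono[OF le1[of s] h(2)[of s]] by (simp add: sum_distrib_right)
    qed (use ip[OF h(1)] h len in auto)
    also have "\<dots> < e"
    proof -
      have "real N * \<delta> \<le> e / 2" using e by (simp add: \<delta>_def field_simps)
      then show ?thesis using hlt by linarith
    qed
    finally show "(\<Sum>p\<in>P. norm (left_frac 1 f (snd p) - left_frac 1 f (fst p))) < e" .
  qed (rule \<delta>)
qed

lemma indefinite_integral_AE_derivative:
  fixes f :: "real \<Rightarrow> 'v::euclidean_space"
  assumes f: "integrable lebesgue f"
  shows "AE t in lebesgue. ((\<lambda>t. LINT s|lebesgue. frac_kernel 1 s t *\<^sub>R f s) has_vector_derivative f t) (at t)"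
proof (rule lebesgue_differentiation)
  have abs: "f absolutely_integrable_on S" if "S \<in> sets lebesgue" for S
    using integrable_mult_indicator[OF that f] by (simp add: set_integrable_def)
  then show "f integrable_on {u..v}" for u v
    by (intro set_lebesgue_integral_eq_integral(1)) auto
  show "(left_frac 1 f v) - (left_frac 1 f u)
     = integral {u..v} f" if "u \<le> v" for u v
  proof -
    have "(LINT s:{u..<v}|lebesgue. f s) = integral {u..<v} f"
      using abs by (intro set_lebesgue_integral_eq_integral(2)) auto
    also have "\<dots> = integral {u..v} f"
      by (rule integral_spike_set; rule negligible_subset[of "{v}"]; force)
    finally show ?thesis using indefinite_integral_diff[OF f that] by simp
  qed
qed

lemma indefinite_integral_right_eq:
  fixes f :: "real \<Rightarrow> 'v::euclidean_space"
  assumes f: "integrable lebesgue f"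
  shows "(right_frac 1 f t)
    = (LINT s|lebesgue. f s) - (left_frac 1 f t)"
proof -
  have int: "integrable lebesgue (\<lambda>s. frac_kernel 1 s t *\<^sub>R f s)"
    by (rule Bochner_Integration.integrable_bound[OF f]) (use f in \<open>auto simp: frac_kernel_one\<close>)
  have "AE s in lebesgue. s \<noteq> t" by (rule AE_I[of _ _ "{t}"]) auto
  then have "(right_frac 1 f t) = (LINT s|lebesgue. f s - frac_kernel 1 s t *\<^sub>R f s)"
    using f by (intro integral_cong_AE) (auto elim!: eventually_mono simp: frac_kernel_one)
  then show ?thesis using f int by simp
qed

section \<open>Fractional integrals of bounded functions\<close>

lemma tendsto_frac_kernel_comp_one:
  assumes "0 < \<gamma>" "(\<tau> \<longlongrightarrow> t) F"
  shows "((\<lambda>n. frac_kernel (\<gamma> + 1) a (\<tau> n)) \<longlongrightarrow> frac_kernel (\<gamma> + 1) a t) F"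
proof -
  have eq: "frac_kernel (\<gamma> + 1) a = (\<lambda>t. max 0 (t - a) powr \<gamma> / Gamma (\<gamma> + 1))"
    using assms(1) by (auto simp: frac_kernel_def max_def fun_eq_iff)
  show ?thesis
    unfolding eq using assms Gamma_real_pos[of "\<gamma> + 1"]
    by (intro tendsto_divide tendsto_powr' tendsto_intros) (auto simp: less_imp_neq[symmetric])
qed

text \<open>
  The difference of two values of the fractional integral is at most \<open>C\<close> times the \<open>L\<^sup>1\<close>
  distance of the two kernels. If \<open>\<tau> n\<close> tends to \<open>t\<close>, the kernels converge almost everywhere, and
  their integrals \<open>frac_kernel (\<gamma> + 1) a (\<tau> n)\<close> converge because \<open>\<gamma> > 0\<close>. Scheffe's lemma then
  gives convergence in \<open>L\<^sup>1\<close>. Domination is not available when \<open>\<gamma> < 1\<close>.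
\<close>

lemma left_frac_integral_bounded:
  fixes f :: "real \<Rightarrow> 'v::euclidean_space"
  assumes \<gamma>: "0 < \<gamma>" and f [measurable]: "f \<in> borel_measurable lebesgue"
    and bound: "AE s in lebesgue. norm (f s) \<le> C" and supp: "\<And>s. s < a \<Longrightarrow> f s = 0"
  shows "integrable lebesgue (\<lambda>s. frac_kernel \<gamma> s t *\<^sub>R f s)"
    and "continuous_on UNIV (\<lambda>t. LINT s|lebesgue. frac_kernel \<gamma> s t *\<^sub>R f s)"
proof -
  \<comment> \<open>the kernel cut off at \<open>a\<close>, whose integral is known from the semigroup law\<close>
  define \<phi> where "\<phi> t s = frac_kernel 1 a s * frac_kernel \<gamma> s t" for t s
  have \<phi>_nn: "0 \<le> \<phi> t s" for t s using \<gamma> by (simp add: \<phi>_def)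
  have [measurable]: "\<phi> t \<in> borel_measurable lebesgue" for t unfolding \<phi>_def by measurable
  have nn: "(\<integral>\<^sup>+ s. ennreal (\<phi> t s) \<partial>lebesgue) = ennreal (frac_kernel (\<gamma> + 1) a t)" for t
    using nn_integral_frac_kernel_comp[OF zero_less_one \<gamma>, of a t]
    by (simp add: \<phi>_def nn_integral_completion add.commute)
  have \<phi>_int: "integrable lebesgue (\<phi> t)" for t
    using nn[of t] \<phi>_nn by (intro integrableI_nonneg) auto
  have eq: "AE s in lebesgue. frac_kernel \<gamma> s t *\<^sub>R f s = \<phi> t s *\<^sub>R f s" for t
  proof -
    have "AE s in lebesgue. s \<noteq> a" by (rule AE_I[of _ _ "{a}"]) auto
    then show ?thesis
      by eventually_elim (use supp in \<open>auto simp: \<phi>_def frac_kernel_one not_less\<close>)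
  qed
  have int: "integrable lebesgue (\<lambda>s. \<phi> t s *\<^sub>R f s)" for t
  proof (rule Bochner_Integration.integrable_bound)
    show "integrable lebesgue (\<lambda>s. C * \<phi> t s)" using \<phi>_int by simp
    show "AE s in lebesgue. norm (\<phi> t s *\<^sub>R f s) \<le> norm (C * \<phi> t s)"
      using bound
    proof eventually_elim
      case (elim s)
      then have "\<bar>\<phi> t s\<bar> * norm (f s) \<le> \<bar>\<phi> t s\<bar> * \<bar>C\<bar>" by (intro mult_left_mono) auto
      then show ?case by (simp add: abs_mult mult.commute)
    qed
  qed measurable
  show "integrable lebesgue (\<lambda>s. frac_kernel \<gamma> s t *\<^sub>R f s)"
    by (rule integrable_cong_AE[THEN iffD2, OF _ _ eq int]) measurable
  have Ieq: "(left_frac \<gamma> f t) = (LINT s|lebesgue. \<phi> t s *\<^sub>R f s)" for t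
    by (rule integral_cong_AE[OF _ _ eq]) measurable
  show "continuous_on UNIV (\<lambda>t. LINT s|lebesgue. frac_kernel \<gamma> s t *\<^sub>R f s)"
    unfolding continuous_on_sequentially Ieq
  proof (intro allI impI ballI, elim conjE)
    fix \<tau> :: "nat \<Rightarrow> real" and t :: real assume lim: "\<tau> \<longlonglongrightarrow> t"
    have "(\<lambda>n. \<integral>\<^sup>+ s. norm (\<phi> (\<tau> n) s - \<phi> t s) \<partial>lebesgue) \<longlonglongrightarrow> 0"
    proof (rule Scheffe_lemma1)
      have "AE s in lebesgue. s \<noteq> t" by (rule AE_I[of _ _ "{t}"]) auto
      then show "AE s in lebesgue. (\<lambda>n. \<phi> (\<tau> n) s) \<longlonglongrightarrow> \<phi> t s"
      proof eventually_elim
        case (elim s)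
        have "(\<lambda>n. frac_kernel \<gamma> s (\<tau> n)) \<longlonglongrightarrow> frac_kernel \<gamma> s t"
        proof (cases "s < t")
          case True
          have "eventually (\<lambda>n. s < \<tau> n) sequentially" using order_tendstoD(1)[OF lim True] .
          then have "eventually (\<lambda>n. (\<tau> n - s) powr (\<gamma> - 1) / Gamma \<gamma> = frac_kernel \<gamma> s (\<tau> n)) sequentially"
            by eventually_elim (simp add: frac_kernel_def)
          moreover have "(\<lambda>n. (\<tau> n - s) powr (\<gamma> - 1) / Gamma \<gamma>) \<longlonglongrightarrow> (t - s) powr (\<gamma> - 1) / Gamma \<gamma>"
            using True less_imp_neq[OF Gamma_real_pos[OF \<gamma>]] by (intro tendsto_intros lim) auto
          ultimately show ?thesis using True tendsto_cong by (force simp: frac_kernel_def)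
        next
          case False
          then have "t < s" using elim by simp
          then have "eventually (\<lambda>n. \<tau> n < s) sequentially" using order_tendstoD(2)[OF lim] by blast
          then have "eventually (\<lambda>n. frac_kernel \<gamma> s (\<tau> n) = 0) sequentially"
            by eventually_elim (simp add: frac_kernel_def)
          then show ?thesis using False by (simp add: frac_kernel_def tendsto_eventually)
        qed
        then show ?case unfolding \<phi>_def by (intro tendsto_intros)
      qed
      have "(\<lambda>n. ennreal (frac_kernel (\<gamma> + 1) a (\<tau> n))) \<longlonglongrightarrow> ennreal (frac_kernel (\<gamma> + 1) a t)"
        by (intro tendsto_ennrealI tendsto_frac_kernel_comp_one \<gamma> lim)
      then have "limsup (\<lambda>n. ennreal (frac_kernel (\<gamma> + 1) a (\<tau> n))) = ennreal (frac_kernel (\<gamma> + 1) a t)"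
        by (intro lim_imp_Limsup) auto
      then show "limsup (\<lambda>n. \<integral>\<^sup>+ s. norm (\<phi> (\<tau> n) s) \<partial>lebesgue) \<le> (\<integral>\<^sup>+ s. norm (\<phi> t s) \<partial>lebesgue)"
        using \<phi>_nn by (simp add: nn)
    qed (use \<phi>_int in auto)
    then have "(\<lambda>n. enn2real (\<integral>\<^sup>+ s. norm (\<phi> (\<tau> n) s - \<phi> t s) \<partial>lebesgue)) \<longlonglongrightarrow> enn2real 0"
      by (intro tendsto_enn2real) auto
    then have "(\<lambda>n. LINT s|lebesgue. norm (\<phi> (\<tau> n) s - \<phi> t s)) \<longlonglongrightarrow> 0"
      by (simp add: integral_eq_nn_integral)
    then have "(\<lambda>n. C * (LINT s|lebesgue. norm (\<phi> (\<tau> n) s - \<phi> t s))) \<longlonglongrightarrow> 0"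
      by (rule tendsto_mult_right_zero)
    then have "(\<lambda>n. (LINT s|lebesgue. \<phi> (\<tau> n) s *\<^sub>R f s) - (LINT s|lebesgue. \<phi> t s *\<^sub>R f s)) \<longlonglongrightarrow> 0"
    proof (rule Lim_null_comparison[rotated], intro always_eventually allI)
      fix n
      have "norm ((LINT s|lebesgue. \<phi> (\<tau> n) s *\<^sub>R f s) - (LINT s|lebesgue. \<phi> t s *\<^sub>R f s))
          = norm (LINT s|lebesgue. (\<phi> (\<tau> n) s - \<phi> t s) *\<^sub>R f s)"
        using int by (simp add: scaleR_diff_left)
      also have "\<dots> \<le> (LINT s|lebesgue. norm ((\<phi> (\<tau> n) s - \<phi> t s) *\<^sub>R f s))"
        by (rule integral_norm_bound)
      also have "\<dots> \<le> (LINT s|lebesgue. C * norm (\<phi> (\<tau> n) s - \<phi> t s))"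
      proof (rule integral_mono_AE)
        show "integrable lebesgue (\<lambda>s. norm ((\<phi> (\<tau> n) s - \<phi> t s) *\<^sub>R f s))"
          using Bochner_Integration.integrable_diff[OF int int, of "\<tau> n" t]
          by (intro integrable_norm) (simp add: scaleR_diff_left)
        show "AE s in lebesgue. norm ((\<phi> (\<tau> n) s - \<phi> t s) *\<^sub>R f s) \<le> C * norm (\<phi> (\<tau> n) s - \<phi> t s)"
          using bound by eventually_elim (simp add: mult_left_mono mult.commute[of C])
      qed (use \<phi>_int in auto)
      also have "\<dots> = C * (LINT s|lebesgue. norm (\<phi> (\<tau> n) s - \<phi> t s))" by simp
      finally show "norm ((LINT s|lebesgue. \<phi> (\<tau> n) s *\<^sub>R f s) - (LINT s|lebesgue. \<phi> t s *\<^sub>R f s))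
        \<le> C * (LINT s|lebesgue. norm (\<phi> (\<tau> n) s - \<phi> t s))" .
    qed
    then show "((\<lambda>t. LINT s|lebesgue. \<phi> t s *\<^sub>R f s) \<circ> \<tau>) \<longlonglongrightarrow> (LINT s|lebesgue. \<phi> t s *\<^sub>R f s)"
      by (simp add: LIM_zero_iff o_def)
  qed
qed

section \<open>Continuous representatives\<close>

lemma continuous_on_AE_eq_imp_eq:
  fixes g h :: "real \<Rightarrow> 'v::euclidean_space"
  assumes ab: "a < b" and "continuous_on {a..b} g" "continuous_on {a..b} h"
    and ae: "AE t\<in>{a..b} in lebesgue. g t = h t" and t: "t \<in> {a..b}"
  shows "g t = h t"
proof -
  have cont: "continuous_on {a..b} (\<lambda>t. g t - h t)" using assms by (intro continuous_intros)
  define C where "C = {s \<in> {a..b}. g s - h s = 0}"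
  have "closed C" unfolding C_def
    using cont by (intro continuous_closed_preimage_constant) auto
  have "{a<..<b} \<subseteq> C"
  proof
    fix s assume s: "s \<in> {a<..<b}"
    show "s \<in> C"
    proof (rule mem_closed_if_AE_lebesgue_open[OF open_greaterThanLessThan \<open>closed C\<close> _ s])
      show "AE s\<in>{a<..<b} in lebesgue. s \<in> C"
        using ae by eventually_elim (auto simp: C_def)
    qed
  qed
  then have "closure {a<..<b} \<subseteq> C" using \<open>closed C\<close> by (rule closure_minimal)
  then show ?thesis using t ab by (auto simp: C_def)
qed

text \<open>
  Values of fractional integrals at single points, in particular at \<open>a\<close> and \<open>b\<close>, are computed
  through this lemma.
\<close>

lemma cont_rep_eq:
  fixes f g :: "real \<Rightarrow> 'v::euclidean_space"
  assumes ab: "a < b" and g: "continuous_on {a..b} g" and ae: "AE t\<in>{a..b} in lebesgue. f t = g t"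
    and t: "t \<in> {a..b}"
  shows "cont_rep a b f t = g t"
proof -
  let ?P = "\<lambda>g. continuous_on {a..b} g \<and> (AE t\<in>{a..b} in lebesgue. f t = g t)"
  define h where "h = (SOME g. ?P g)"
  have ex: "\<exists>g. ?P g" using g ae by blast
  then have h: "?P h" unfolding h_def by (rule someI_ex)
  then have "AE t\<in>{a..b} in lebesgue. f t = h t" ..
  then have "AE t\<in>{a..b} in lebesgue. h t = g t"
    using ae by eventually_elim simp
  then have "h t = g t" using h g t ab by (intro continuous_on_AE_eq_imp_eq[of a b h g]) auto
  then show ?thesis using ex by (simp add: cont_rep_def h_def)
qed

lemma frac_int_left_kernel:
  assumes "t \<le> b"
  shows "(LINT s:{a..t}|lebesgue. ((t - s) powr (\<gamma> - 1) / Gamma \<gamma>) *\<^sub>R f s)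
    = left_frac \<gamma> (\<lambda>s. indicator {a..b} s *\<^sub>R f s) t"
  unfolding set_lebesgue_integral_def
  using assms by (intro Bochner_Integration.integral_cong) (auto simp: frac_kernel_def indicator_def)

lemma frac_int_right_kernel:
  assumes "a \<le> t"
  shows "(LINT s:{t..b}|lebesgue. ((s - t) powr (\<gamma> - 1) / Gamma \<gamma>) *\<^sub>R f s)
    = right_frac \<gamma> (\<lambda>s. indicator {a..b} s *\<^sub>R f s) t"
  unfolding set_lebesgue_integral_def
  using assms by (intro Bochner_Integration.integral_cong) (auto simp: frac_kernel_def indicator_def)

lemma frac_int_left_bounded:
  fixes f :: "real \<Rightarrow> 'v::euclidean_space"
  assumes ab: "a < b" and \<gamma>: "0 < \<gamma>" and f: "Linfinity_on a b f" and t: "t \<in> {a..b}"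
  shows "frac_int_left a b \<gamma> f t = left_frac \<gamma> (\<lambda>s. indicator {a..b} s *\<^sub>R f s) t"
proof -
  obtain C where m: "(\<lambda>s. indicator {a..b} s *\<^sub>R f s) \<in> borel_measurable lebesgue"
    and C: "AE t\<in>{a..b} in lebesgue. norm (f t) \<le> C"
    using f by (auto simp: Linfinity_on_def set_borel_measurable_def)
  have C': "AE s in lebesgue. norm (indicator {a..b} s *\<^sub>R f s) \<le> max 0 C"
    using C by eventually_elim (auto simp: indicator_def)
  have "continuous_on UNIV (\<lambda>t. LINT s|lebesgue. frac_kernel \<gamma> s t *\<^sub>R (indicator {a..b} s *\<^sub>R f s))"
    by (rule left_frac_integral_bounded(2)[OF \<gamma> m C', of a]) auto
  then have cont: "continuous_on {a..b} (\<lambda>t. LINT s|lebesgue. frac_kernel \<gamma> s t *\<^sub>R (indicator {a..b} s *\<^sub>R f s))"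
    by (rule continuous_on_subset) auto
  have "AE t\<in>{a..b} in lebesgue. (LINT s:{a..t}|lebesgue. ((t - s) powr (\<gamma> - 1) / Gamma \<gamma>) *\<^sub>R f s)
      = left_frac \<gamma> (\<lambda>s. indicator {a..b} s *\<^sub>R f s) t"
    by (intro AE_I2 impI frac_int_left_kernel) simp
  from cont_rep_eq[OF ab cont this t] show ?thesis
    using \<gamma> by (simp add: frac_int_left_def del: scaleR_scaleR)
qed

section \<open>Partial gradients of functions of class C2\<close>

lemma gradient_eq:
  assumes "(f has_derivative (\<lambda>h. h \<bullet> D)) (at z)"
  shows "gradient f z = D"
  unfolding gradient_def gderiv_def
proof (rule the_equality)
  show "(f has_derivative (\<lambda>h. h \<bullet> D)) (at z)" by (rule assms)
  fix D' assume "(f has_derivative (\<lambda>h. h \<bullet> D')) (at z)"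
  from has_derivative_unique[OF this assms] have "h \<bullet> D' = h \<bullet> D" for h by metis
  then show "D' = D" by (metis inner_commute vector_eq_rdot)
qed

text \<open>
  The Riesz representative of the functional \<open>l \<circ> p\<close>, for a linear map \<open>p\<close>.
\<close>

definition functional_vector :: "('w::euclidean_space \<Rightarrow>\<^sub>L real) \<Rightarrow> ('v::euclidean_space \<Rightarrow> 'w) \<Rightarrow> 'v" where
  "functional_vector l p = (\<Sum>i\<in>Basis. blinfun_apply l (p i) *\<^sub>R i)"

lemma inner_functional_vector:
  assumes "linear p"
  shows "h \<bullet> functional_vector l p = blinfun_apply l (p h)"
proof -
  have lin: "linear (\<lambda>h. blinfun_apply l (p h))"
    using linear_compose[OF assms, of "blinfun_apply l"] by (simp add: o_def blinfun.bounded_linear_right bounded_linear.linear)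
  have "blinfun_apply l (p h) = blinfun_apply l (p (\<Sum>i\<in>Basis. (h \<bullet> i) *\<^sub>R i))"
    by (simp add: euclidean_representation)
  also have "\<dots> = (\<Sum>i\<in>Basis. (h \<bullet> i) * blinfun_apply l (p i))"
    using linear_sum[OF lin, of "\<lambda>i. (h \<bullet> i) *\<^sub>R i" Basis] linear_scale[OF lin] by simp
  finally show ?thesis
    by (simp add: functional_vector_def inner_sum_right mult.commute)
qed

lemma bounded_linear_functional_vector: "bounded_linear (\<lambda>l. functional_vector l p)"
  unfolding functional_vector_def
  by (intro bounded_linear_sum bounded_linear_scaleR_const[of "\<lambda>l. blinfun_apply l _", OF blinfun.bounded_linear_left])

text \<open>
  Restricting the derivatives within the slab to the affine subspaces on which only the first or
  only the second vector argument varies gives two-sided derivatives, since these subspaces lie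
  inside the slab even when \<open>t\<close> is an end point.
\<close>

lemma C2_on_slab_partials:
  fixes L :: "'v::euclidean_space \<Rightarrow> 'v \<Rightarrow> real \<Rightarrow> real"
  assumes "C2_on (\<lambda>(u, v, t). L u v t) (UNIV \<times> UNIV \<times> T)"
  obtains L1 L2 :: "'v \<Rightarrow> 'v \<Rightarrow> real \<Rightarrow> 'v" and H :: "'v \<Rightarrow> 'v \<Rightarrow> real \<Rightarrow> 'v \<Rightarrow> 'v"
  where "\<And>u v t. t \<in> T \<Longrightarrow> ((\<lambda>u. L u v t) has_derivative (\<lambda>h. h \<bullet> L1 u v t)) (at u)"
    and "\<And>u v t. t \<in> T \<Longrightarrow> ((\<lambda>v. L u v t) has_derivative (\<lambda>h. h \<bullet> L2 u v t)) (at v)"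
    and "\<And>u v t. t \<in> T \<Longrightarrow> ((\<lambda>v. L2 u v t) has_derivative H u v t) (at v)"
    and "continuous_on (UNIV \<times> UNIV \<times> T) (\<lambda>(u, v, t). L u v t)"
    and "continuous_on (UNIV \<times> UNIV \<times> T) (\<lambda>(u, v, t). L1 u v t)"
    and "continuous_on (UNIV \<times> UNIV \<times> T) (\<lambda>(u, v, t). L2 u v t)"
proof -
  let ?S = "UNIV \<times> UNIV \<times> T :: ('v \<times> 'v \<times> real) set"
  let ?L = "\<lambda>(u, v, t). L u v t"
  obtain f' f'' where f': "\<And>z. z \<in> ?S \<Longrightarrow> (?L has_derivative blinfun_apply (f' z)) (at z within ?S)"
    and f'': "\<And>z. z \<in> ?S \<Longrightarrow> (f' has_derivative blinfun_apply (f'' z)) (at z within ?S)"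
    using assms unfolding C2_on_def by blast
  define p1 p2 :: "'v \<Rightarrow> 'v \<times> 'v \<times> real" where "p1 h = (h, 0, 0)" and "p2 h = (0, h, 0)" for h
  have lin: "linear p1" "linear p2" by (auto intro!: linearI simp: p1_def p2_def)
  \<comment> \<open>\<open>p1\<close> and \<open>p2\<close> embed the directions of the first and the second vector argument\<close>
  define L1 L2 where "L1 u v t = functional_vector (f' (u, v, t)) p1"
    and "L2 u v t = functional_vector (f' (u, v, t)) p2" for u v t
  define H where "H u v t h = functional_vector (f'' (u, v, t) (p2 h)) p2" for u v t h
  have d1: "((\<lambda>u. (u, v, t)) has_derivative p1) (at u)"
    and d2: "((\<lambda>v. (u, v, t)) has_derivative p2) (at v)" for u v :: 'v and t :: real
    unfolding p1_def p2_def by (auto intro!: derivative_eq_intros simp: zero_prod_def)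
  have contf': "continuous_on ?S f'" using f'' by (intro has_derivative_continuous_on) auto
  have cont: "continuous_on ?S (\<lambda>z. functional_vector (f' z) p)" for p :: "'v \<Rightarrow> 'v \<times> 'v \<times> real"
    by (rule bounded_linear.continuous_on[OF bounded_linear_functional_vector contf'])
  show ?thesis
  proof (rule that[of L1 L2 H])
    fix u v t assume t: "t \<in> T"
    have "((\<lambda>u. ?L (u, v, t)) has_derivative (\<lambda>h. blinfun_apply (f' (u, v, t)) (p1 h))) (at u)"
      by (rule has_derivative_in_compose2[where g="?L" and t="?S", OF _ _ _ d1]) (use f' t in auto)
    then show "((\<lambda>u. L u v t) has_derivative (\<lambda>h. h \<bullet> L1 u v t)) (at u)"
      by (simp add: L1_def inner_functional_vector[OF lin(1)])
    have "((\<lambda>v. ?L (u, v, t)) has_derivative (\<lambda>h. blinfun_apply (f' (u, v, t)) (p2 h))) (at v)"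
      by (rule has_derivative_in_compose2[where g="?L" and t="?S", OF _ _ _ d2]) (use f' t in auto)
    then show "((\<lambda>v. L u v t) has_derivative (\<lambda>h. h \<bullet> L2 u v t)) (at v)"
      by (simp add: L2_def inner_functional_vector[OF lin(2)])
    have "((\<lambda>v. f' (u, v, t)) has_derivative (\<lambda>h. blinfun_apply (f'' (u, v, t)) (p2 h))) (at v)"
      by (rule has_derivative_in_compose2[where g="f'" and t="?S", OF _ _ _ d2]) (use f'' t in auto)
    then show "((\<lambda>v. L2 u v t) has_derivative H u v t) (at v)"
      unfolding L2_def H_def by (rule bounded_linear.has_derivative[OF bounded_linear_functional_vector])
  next
    show "continuous_on ?S ?L" using f' by (intro has_derivative_continuous_on) auto
    show "continuous_on ?S (\<lambda>(u, v, t). L1 u v t)" "continuous_on ?S (\<lambda>(u, v, t). L2 u v t)"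
      using cont[of p1] cont[of p2] by (simp_all add: L1_def L2_def split_beta)
  qed
qed

lemma C2_on_pair_derivative:
  fixes \<phi> :: "'v::euclidean_space \<Rightarrow> 'v \<Rightarrow> real"
  assumes "C2_on (\<lambda>(u, v). \<phi> u v) UNIV"
  shows "((\<lambda>(u, v). \<phi> u v) has_derivative
     (\<lambda>(h, k). h \<bullet> gradient (\<lambda>u. \<phi> u v) u + k \<bullet> gradient (\<lambda>v. \<phi> u v) v)) (at (u, v))"
proof -
  obtain f' where f': "((\<lambda>(u, v). \<phi> u v) has_derivative blinfun_apply f') (at (u, v))"
    using assms unfolding C2_on_def by blast
  define p1 p2 :: "'v \<Rightarrow> 'v \<times> 'v" where "p1 h = (h, 0)" and "p2 h = (0, h)" for h
  have lin: "linear p1" "linear p2" by (auto intro!: linearI simp: p1_def p2_def)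
  have d1: "((\<lambda>u. (u, v)) has_derivative p1) (at u)"
    and d2: "((\<lambda>v. (u, v)) has_derivative p2) (at v)" for u v :: 'v
    unfolding p1_def p2_def by (auto intro!: derivative_eq_intros simp: zero_prod_def)
  have "((\<lambda>u. \<phi> u v) has_derivative (\<lambda>h. h \<bullet> functional_vector f' p1)) (at u)"
    using has_derivative_compose[OF d1, of "\<lambda>(u, v). \<phi> u v"] f'
    by (simp add: inner_functional_vector[OF lin(1)])
  moreover have "((\<lambda>v. \<phi> u v) has_derivative (\<lambda>h. h \<bullet> functional_vector f' p2)) (at v)"
    using has_derivative_compose[OF d2, of "\<lambda>(u, v). \<phi> u v"] f'
    by (simp add: inner_functional_vector[OF lin(2)])
  ultimately have grad: "gradient (\<lambda>u. \<phi> u v) u = functional_vector f' p1"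
    "gradient (\<lambda>v. \<phi> u v) v = functional_vector f' p2"
    by (simp_all add: gradient_eq)
  have "blinfun_apply f' (h, k) = blinfun_apply f' (p1 h) + blinfun_apply f' (p2 k)" for h k
    by (simp add: p1_def p2_def flip: blinfun.add_right)
  then have "blinfun_apply f' = (\<lambda>(h, k). h \<bullet> gradient (\<lambda>u. \<phi> u v) u + k \<bullet> gradient (\<lambda>v. \<phi> u v) v)"
    by (simp add: fun_eq_iff grad inner_functional_vector[OF lin(1)] inner_functional_vector[OF lin(2)])
  with f' show ?thesis by simp
qed

section \<open>Symmetry and sign of the second derivative\<close>

lemma directional_mean_value:
  fixes f :: "'v::euclidean_space \<Rightarrow> real"
  assumes f: "\<And>z. (f has_derivative (\<lambda>h. h \<bullet> g z)) (at z)" and s: "0 < s"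
  obtains r where "0 < r" "r < s" "f (p + s *\<^sub>R q) - f p = s * (q \<bullet> g (p + r *\<^sub>R q))"
proof -
  have D: "((\<lambda>r. f (p + r *\<^sub>R q)) has_real_derivative q \<bullet> g (p + r *\<^sub>R q)) (at r)" for r
    unfolding has_field_derivative_def
    by (rule has_derivative_eq_rhs[OF has_derivative_compose[OF _ f]])
      (auto intro!: derivative_eq_intros simp: mult.commute)
  obtain r where "0 < r" "r < s" "f (p + s *\<^sub>R q) - f (p + 0 *\<^sub>R q) = (s - 0) * (q \<bullet> g (p + r *\<^sub>R q))"
    using MVT2[OF s D] by blast
  with that show ?thesis by simp
qed

text \<open>
  Apply the mean value theorem in direction \<open>x\<close> to \<open>p \<mapsto> f (p + s *\<^sub>R y) - f p\<close>. The resulting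
  difference of two gradients is \<open>s *\<^sub>R H y\<close> up to the error of linearization of \<open>g\<close> at \<open>z\<close>.
\<close>

lemma second_difference_bound:
  fixes f :: "'v::euclidean_space \<Rightarrow> real"
  assumes f: "\<And>z. (f has_derivative (\<lambda>h. h \<bullet> g z)) (at z)"
    and H: "linear H"
    and d: "\<And>k. norm k < d \<Longrightarrow> norm (g (z + k) - g z - H k) \<le> e * norm k"
    and s: "0 < s" "s * (norm x + norm y) < d" and e: "0 \<le> e"
  shows "\<bar>f (z + s *\<^sub>R x + s *\<^sub>R y) - f (z + s *\<^sub>R x) - f (z + s *\<^sub>R y) + f z - s\<^sup>2 * (x \<bullet> H y)\<bar>
    \<le> 2 * e * s\<^sup>2 * (norm x + norm y)\<^sup>2"
proof -
  let ?M = "norm x + norm y"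
  have "((\<lambda>p. f (p + s *\<^sub>R y) - f p) has_derivative (\<lambda>h. h \<bullet> (g (p + s *\<^sub>R y) - g p))) (at p)" for p
    by (rule has_derivative_eq_rhs[OF has_derivative_diff[OF has_derivative_compose[OF _ f] f]])
      (auto intro!: derivative_eq_intros simp: inner_diff_right)
  from directional_mean_value[OF this s(1), of z x] obtain r where r: "0 < r" "r < s"
    and eq: "f (z + s *\<^sub>R x + s *\<^sub>R y) - f (z + s *\<^sub>R x) - (f (z + s *\<^sub>R y) - f z)
       = s * (x \<bullet> (g (z + r *\<^sub>R x + s *\<^sub>R y) - g (z + r *\<^sub>R x)))"
    by metis
  have n1: "norm (r *\<^sub>R x + s *\<^sub>R y) \<le> s * ?M"
  proof -
    have "norm (r *\<^sub>R x + s *\<^sub>R y) \<le> r * norm x + s * norm y"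
      using r s by (metis abs_of_pos norm_scaleR norm_triangle_ineq)
    also have "\<dots> \<le> s * ?M" using r by (simp add: distrib_left mult_right_mono)
    finally show ?thesis .
  qed
  have n2: "norm (r *\<^sub>R x) \<le> s * ?M"
  proof -
    have "norm (r *\<^sub>R x) = r * norm x" using r by simp
    also have "\<dots> \<le> s * norm x" using r by (intro mult_right_mono) auto
    also have "\<dots> \<le> s * ?M" using s by (intro mult_left_mono) auto
    finally show ?thesis .
  qed
  let ?E = "g (z + r *\<^sub>R x + s *\<^sub>R y) - g (z + r *\<^sub>R x) - s *\<^sub>R H y"
  have Eeq: "?E = (g (z + (r *\<^sub>R x + s *\<^sub>R y)) - g z - H (r *\<^sub>R x + s *\<^sub>R y))
     - (g (z + r *\<^sub>R x) - g z - H (r *\<^sub>R x))"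
    by (simp add: linear_add[OF H] linear_scale[OF H] algebra_simps)
  have "norm ?E \<le> norm (g (z + (r *\<^sub>R x + s *\<^sub>R y)) - g z - H (r *\<^sub>R x + s *\<^sub>R y))
     + norm (g (z + r *\<^sub>R x) - g z - H (r *\<^sub>R x))"
    unfolding Eeq by (rule norm_triangle_ineq4)
  also have "\<dots> \<le> e * (s * ?M) + e * (s * ?M)"
    using d[of "r *\<^sub>R x + s *\<^sub>R y"] d[of "r *\<^sub>R x"] n1 n2 s(2)
      mult_left_mono[OF n1 e] mult_left_mono[OF n2 e] by linarith
  finally have E: "norm ?E \<le> 2 * e * s * ?M" by simp
  have "f (z + s *\<^sub>R x + s *\<^sub>R y) - f (z + s *\<^sub>R x) - f (z + s *\<^sub>R y) + f z - s\<^sup>2 * (x \<bullet> H y) = s * (x \<bullet> ?E)"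
    using eq by (simp add: inner_diff_right power2_eq_square algebra_simps)
  also have "\<bar>\<dots>\<bar> \<le> s * (norm x * norm ?E)"
    using s Cauchy_Schwarz_ineq2[of x ?E] by (simp add: abs_mult)
  also have "\<dots> \<le> s * (?M * (2 * e * s * ?M))"
    using s E by (intro mult_left_mono mult_mono) auto
  finally show ?thesis by (simp add: power2_eq_square mult_ac)
qed

text \<open>
  Differentiability of the gradient at the single point \<open>z\<close> suffices: the second difference is
  symmetric in \<open>x\<close> and \<open>y\<close>, and by the previous bound it is close to both \<open>s\<^sup>2 * (x \<bullet> H y)\<close> and
  \<open>s\<^sup>2 * (y \<bullet> H x)\<close>.
\<close>

lemma second_derivative_symmetric:
  fixes f :: "'v::euclidean_space \<Rightarrow> real"
  assumes f: "\<And>z. (f has_derivative (\<lambda>h. h \<bullet> g z)) (at z)" and g: "(g has_derivative H) (at z)"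
  shows "x \<bullet> H y = y \<bullet> H x"
proof -
  let ?M = "norm x + norm y"
  have lin: "linear H" using g has_derivative_linear by blast
  have "\<bar>x \<bullet> H y - y \<bullet> H x\<bar> \<le> 0 + \<epsilon>" if "\<epsilon> > 0" for \<epsilon>
  proof -
    define e where "e = \<epsilon> / (4 * (?M\<^sup>2 + 1))"
    have pos: "?M\<^sup>2 + 1 > 0" by (simp add: add_nonneg_pos)
    then have e: "e > 0" using that by (simp add: e_def)
    obtain d where d: "d > 0" "\<And>y. norm (y - z) < d \<Longrightarrow> norm (g y - g z - H (y - z)) \<le> e * norm (y - z)"
      using g e unfolding has_derivative_at_alt by blast
    have d': "norm (g (z + k) - g z - H k) \<le> e * norm k" if "norm k < d" for k
      using d(2)[of "z + k"] that by simp
    define s where "s = d / (2 * (?M + 1))"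
    have M1: "?M + 1 > 0" by (simp add: add_nonneg_pos)
    then have s: "s > 0" using d by (simp add: s_def)
    have "s * ?M < s * (2 * (?M + 1))" using s M1 by (intro mult_strict_left_mono) auto
    also have "\<dots> = d" using M1 by (simp add: s_def)
    finally have "s * ?M < d" .
    have *: "\<bar>f (z + s *\<^sub>R p + s *\<^sub>R q) - f (z + s *\<^sub>R p) - f (z + s *\<^sub>R q) + f z - s\<^sup>2 * (p \<bullet> H q)\<bar>
        \<le> 2 * e * s\<^sup>2 * (norm p + norm q)\<^sup>2" if "s * (norm p + norm q) < d" for p q
      by (rule second_difference_bound[OF f lin, where d=d]) (use d' s e that in auto)
    have "\<bar>s\<^sup>2 * (x \<bullet> H y) - s\<^sup>2 * (y \<bullet> H x)\<bar> \<le> 4 * e * s\<^sup>2 * ?M\<^sup>2"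
      using *[of x y] *[of y x] \<open>s * ?M < d\<close> by (simp add: add_ac abs_le_iff)
    then have "s\<^sup>2 * \<bar>x \<bullet> H y - y \<bullet> H x\<bar> \<le> s\<^sup>2 * (4 * e * ?M\<^sup>2)"
      unfolding right_diff_distrib[symmetric] abs_mult by (simp add: mult_ac)
    then have "\<bar>x \<bullet> H y - y \<bullet> H x\<bar> \<le> 4 * e * ?M\<^sup>2" using s by simp
    also have "\<dots> \<le> \<epsilon>" using that pos by (simp add: e_def field_simps)
    finally show ?thesis by simp
  qed
  then show ?thesis using field_le_epsilon[of "\<bar>x \<bullet> H y - y \<bullet> H x\<bar>" 0] by simp
qed

lemma second_derivative_nonneg_at_minimum:
  fixes f :: "'v::euclidean_space \<Rightarrow> real"
  assumes f: "\<And>z. (f has_derivative (\<lambda>h. h \<bullet> g z)) (at z)" and g: "(g has_derivative H) (at z)"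
    and supp: "\<And>h. f z + h \<bullet> g z \<le> f (z + h)"
  shows "0 \<le> v \<bullet> H v"
proof -
  have lin: "linear H" using g has_derivative_linear by blast
  have "0 \<le> v \<bullet> H v + \<epsilon>" if "\<epsilon> > 0" for \<epsilon>
  proof -
    define e where "e = \<epsilon> / (norm v ^ 2 + 1)"
    have pos: "norm v ^ 2 + 1 > 0" by (simp add: add_nonneg_pos)
    then have e: "e > 0" using that by (simp add: e_def)
    obtain d where d: "d > 0" "\<And>y. norm (y - z) < d \<Longrightarrow> norm (g y - g z - H (y - z)) \<le> e * norm (y - z)"
      using g e unfolding has_derivative_at_alt by blast
    define s where "s = d / (norm v + 1)"
    have M1: "norm v + 1 > 0" by (simp add: add_nonneg_pos)
    then have s: "s > 0" using d by (simp add: s_def)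
    have "s * norm v < s * (norm v + 1)" using s by (intro mult_strict_left_mono) auto
    also have "\<dots> = d" using M1 by (simp add: s_def)
    finally have sv: "s * norm v < d" .
    obtain r where r: "0 < r" "r < s" and eq: "f (z + s *\<^sub>R v) - f z = s * (v \<bullet> g (z + r *\<^sub>R v))"
      using directional_mean_value[OF f s] by metis
    have "0 \<le> s * (v \<bullet> (g (z + r *\<^sub>R v) - g z))"
      using supp[of "s *\<^sub>R v"] eq by (simp add: inner_diff_right algebra_simps)
    then have "0 \<le> v \<bullet> (g (z + r *\<^sub>R v) - g z)" using s by (simp add: zero_le_mult_iff)
    also have "\<dots> = v \<bullet> (g (z + r *\<^sub>R v) - g z - H (r *\<^sub>R v)) + r * (v \<bullet> H v)"
      using lin by (simp add: linear_scale inner_diff_right)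
    also have "v \<bullet> (g (z + r *\<^sub>R v) - g z - H (r *\<^sub>R v)) \<le> norm v * (e * (r * norm v))"
    proof -
      have "r * norm v \<le> s * norm v" using r by (intro mult_right_mono) auto
      then have "norm (g (z + r *\<^sub>R v) - g z - H (r *\<^sub>R v)) \<le> e * (r * norm v)"
        using d(2)[of "z + r *\<^sub>R v"] sv r by simp
      then show ?thesis
        by (intro order_trans[OF norm_cauchy_schwarz] mult_left_mono) auto
    qed
    finally have "0 \<le> r * (v \<bullet> H v + e * (norm v)\<^sup>2)"
      by (simp add: power2_eq_square algebra_simps)
    then have "0 \<le> v \<bullet> H v + e * (norm v)\<^sup>2" using r by (simp add: zero_le_mult_iff)
    also have "e * (norm v)\<^sup>2 \<le> \<epsilon>" using that pos by (simp add: e_def field_simps)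
    finally show ?thesis by simp
  qed
  then show ?thesis by (rule field_le_epsilon)
qed

lemma pos_semidefinite_scaleR_hessian:
  fixes f :: "real ^ 'n \<Rightarrow> real"
  assumes f: "\<And>z. (f has_derivative (\<lambda>h. h \<bullet> g z)) (at z)" and g: "(g has_derivative H) (at z)"
    and nonneg: "\<And>v. 0 \<le> c * (v \<bullet> H v)"
  shows "pos_semidefinite (c *\<^sub>R hessian f z)"
proof -
  have lin: "linear H" using g has_derivative_linear by blast
  have "gradient f = g" using gradient_eq[OF f] by blast
  then have hess: "hessian f z = matrix H"
    using frechet_derivative_at[OF g] by (simp add: hessian_def jacobian_def)
  have mv: "matrix H *v v = H v" for v by (rule fun_cong[OF matrix_vector_mul(2)[OF lin]])
  have "matrix H $ i $ j = matrix H $ j $ i" for i j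
    using second_derivative_symmetric[OF f g, of "axis i 1" "axis j 1"]
    by (simp add: matrix_def inner_axis')
  then have "transpose (c *\<^sub>R matrix H) = c *\<^sub>R matrix H"
    by (simp add: transpose_def vec_eq_iff)
  moreover have "(c *\<^sub>R matrix H) *v v = c *\<^sub>R H v" for v
    by (simp add: mv flip: scaleR_matrix_vector_assoc)
  ultimately show ?thesis using nonneg by (simp add: pos_semidefinite_def hess)
qed

section \<open>First order expansion on compact sets\<close>

lemma uniform_first_order_expansion:
  fixes L :: "'v::euclidean_space \<Rightarrow> 'w::euclidean_space \<Rightarrow> real \<Rightarrow> real"
  assumes L1: "\<And>u v t. t \<in> T \<Longrightarrow> ((\<lambda>u. L u v t) has_derivative (\<lambda>h. h \<bullet> L1 u v t)) (at u)"
    and cont: "continuous_on (UNIV \<times> UNIV \<times> T) (\<lambda>(u, v, t). L1 u v t)"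
    and T: "compact T" and \<eta>: "\<eta> > 0"
  obtains \<delta> where "\<delta> > 0" "\<And>u v t h. \<lbrakk>norm u \<le> R; norm v \<le> R; t \<in> T; norm h \<le> \<delta>\<rbrakk> \<Longrightarrow>
      \<bar>L (u + h) v t - L u v t - h \<bullet> L1 u v t\<bar> \<le> \<eta> * norm h"
proof -
  let ?K = "cball 0 (R + 1) \<times> cball 0 R \<times> T :: ('v \<times> 'w \<times> real) set"
  have "compact ?K" using T by (intro compact_Times) auto
  then have "uniformly_continuous_on ?K (\<lambda>(u, v, t). L1 u v t)"
    by (intro compact_uniformly_continuous continuous_on_subset[OF cont]) auto
  then obtain d where d: "d > 0" "\<And>z z'. z \<in> ?K \<Longrightarrow> z' \<in> ?K \<Longrightarrow> dist z' z < d \<Longrightarrow>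
      dist (case z' of (u, v, t) \<Rightarrow> L1 u v t) (case z of (u, v, t) \<Rightarrow> L1 u v t) < \<eta>"
    using \<eta> unfolding uniformly_continuous_on_def by metis
  show ?thesis
  proof (rule that[of "min 1 (d / 2)"])
    fix u :: 'v and v :: 'w and t and h :: 'v
    assume u: "norm u \<le> R" "norm v \<le> R" and t: "t \<in> T" and h: "norm h \<le> min 1 (d / 2)"
    obtain r where r: "0 < r" "r < 1" and eq: "L (u + 1 *\<^sub>R h) v t - L u v t = 1 * (h \<bullet> L1 (u + r *\<^sub>R h) v t)"
      using directional_mean_value[OF L1[OF t] zero_less_one] by metis
    have rh: "norm (r *\<^sub>R h) \<le> norm h" using r by (simp add: mult_left_le_one_le)
    have "norm (u + r *\<^sub>R h) \<le> R + 1" using u h rh norm_triangle_ineq[of u "r *\<^sub>R h"] by simp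
    moreover have "dist (u + r *\<^sub>R h, v, t) (u, v, t) < d"
      using rh h d by (simp add: dist_Pair_Pair dist_norm)
    ultimately have "dist (L1 (u + r *\<^sub>R h) v t) (L1 u v t) < \<eta>"
      using d(2)[of "(u, v, t)" "(u + r *\<^sub>R h, v, t)"] u t by simp
    then have "norm h * norm (L1 (u + r *\<^sub>R h) v t - L1 u v t) \<le> norm h * \<eta>"
      by (intro mult_left_mono) (auto simp: dist_norm)
    moreover have "L (u + h) v t - L u v t - h \<bullet> L1 u v t = h \<bullet> (L1 (u + r *\<^sub>R h) v t - L1 u v t)"
      using eq by (simp add: inner_diff_right)
    ultimately show "\<bar>L (u + h) v t - L u v t - h \<bullet> L1 u v t\<bar> \<le> \<eta> * norm h"
      using Cauchy_Schwarz_ineq2[of h "L1 (u + r *\<^sub>R h) v t - L1 u v t"] by (simp add: mult.commute)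
  qed (use d in auto)
qed

section \<open>Trajectories and their variations\<close>

lemma Linfinity_on_AE_cong:
  fixes f g :: "real \<Rightarrow> 'v::euclidean_space"
  assumes f: "Linfinity_on a b f" and eq: "AE t\<in>{a..b} in lebesgue. f t = g t"
  shows "Linfinity_on a b g"
proof -
  obtain C where m: "(\<lambda>s. indicator {a..b} s *\<^sub>R f s) \<in> borel_measurable lebesgue"
    and C: "AE t\<in>{a..b} in lebesgue. norm (f t) \<le> C"
    using f by (auto simp: Linfinity_on_def set_borel_measurable_def)
  have "AE s in lebesgue. indicator {a..b} s *\<^sub>R f s = indicator {a..b} s *\<^sub>R g s"
    using eq by eventually_elim (auto simp: indicator_def)
  from borel_measurable_AE[OF m this] have "set_borel_measurable lebesgue {a..b} g"
    by (simp add: set_borel_measurable_def)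
  moreover have "AE t\<in>{a..b} in lebesgue. norm (g t) \<le> C"
    using eq C by eventually_elim simp
  ultimately show ?thesis unfolding Linfinity_on_def by blast
qed

lemma Linfinity_on_add:
  fixes f g :: "real \<Rightarrow> 'v::euclidean_space"
  assumes "Linfinity_on a b f" "Linfinity_on a b g"
  shows "Linfinity_on a b (\<lambda>t. f t + g t)"
proof -
  obtain C where m: "(\<lambda>s. indicator {a..b} s *\<^sub>R f s) \<in> borel_measurable lebesgue"
    and C: "AE t\<in>{a..b} in lebesgue. norm (f t) \<le> C"
    using assms(1) by (auto simp: Linfinity_on_def set_borel_measurable_def)
  obtain D where m': "(\<lambda>s. indicator {a..b} s *\<^sub>R g s) \<in> borel_measurable lebesgue"
    and D: "AE t\<in>{a..b} in lebesgue. norm (g t) \<le> D"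
    using assms(2) by (auto simp: Linfinity_on_def set_borel_measurable_def)
  have "AE t\<in>{a..b} in lebesgue. norm (f t + g t) \<le> C + D"
    using C D by eventually_elim (auto intro: norm_triangle_mono)
  moreover have "set_borel_measurable lebesgue {a..b} (\<lambda>t. f t + g t)"
    using borel_measurable_add[OF m m'] by (simp add: set_borel_measurable_def scaleR_add_right)
  ultimately show ?thesis unfolding Linfinity_on_def by blast
qed

text \<open>
  Clamping time to the interval turns \<open>G\<close> into a globally continuous, hence Borel, function;
  the bound comes from compactness of the range of \<open>X\<close> and of a ball containing almost all values
  of \<open>Z\<close>.
\<close>

lemma Linfinity_on_compose:
  fixes G :: "'v::euclidean_space \<Rightarrow> 'v \<Rightarrow> real \<Rightarrow> 'w::euclidean_space"
  assumes ab: "a \<le> b" and G: "continuous_on (UNIV \<times> UNIV \<times> {a..b}) (\<lambda>(u, v, t). G u v t)"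
    and X: "continuous_on {a..b} X" and Z: "Linfinity_on a b Z"
  shows "Linfinity_on a b (\<lambda>t. G (X t) (Z t) t)"
proof -
  obtain C where m: "(\<lambda>s. indicator {a..b} s *\<^sub>R Z s) \<in> borel_measurable lebesgue"
    and C: "AE t\<in>{a..b} in lebesgue. norm (Z t) \<le> C"
    using Z by (auto simp: Linfinity_on_def set_borel_measurable_def)
  define cl where "cl t = max a (min b t)" for t
  have cl: "continuous_on UNIV cl" "\<And>t. cl t \<in> {a..b}" "\<And>t. t \<in> {a..b} \<Longrightarrow> cl t = t"
    unfolding cl_def using ab by (auto intro!: continuous_intros)
  have "continuous_on UNIV (\<lambda>z. case (fst z, fst (snd z), cl (snd (snd z))) of (u, v, t) \<Rightarrow> G u v t)"
    by (rule continuous_on_compose2[OF G])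
      (use cl in \<open>auto intro!: continuous_intros continuous_on_compose2[OF cl(1)]\<close>)
  then have Gm: "(\<lambda>z. G (fst z) (fst (snd z)) (cl (snd (snd z)))) \<in> borel_measurable borel"
    by (intro borel_measurable_continuous_onI) simp
  have Xm: "(\<lambda>t. X (cl t)) \<in> borel_measurable lebesgue"
  proof -
    have "continuous_on UNIV (\<lambda>t. X (cl t))"
      by (rule continuous_on_compose2[OF X cl(1)]) (use cl in auto)
    then show ?thesis by (intro measurable_completion) (simp add: borel_measurable_continuous_onI)
  qed
  have "(\<lambda>t. (X (cl t), indicator {a..b} t *\<^sub>R Z t, t)) \<in> borel_measurable lebesgue"
    using Xm m by (intro borel_measurable_Pair) (auto simp: measurable_completion)
  from measurable_compose[OF this Gm]
  have comp: "(\<lambda>t. G (X (cl t)) (indicator {a..b} t *\<^sub>R Z t) (cl t)) \<in> borel_measurable lebesgue" by simp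
  have "(\<lambda>t. indicator {a..b} t *\<^sub>R G (X (cl t)) (indicator {a..b} t *\<^sub>R Z t) (cl t)) \<in> borel_measurable lebesgue"
    by (rule borel_measurable_scaleR[OF _ comp]) auto
  moreover have "indicator {a..b} t *\<^sub>R G (X (cl t)) (indicator {a..b} t *\<^sub>R Z t) (cl t)
      = indicator {a..b} t *\<^sub>R G (X t) (Z t) t" for t
    using cl(3)[of t] by (simp add: indicator_def)
  ultimately have "set_borel_measurable lebesgue {a..b} (\<lambda>t. G (X t) (Z t) t)"
    by (simp add: set_borel_measurable_def)
  moreover have "\<exists>B. AE t\<in>{a..b} in lebesgue. norm (G (X t) (Z t) t) \<le> B"
  proof -
    have "compact ((\<lambda>(u, v, t). G u v t) ` (X ` {a..b} \<times> cball 0 C \<times> {a..b}))"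
      by (intro compact_continuous_image continuous_on_subset[OF G] compact_Times X) auto
    then obtain B where B: "\<And>z. z \<in> (\<lambda>(u, v, t). G u v t) ` (X ` {a..b} \<times> cball 0 C \<times> {a..b}) \<Longrightarrow> norm z \<le> B"
      using compact_imp_bounded bounded_iff by metis
    have nb: "norm (G (X t) (Z t) t) \<le> B" if "t \<in> {a..b}" "norm (Z t) \<le> C" for t
      by (rule B) (use that in \<open>auto intro!: image_eqI[of _ _ "(X t, Z t, t)"]\<close>)
    have "AE t\<in>{a..b} in lebesgue. norm (G (X t) (Z t) t) \<le> B"
      using C by eventually_elim (use nb in auto)
    then show ?thesis ..
  qed
  ultimately show ?thesis unfolding Linfinity_on_def by blast
qed

lemma continuous_imp_Linfinity_on:
  fixes f :: "real \<Rightarrow> 'v::euclidean_space"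
  assumes "a \<le> b" "continuous_on {a..b} f"
  shows "Linfinity_on a b f"
proof -
  have Z: "Linfinity_on a b (\<lambda>_. 0 :: 'v)" by (auto simp: Linfinity_on_def set_borel_measurable_def)
  have "continuous_on (UNIV \<times> UNIV \<times> {a..b}) (\<lambda>z::'v \<times> 'v \<times> real. f (snd (snd z)))"
    by (rule continuous_on_compose2[OF assms(2)]) (auto intro!: continuous_intros)
  then have G: "continuous_on (UNIV \<times> UNIV \<times> {a..b}) (\<lambda>(u::'v, v::'v, t). f t)" by (simp add: split_beta)
  show ?thesis by (rule Linfinity_on_compose[OF assms(1) G assms(2) Z])
qed

lemma Linfinity_on_kernel_form:
  fixes f :: "real \<Rightarrow> 'v::euclidean_space"
  assumes "Linfinity_on a b f"
  obtains C where "(\<lambda>s. indicator {a..b} s *\<^sub>R f s) \<in> borel_measurable lebesgue"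
    "AE s in lebesgue. norm (indicator {a..b} s *\<^sub>R f s) \<le> C"
proof -
  obtain C where m: "(\<lambda>s. indicator {a..b} s *\<^sub>R f s) \<in> borel_measurable lebesgue"
    and C: "AE t\<in>{a..b} in lebesgue. norm (f t) \<le> C"
    using assms by (auto simp: Linfinity_on_def set_borel_measurable_def)
  have "AE s in lebesgue. norm (indicator {a..b} s *\<^sub>R f s) \<le> max 0 C"
    using C by eventually_elim (auto simp: indicator_def)
  with m show ?thesis by (rule that)
qed

lemma integrable_frac_kernel_Linfinity:
  fixes f :: "real \<Rightarrow> 'v::euclidean_space"
  assumes "0 < \<gamma>" "Linfinity_on a b f"
  shows "integrable lebesgue (\<lambda>s. frac_kernel \<gamma> s t *\<^sub>R (indicator {a..b} s *\<^sub>R f s))"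
proof -
  obtain C where C: "(\<lambda>s. indicator {a..b} s *\<^sub>R f s) \<in> borel_measurable lebesgue"
    "AE s in lebesgue. norm (indicator {a..b} s *\<^sub>R f s) \<le> C"
    by (rule Linfinity_on_kernel_form[OF assms(2)])
  show ?thesis by (rule left_frac_integral_bounded(1)[OF assms(1) C, of a]) auto
qed

text \<open>
  The integrand is essentially bounded, so its fractional integral is continuous and the value
  at \<open>b\<close> is the literal integral, for which only the almost everywhere class of the Caputo
  derivative matters.
\<close>

lemma bolza_eq:
  assumes ab: "a < b" and \<beta>: "0 < \<beta>"
    and L: "continuous_on (UNIV \<times> UNIV \<times> {a..b}) (\<lambda>(u, v, t). L u v t)"
    and X: "X \<in> caputo_AC_inf_left a b \<alpha>"
    and Z: "AE t\<in>{a..b} in lebesgue. caputo_deriv_left a b \<alpha> X t = Z t"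
  shows "bolza a b \<alpha> \<beta> \<phi> L X
    = \<phi> (X a) (X b) + (LINT s|lebesgue. frac_kernel \<beta> s b * (indicator {a..b} s * L (X s) (Z s) s))"
proof -
  have Xc: "continuous_on {a..b} X" and X': "Linfinity_on a b (caputo_deriv_left a b \<alpha> X)"
    using X by (auto simp: caputo_AC_inf_left_def caputo_AC_left_def)
  have f: "Linfinity_on a b (\<lambda>t. L (X t) (caputo_deriv_left a b \<alpha> X t) t)"
    by (rule Linfinity_on_compose[OF less_imp_le[OF ab] L Xc X'])
  have eq: "AE t\<in>{a..b} in lebesgue. L (X t) (caputo_deriv_left a b \<alpha> X t) t = L (X t) (Z t) t"
    using Z by eventually_elim simp
  have g: "Linfinity_on a b (\<lambda>t. L (X t) (Z t) t)" by (rule Linfinity_on_AE_cong[OF f eq])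
  have "frac_int_left a b \<beta> (\<lambda>t. L (X t) (caputo_deriv_left a b \<alpha> X t) t) b
      = left_frac \<beta> (\<lambda>s. indicator {a..b} s *\<^sub>R L (X s) (caputo_deriv_left a b \<alpha> X s) s) b"
    using ab by (intro frac_int_left_bounded \<beta> f) auto
  also have "\<dots> = left_frac \<beta> (\<lambda>s. indicator {a..b} s *\<^sub>R L (X s) (Z s) s) b"
  proof (rule integral_cong_AE)
    show "AE s in lebesgue. frac_kernel \<beta> s b *\<^sub>R (indicator {a..b} s *\<^sub>R L (X s) (caputo_deriv_left a b \<alpha> X s) s)
       = frac_kernel \<beta> s b *\<^sub>R (indicator {a..b} s *\<^sub>R L (X s) (Z s) s)"
      using eq by eventually_elim (auto simp: indicator_def)
  qed (intro borel_measurable_integrable integrable_frac_kernel_Linfinity \<beta> f g)+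
  finally show ?thesis by (simp add: bolza_def)
qed

text \<open>
  Adding a constant and the fractional integral of a bounded \<open>u\<close> changes \<open>x - x a\<close> by the fractional
  integral of \<open>u\<close>. The semigroup law turns the fractional integral of order \<open>1 - \<alpha>\<close> of this change
  into the ordinary indefinite integral of \<open>u\<close>. Its derivative is \<open>u\<close> almost everywhere. It can be
  added to the derivative of the term of \<open>x\<close> wherever the latter exists, that is, almost everywhere.
\<close>

lemma caputo_variation:
  fixes x u :: "real \<Rightarrow> 'v::euclidean_space" and h0 :: 'v
  assumes ab: "a < b" and \<alpha>: "0 < \<alpha>" "\<alpha> \<le> 1" and x: "x \<in> caputo_AC_inf_left a b \<alpha>"
    and u [measurable]: "u \<in> borel_measurable lebesgue" and C: "\<And>s. norm (u s) \<le> C"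
    and supp: "\<And>s. s \<notin> {a..b} \<Longrightarrow> u s = 0"
  defines "X \<equiv> \<lambda>t. x t + (h0 + (left_frac \<alpha> u t))"
  shows "X \<in> caputo_AC_inf_left a b \<alpha>"
    and "AE t\<in>{a..b} in lebesgue. caputo_deriv_left a b \<alpha> X t = caputo_deriv_left a b \<alpha> x t + u t"
proof -
  define J where "J t = left_frac \<alpha> u t" for t
  define d where "d t = x t - x a" for t
  have le: "a \<le> b" using ab by simp
  have xc: "continuous_on {a..b} x" and xAC: "d \<in> AC_left a b \<alpha>"
    and xinf: "Linfinity_on a b (caputo_deriv_left a b \<alpha> x)"
    using x by (auto simp: caputo_AC_inf_left_def caputo_AC_left_def d_def[abs_def])
  have uAE: "AE s in lebesgue. norm (u s) \<le> C" using C by simp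
  have supp': "u s = 0" if "s < a" for s using supp that by simp
  have J0: "J t = 0" if "t \<le> a" for t
  proof -
    have "frac_kernel \<alpha> s t *\<^sub>R u s = 0" for s using supp'[of s] that by (simp add: frac_kernel_def)
    then show ?thesis unfolding J_def by (intro integral_eq_zero_AE AE_I2)
  qed
  have Jc: "continuous_on UNIV J"
    unfolding J_def using \<alpha> supp' by (intro left_frac_integral_bounded(2)[OF _ u uAE, of _ a]) auto
  have dc: "continuous_on {a..b} d" unfolding d_def using xc by (intro continuous_intros)
  have Xc: "continuous_on {a..b} X"
    unfolding X_def J_def[symmetric] using xc continuous_on_subset[OF Jc, of "{a..b}"]
    by (intro continuous_intros) auto
  have Xa: "X t - X a = d t + J t" for t
    using J0[of a] by (simp add: X_def J_def[symmetric] d_def)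
  have dJc: "continuous_on {a..b} (\<lambda>t. d t + J t)"
    using dc continuous_on_subset[OF Jc, of "{a..b}"] by (intro continuous_intros) auto
  have uint: "integrable lebesgue u"
  proof -
    have "integrable lebesgue (\<lambda>s. C * indicator {a..b} s)"
      using ab by (intro integrable_mult_right integrable_real_indicator) auto
    moreover have "AE s in lebesgue. norm (u s) \<le> norm (C * indicator {a..b} s)"
    proof (intro AE_I2)
      fix s show "norm (u s) \<le> norm (C * indicator {a..b} s)"
        using C[of s] supp[of s] by (cases "s \<in> {a..b}") auto
    qed
    ultimately show ?thesis by (rule Bochner_Integration.integrable_bound[OF _ u])
  qed
  define U where "U t = left_frac 1 u t" for t
  define g where "g = frac_int_left a b (1 - \<alpha>) d"
  have split: "frac_int_left a b (1 - \<alpha>) (\<lambda>t. d t + J t) t = g t + U t" if t: "t \<in> {a..b}" for t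
  proof (cases "\<alpha> = 1")
    case True
    have "frac_int_left a b (1 - \<alpha>) (\<lambda>t. d t + J t) t = d t + J t"
      unfolding frac_int_left_def using True by (simp add: cont_rep_eq[OF ab dJc _ t])
    moreover have "g t = d t"
      unfolding g_def frac_int_left_def using True by (simp add: cont_rep_eq[OF ab dc _ t])
    ultimately show ?thesis using True by (simp add: J_def U_def)
  next
    case False
    then have \<gamma>: "0 < 1 - \<alpha>" using \<alpha> by simp
    have dinf: "Linfinity_on a b d" by (rule continuous_imp_Linfinity_on[OF le dc])
    have Jinf: "Linfinity_on a b J"
      by (rule continuous_imp_Linfinity_on[OF le continuous_on_subset[OF Jc]]) simp
    have "frac_int_left a b (1 - \<alpha>) (\<lambda>t. d t + J t) t
      = left_frac (1 - \<alpha>) (\<lambda>s. indicator {a..b} s *\<^sub>R (d s + J s)) t"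
      by (rule frac_int_left_bounded[OF ab \<gamma> continuous_imp_Linfinity_on[OF le dJc] t])
    also have "\<dots> = (LINT s|lebesgue. frac_kernel (1 - \<alpha>) s t *\<^sub>R (indicator {a..b} s *\<^sub>R d s)
       + frac_kernel (1 - \<alpha>) s t *\<^sub>R (indicator {a..b} s *\<^sub>R J s))"
      by (simp only: scaleR_add_right)
    also have "\<dots> = left_frac (1 - \<alpha>) (\<lambda>s. indicator {a..b} s *\<^sub>R d s) t
       + (left_frac (1 - \<alpha>) (\<lambda>s. indicator {a..b} s *\<^sub>R J s) t)"
      by (intro Bochner_Integration.integral_add integrable_frac_kernel_Linfinity \<gamma> dinf Jinf)
    also have "(left_frac (1 - \<alpha>) (\<lambda>s. indicator {a..b} s *\<^sub>R d s) t) = g t"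
      unfolding g_def by (rule frac_int_left_bounded[OF ab \<gamma> dinf t, symmetric])
    also have "(left_frac (1 - \<alpha>) (\<lambda>s. indicator {a..b} s *\<^sub>R J s) t)
      = left_frac (1 - \<alpha>) J t"
    proof (intro Bochner_Integration.integral_cong refl)
      fix s
      show "frac_kernel (1 - \<alpha>) s t *\<^sub>R (indicator {a..b} s *\<^sub>R J s) = frac_kernel (1 - \<alpha>) s t *\<^sub>R J s"
        using J0[of s] t by (cases "s \<le> a") (auto simp: indicator_def frac_kernel_def)
    qed
    also have "\<dots> = left_frac (\<alpha> + (1 - \<alpha>)) u t"
      unfolding J_def
      by (rule frac_kernel_semigroup_left[OF \<alpha>(1) \<gamma> u])
        (rule left_frac_integral_bounded(1)[OF _ u uAE, of _ a], use supp' in auto)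
    also have "\<dots> = U t" by (simp add: U_def)
    finally show ?thesis .
  qed
  have gAC: "abs_continuous_on a b g" using xAC by (simp add: AC_left_def g_def)
  have UAC: "abs_continuous_on a b U"
    unfolding U_def by (rule indefinite_integral_abs_continuous[OF uint])
  have sumAC: "abs_continuous_on a b (frac_int_left a b (1 - \<alpha>) (\<lambda>t. d t + J t))"
    by (subst abs_continuous_on_cong[where g="\<lambda>t. g t + U t"]) (rule split, assumption, rule abs_continuous_on_add[OF gAC UAC])
  have Xin: "(\<lambda>t. X t - X a) \<in> AC_left a b \<alpha>"
    unfolding Xa AC_left_def using sumAC absolutely_integrable_continuous_real[OF dJc] by blast
  show deriv: "AE t\<in>{a..b} in lebesgue. caputo_deriv_left a b \<alpha> X t = caputo_deriv_left a b \<alpha> x t + u t"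
  proof -
    have "AE t in lebesgue. t \<noteq> a" "AE t in lebesgue. t \<noteq> b"
      by (rule AE_I[of _ _ "{a}"] AE_I[of _ _ "{b}"]; auto)+
    then show ?thesis
      using abs_continuous_on_imp_AE_differentiable[OF ab gAC] indefinite_integral_AE_derivative[OF uint]
    proof eventually_elim
      case (elim t)
      show ?case
      proof
        assume "t \<in> {a..b}"
        then have t: "t \<in> {a<..<b}" using elim by auto
        then have "(g has_vector_derivative vector_derivative g (at t)) (at t)"
          using elim by (simp add: vector_derivative_works)
        moreover have "(U has_vector_derivative u t) (at t)" using elim unfolding U_def by simp
        ultimately have "((\<lambda>t. g t + U t) has_vector_derivative (vector_derivative g (at t) + u t)) (at t)"
          by (rule has_vector_derivative_add)
        then have "(frac_int_left a b (1 - \<alpha>) (\<lambda>t. d t + J t) has_vector_derivative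
            (vector_derivative g (at t) + u t)) (at t)"
          by (rule has_vector_derivative_transform_within_open[OF _ open_greaterThanLessThan t])
            (simp add: split)
        then show "caputo_deriv_left a b \<alpha> X t = caputo_deriv_left a b \<alpha> x t + u t"
          unfolding caputo_deriv_left_def frac_deriv_left_def Xa
          by (simp add: vector_derivative_at g_def d_def[abs_def])
      qed
    qed
  qed
  have "Linfinity_on a b u"
    unfolding Linfinity_on_def set_borel_measurable_def using uAE
    by (auto intro!: exI[of _ C] borel_measurable_scaleR)
  from Linfinity_on_add[OF xinf this]
  have "Linfinity_on a b (\<lambda>t. caputo_deriv_left a b \<alpha> x t + u t)" .
  then have "Linfinity_on a b (caputo_deriv_left a b \<alpha> X)"
    by (rule Linfinity_on_AE_cong) (use deriv in eventually_elim, simp)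
  then show "X \<in> caputo_AC_inf_left a b \<alpha>"
    using Xc Xin by (simp add: caputo_AC_inf_left_def caputo_AC_left_def)
qed

section \<open>Needles\<close>

text \<open>
  Test with the part of \<open>{F < - 2 * \<eta>}\<close> inside an interval of length \<open>\<delta>\<close>: on it the integral of \<open>F\<close>
  is at most \<open>- 2 * \<eta>\<close> times its measure, which contradicts the hypothesis unless that
  measure is zero.
\<close>

lemma AE_nonneg_if_small_set_integrals_almost_nonneg:
  fixes F :: "real \<Rightarrow> real"
  assumes F: "set_integrable lebesgue {a..b} F"
    and small: "\<And>\<eta>. \<eta> > 0 \<Longrightarrow> \<exists>\<delta>>0. \<forall>E\<in>sets lebesgue. E \<subseteq> {a..b} \<longrightarrow> measure lebesgue E \<le> \<delta> \<longrightarrow>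
        - \<eta> * measure lebesgue E \<le> (LINT s|lebesgue. indicator E s * F s)"
  shows "AE s\<in>{a..b} in lebesgue. 0 \<le> F s"
proof -
  define G where "G s = indicator {a..b} s * F s" for s
  have G: "integrable lebesgue G" using F by (simp add: G_def[abs_def] set_integrable_def)
  have [measurable]: "G \<in> borel_measurable lebesgue" using G by auto
  have "AE s in lebesgue. - 2 * \<eta> \<le> G s" if \<eta>: "\<eta> > 0" for \<eta>
  proof -
    obtain \<delta> where \<delta>: "\<delta> > 0" "\<And>E. \<lbrakk>E \<in> sets lebesgue; E \<subseteq> {a..b}; measure lebesgue E \<le> \<delta>\<rbrakk> \<Longrightarrow>
        - \<eta> * measure lebesgue E \<le> (LINT s|lebesgue. indicator E s * F s)"
      using small[OF \<eta>] by blast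
    have "AE s in lebesgue. s \<in> {q..q + \<delta>} \<longrightarrow> - 2 * \<eta> \<le> G s" for q
    proof -
      define E where "E = {s \<in> {q..q + \<delta>}. G s < - 2 * \<eta>}"
      have "{s \<in> space lebesgue. G s < - 2 * \<eta>} \<inter> {q..q + \<delta>} \<in> sets lebesgue"
        by (intro sets.Int borel_measurable_less) auto
      moreover have "E = {s \<in> space lebesgue. G s < - 2 * \<eta>} \<inter> {q..q + \<delta>}" by (auto simp: E_def)
      ultimately have Em: "E \<in> sets lebesgue" by simp
      have "E \<subseteq> {a..b}" using \<eta> by (auto simp: E_def G_def indicator_def split: if_splits)
      have "E \<subseteq> {q..q + \<delta>}" by (auto simp: E_def)
      moreover have Q: "{q..q + \<delta>} \<in> lmeasurable" by simp
      ultimately have fm: "E \<in> lmeasurable" using Em by (metis fmeasurableI2)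
      have "measure lebesgue E \<le> measure lebesgue {q..q + \<delta>}"
        using \<open>E \<subseteq> {q..q + \<delta>}\<close> Em Q by (rule measure_mono_fmeasurable)
      then have "measure lebesgue E \<le> \<delta>" using \<delta>(1) by simp
      from \<delta>(2)[OF Em \<open>E \<subseteq> {a..b}\<close> this]
      have "- \<eta> * measure lebesgue E \<le> (LINT s|lebesgue. indicator E s * F s)" .
      also have "\<dots> \<le> (LINT s|lebesgue. - 2 * \<eta> * indicator E s)"
      proof (rule integral_mono)
        have "indicator E s * F s = indicator E s * G s" for s
          using \<open>E \<subseteq> {a..b}\<close> by (auto simp: G_def indicator_def)
        then have "(\<lambda>s. indicator E s * F s) = (\<lambda>s. indicator E s *\<^sub>R G s)"
          by (intro ext) (simp only: real_scaleR_def)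
        then show "integrable lebesgue (\<lambda>s. indicator E s * F s)"
          using integrable_mult_indicator[OF Em G] by (simp only:)
        show "integrable lebesgue (\<lambda>s. - 2 * \<eta> * indicator E s)"
          using fm by (intro integrable_mult_right integrable_real_indicator) (auto simp: fmeasurable_def)
        show "indicator E s * F s \<le> - 2 * \<eta> * indicator E s" for s
          using \<open>E \<subseteq> {a..b}\<close> by (auto simp: E_def G_def indicator_def)
      qed
      also have "\<dots> = - 2 * \<eta> * measure lebesgue E" using Em by simp
      finally have "\<eta> * measure lebesgue E \<le> 0" by linarith
      then have "measure lebesgue E = 0" using \<eta> measure_nonneg[of lebesgue E] by (simp add: mult_le_0_iff)
      then have "emeasure lebesgue E = 0" using fm by (simp add: emeasure_eq_measure2)
      then have "E \<in> null_sets lebesgue" using Em by auto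
      then show ?thesis by (rule AE_I') (auto simp: E_def)
    qed
    then have "AE s in lebesgue. \<forall>q\<in>\<rat>. s \<in> {q..q + \<delta>} \<longrightarrow> - 2 * \<eta> \<le> G s"
      by (subst AE_ball_countable[OF countable_rat]) blast
    then show ?thesis
    proof eventually_elim
      case (elim s)
      obtain q where "q \<in> \<rat>" "s - \<delta> < q" "q < s" using Rats_dense_in_real[of "s - \<delta>" s] \<delta>(1) by auto
      then have "s \<in> {q..q + \<delta>}" by simp
      then show ?case using elim \<open>q \<in> \<rat>\<close> by blast
    qed
  qed
  then have "AE s in lebesgue. - 2 * inverse (real (Suc n)) \<le> G s" for n by simp
  then have "AE s in lebesgue. \<forall>n. - 2 * inverse (real (Suc n)) \<le> G s"
    unfolding AE_all_countable by blast
  then show ?thesis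
  proof eventually_elim
    case (elim s)
    show ?case
    proof
      assume "s \<in> {a..b}"
      then have GF: "G s = F s" by (simp add: G_def)
      have "(\<lambda>n. - 2 * inverse (real (Suc n))) \<longlonglongrightarrow> - 2 * 0"
        by (intro tendsto_intros LIMSEQ_inverse_real_of_nat)
      then show "0 \<le> F s" using elim GF by (intro LIMSEQ_le_const2[of _ 0]) auto
    qed
  qed
qed

text \<open>
  The left fractional integral of the indicator function of \<open>E\<close>.
\<close>

definition needle :: "real \<Rightarrow> real set \<Rightarrow> real \<Rightarrow> real" where
  "needle \<alpha> E t = (LINT s|lebesgue. frac_kernel \<alpha> s t * indicator E s)"

lemma frac_kernel_bounded_left_of:
  assumes "0 < \<gamma>" "c < b"
  obtains C where "0 \<le> C" "\<And>s. s \<in> {a..c} \<Longrightarrow> frac_kernel \<gamma> s b \<le> C"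
proof -
  have "continuous_on {a..c} (\<lambda>s. (b - s) powr (\<gamma> - 1) / Gamma \<gamma>)"
    using assms less_imp_neq[OF Gamma_real_pos[OF assms(1)]] by (intro continuous_intros) auto
  then have "compact ((\<lambda>s. (b - s) powr (\<gamma> - 1) / Gamma \<gamma>) ` {a..c})"
    by (rule compact_continuous_image) simp
  then obtain C where C: "\<And>z. z \<in> (\<lambda>s. (b - s) powr (\<gamma> - 1) / Gamma \<gamma>) ` {a..c} \<Longrightarrow> norm z \<le> C"
    using compact_imp_bounded bounded_iff by metis
  show ?thesis
  proof (rule that[of "max 0 C"])
    fix s assume s: "s \<in> {a..c}"
    then have "norm ((b - s) powr (\<gamma> - 1) / Gamma \<gamma>) \<le> C" by (intro C) auto
    then show "frac_kernel \<gamma> s b \<le> max 0 C" using s assms by (auto simp: frac_kernel_def)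
  qed simp
qed

context
  fixes \<alpha> a c :: real and E :: "real set"
  assumes \<alpha>: "0 < \<alpha>" and E [measurable]: "E \<in> sets lebesgue" and Eac: "E \<subseteq> {a..c}"
begin

lemma lmeasurable_needle_support: "E \<in> lmeasurable"
  using Eac E by (metis fmeasurableI2 lmeasurable_interval(1) box_real(2) lmeasurable_cbox)

lemma indicator_support_measurable [measurable]: "(\<lambda>s. indicat_real E s) \<in> borel_measurable lebesgue"
  by measurable

lemma kernel_indicator:
  assumes "0 < \<gamma>"
  shows kernel_indicator_integrable: "integrable lebesgue (\<lambda>s. frac_kernel \<gamma> s t * indicat_real E s)"
    and kernel_indicator_continuous: "continuous_on UNIV (\<lambda>t. LINT s|lebesgue. frac_kernel \<gamma> s t * indicat_real E s)"
proof -
  have zero: "indicat_real E s = 0" if "s < a" for s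
    using Eac that by (force simp: indicator_def)
  have one: "AE s in lebesgue. norm (indicat_real E s) \<le> 1" by simp
  note * = left_frac_integral_bounded[OF assms indicator_support_measurable one zero]
  show "integrable lebesgue (\<lambda>s. frac_kernel \<gamma> s t * indicat_real E s)"
    using *(1) by (simp only: real_scaleR_def)
  show "continuous_on UNIV (\<lambda>t. LINT s|lebesgue. frac_kernel \<gamma> s t * indicat_real E s)"
    using *(2) by (simp only: real_scaleR_def)
qed

lemmas needle_integrable = kernel_indicator_integrable[OF \<alpha>]

lemma needle_continuous: "continuous_on UNIV (needle \<alpha> E)"
  using kernel_indicator_continuous[OF \<alpha>] by (simp only: needle_def[abs_def])

lemma needle_nonneg: "0 \<le> needle \<alpha> E t"
  unfolding needle_def using \<alpha> by (intro Bochner_Integration.integral_nonneg) simp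

lemma needle_nn_integral: "(\<integral>\<^sup>+ s. ennreal (frac_kernel \<alpha> s t * indicator E s) \<partial>lebesgue) = ennreal (needle \<alpha> E t)"
  unfolding needle_def using \<alpha> by (intro nn_integral_eq_integral needle_integrable) auto

lemma needle_eq_0: "t \<le> a \<Longrightarrow> needle \<alpha> E t = 0"
  unfolding needle_def using Eac by (intro integral_eq_zero_AE AE_I2) (auto simp: frac_kernel_def indicator_def)

text \<open>
  The singular part of the kernel, within distance \<open>r\<close> of \<open>t\<close>, is integrated over the whole interval
  \<open>{t - r..t}\<close>. Further away the kernel is at most \<open>r powr (\<alpha> - 1) / Gamma \<alpha>\<close>. This bound does not
  depend on \<open>t\<close>.
\<close>

lemma needle_le:
  assumes "\<alpha> \<le> 1" "r > 0"
  shows "needle \<alpha> E t \<le> r powr \<alpha> / Gamma (\<alpha> + 1) + r powr (\<alpha> - 1) / Gamma \<alpha> * measure lebesgue E"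
proof -
  define K where "K = r powr (\<alpha> - 1) / Gamma \<alpha>"
  have K: "K \<ge> 0" using \<alpha> by (simp add: K_def)
  let ?near = "\<lambda>s. frac_kernel 1 (t - r) s * frac_kernel \<alpha> s t"
  have nn: "(\<integral>\<^sup>+ s. ennreal (?near s) \<partial>lebesgue) = ennreal (frac_kernel (1 + \<alpha>) (t - r) t)"
    using nn_integral_frac_kernel_comp[OF zero_less_one \<alpha>, of "t - r" t] by (simp add: nn_integral_completion)
  have near_nonneg: "0 \<le> ?near s" for s using \<alpha> by simp
  have near: "integrable lebesgue ?near"
    using nn near_nonneg by (intro integrableI_nonneg) auto
  have near_val: "(LINT s|lebesgue. ?near s) = r powr \<alpha> / Gamma (\<alpha> + 1)"
    using nn near_nonneg \<alpha> assms(2)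
    by (subst integral_eq_nn_integral) (auto simp: frac_kernel_def add.commute)
  have far: "integrable lebesgue (\<lambda>s. K * indicator E s)"
    using lmeasurable_needle_support
    by (intro integrable_mult_right integrable_real_indicator) (auto simp: fmeasurable_def)
  have "needle \<alpha> E t \<le> (LINT s|lebesgue. ?near s + K * indicator E s)"
    unfolding needle_def
  proof (rule integral_mono)
    fix s
    show "frac_kernel \<alpha> s t * indicator E s \<le> ?near s + K * indicator E s"
    proof (cases "t - r < s")
      case True
      have "frac_kernel \<alpha> s t * indicator E s \<le> frac_kernel \<alpha> s t"
        using \<alpha> by (simp add: indicator_def)
      moreover have "0 \<le> K * indicator E s" using K by simp
      ultimately show ?thesis using True by (simp add: frac_kernel_one)
    next
      case False
      then have "(t - s) powr (\<alpha> - 1) \<le> r powr (\<alpha> - 1)"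
        using assms by (intro powr_mono2') auto
      then have "frac_kernel \<alpha> s t \<le> K"
        using \<alpha> K by (auto simp: frac_kernel_def K_def divide_right_mono)
      then have "frac_kernel \<alpha> s t * indicator E s \<le> K * indicator E s"
        by (intro mult_right_mono) auto
      then show ?thesis using near_nonneg[of s] by linarith
    qed
  qed (use needle_integrable near far in auto)
  also have "\<dots> = r powr \<alpha> / Gamma (\<alpha> + 1) + K * measure lebesgue E"
    using near far near_val lmeasurable_needle_support by (simp add: fmeasurable_def)
  finally show ?thesis by (simp add: K_def)
qed

lemma integral_kernel_on_support_le:
  assumes "0 < \<gamma>" "\<And>s. s \<in> {a..c} \<Longrightarrow> frac_kernel \<gamma> s b \<le> C"
  shows "(LINT s|lebesgue. frac_kernel \<gamma> s b * indicator E s) \<le> C * measure lebesgue E"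
proof -
  have far: "integrable lebesgue (\<lambda>s. C * indicator E s)"
    using lmeasurable_needle_support
    by (intro integrable_mult_right integrable_real_indicator) (auto simp: fmeasurable_def)
  have "integrable lebesgue (\<lambda>s. frac_kernel \<gamma> s b * indicator E s)"
    by (rule kernel_indicator_integrable[OF assms(1)])
  then have "(LINT s|lebesgue. frac_kernel \<gamma> s b * indicator E s) \<le> (LINT s|lebesgue. C * indicator E s)"
    using far by (rule integral_mono) (use assms Eac in \<open>auto simp: indicator_def\<close>)
  also have "\<dots> = C * measure lebesgue E" using lmeasurable_needle_support by (simp add: fmeasurable_def)
  finally show ?thesis .
qed

text \<open>
  The singular weight does no harm: by the semigroup law it only raises the index of the kernel
  from \<open>\<alpha>\<close> to \<open>\<alpha> + \<beta>\<close>. On sets \<open>E\<close> away from \<open>b\<close> the integral is therefore of the order of the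
  measure of \<open>E\<close>.
\<close>

lemma weighted_needle_integral:
  assumes \<beta>: "0 < \<beta>"
  shows "integrable lebesgue (\<lambda>t. frac_kernel \<beta> t b * needle \<alpha> E t)"
    and "(LINT t|lebesgue. frac_kernel \<beta> t b * needle \<alpha> E t)
       = (LINT s|lebesgue. frac_kernel (\<alpha> + \<beta>) s b * indicator E s)"
proof -
  have ind: "integrable lebesgue (\<lambda>s. frac_kernel (\<alpha> + \<beta>) s b *\<^sub>R indicat_real E s)"
    using kernel_indicator_integrable[of "\<alpha> + \<beta>" b] \<alpha> \<beta> by (simp only: real_scaleR_def add_pos_pos)
  have M: "(\<integral>\<^sup>+ t. ennreal (frac_kernel \<beta> t b * frac_kernel \<alpha> s t) \<partial>lebesgue) = ennreal (frac_kernel (\<alpha> + \<beta>) s b)" for s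
    using nn_integral_frac_kernel_comp[OF \<alpha> \<beta>, of s b] by (simp add: nn_integral_completion mult.commute)
  note * = fubini_nonneg_kernel(1,2)[OF _ _ _ indicator_support_measurable M ind]
  have eq: "(LINT s|lebesgue. (frac_kernel \<beta> t b * frac_kernel \<alpha> s t) *\<^sub>R indicat_real E s)
      = frac_kernel \<beta> t b * needle \<alpha> E t" for t
    by (simp add: needle_def mult.assoc)
  show "integrable lebesgue (\<lambda>t. frac_kernel \<beta> t b * needle \<alpha> E t)"
    using *(1) \<alpha> \<beta> unfolding eq by simp
  show "(LINT t|lebesgue. frac_kernel \<beta> t b * needle \<alpha> E t)
       = (LINT s|lebesgue. frac_kernel (\<alpha> + \<beta>) s b * indicator E s)"
    using *(2) \<alpha> \<beta> unfolding eq by simp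
qed

text \<open>
  The left fractional integral of the indicator function of \<open>E\<close> is moved onto \<open>f\<close> as a right fractional
  integral.
\<close>

lemma needle_duality:
  fixes f :: "real \<Rightarrow> 'v::euclidean_space"
  assumes f: "integrable lebesgue (\<lambda>t. needle \<alpha> E t *\<^sub>R f t)" and [measurable]: "f \<in> borel_measurable lebesgue"
  shows "integrable lebesgue (\<lambda>s. indicator E s *\<^sub>R (right_frac \<alpha> f s))"
    and "(LINT t|lebesgue. needle \<alpha> E t *\<^sub>R f t)
       = (LINT s|lebesgue. indicator E s *\<^sub>R (right_frac \<alpha> f s))"
proof -
  have nonneg: "0 \<le> frac_kernel \<alpha> s t * indicator E s" "0 \<le> needle \<alpha> E t" for s t
    using \<alpha> needle_nonneg by auto
  note * = fubini_nonneg_kernel(1,2)[OF _ nonneg assms(2) needle_nn_integral f]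
  have eq: "(LINT t|lebesgue. (frac_kernel \<alpha> s t * indicator E s) *\<^sub>R f t)
      = indicator E s *\<^sub>R (right_frac \<alpha> f s)" for s
    by (simp add: indicator_def)
  show "integrable lebesgue (\<lambda>s. indicator E s *\<^sub>R (right_frac \<alpha> f s))"
    using *(1) unfolding eq by simp
  show "(LINT t|lebesgue. needle \<alpha> E t *\<^sub>R f t)
       = (LINT s|lebesgue. indicator E s *\<^sub>R (right_frac \<alpha> f s))"
    using *(2) unfolding eq by simp
qed

end

text \<open>
  Choose \<open>r\<close> such that the near part in \<open>needle_le\<close> equals \<open>\<epsilon> / 2\<close>, then the measure of \<open>E\<close>.
\<close>

lemma needle_small:
  assumes \<alpha>: "0 < \<alpha>" "\<alpha> \<le> 1" and \<epsilon>: "\<epsilon> > 0"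
  obtains \<delta> where "\<delta> > 0" "\<And>E t a c. \<lbrakk>E \<in> sets lebesgue; E \<subseteq> {a..c}; measure lebesgue E \<le> \<delta>\<rbrakk> \<Longrightarrow> needle \<alpha> E t \<le> \<epsilon>"
proof -
  have G: "Gamma (\<alpha> + 1) > 0" "Gamma \<alpha> > 0" using \<alpha> by auto
  define r where "r = (\<epsilon> / 2 * Gamma (\<alpha> + 1)) powr (1 / \<alpha>)"
  have r: "r > 0" using \<epsilon> G by (simp add: r_def)
  have r1: "r powr \<alpha> / Gamma (\<alpha> + 1) = \<epsilon> / 2" 
    using \<epsilon> G less_imp_neq[OF G(1)] \<alpha> by (simp add: r_def powr_powr)
  define K where "K = r powr (\<alpha> - 1) / Gamma \<alpha>"
  have K: "K > 0" using r G by (simp add: K_def)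
  show ?thesis
  proof (rule that[of "\<epsilon> / (2 * K)"])
    fix E :: "real set" and t a c assume E: "E \<in> sets lebesgue" "E \<subseteq> {a..c}" "measure lebesgue E \<le> \<epsilon> / (2 * K)"
    have "needle \<alpha> E t \<le> \<epsilon> / 2 + K * measure lebesgue E"
      using needle_le[OF \<alpha>(1) E(1,2) \<alpha>(2) r, of t] by (simp add: r1 K_def)
    also have "K * measure lebesgue E \<le> \<epsilon> / 2" using E(3) K by (simp add: field_simps)
    finally show "needle \<alpha> E t \<le> \<epsilon>" by simp
  qed (use \<epsilon> K in auto)
qed

section \<open>The Weierstrass condition for a minimizer\<close>

text \<open>
  The data of the problem after the fractional calculus has been removed: \<open>Y\<close> is a bounded
  representative of the Caputo derivative of the minimizer \<open>x\<close>, \<open>d1\<close> and \<open>d2\<close> are the partial gradients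
  of \<open>\<phi>\<close> at its end points, and minimality is stated for needle variations and constant shifts.
\<close>

locale bolza_minimizer =
  fixes a b \<alpha> \<beta> R :: real
    and \<phi> :: "'v::euclidean_space \<Rightarrow> 'v \<Rightarrow> real" and d1 d2 :: 'v
    and L :: "'v \<Rightarrow> 'v \<Rightarrow> real \<Rightarrow> real" and L1 :: "'v \<Rightarrow> 'v \<Rightarrow> real \<Rightarrow> 'v"
    and x Y :: "real \<Rightarrow> 'v"
  assumes ab: "a < b" and \<alpha>: "0 < \<alpha>" "\<alpha> \<le> 1" and \<beta>: "0 < \<beta>"
    and x: "continuous_on {a..b} x" "\<And>t. t \<in> {a..b} \<Longrightarrow> norm (x t) \<le> R"
    and Y: "Y \<in> borel_measurable lebesgue" "\<And>t. norm (Y t) \<le> R"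
    and deriv_\<phi>: "((\<lambda>(u, v). \<phi> u v) has_derivative (\<lambda>(h, k). h \<bullet> d1 + k \<bullet> d2)) (at (x a, x b))"
    and deriv_L: "\<And>u v t. t \<in> {a..b} \<Longrightarrow> ((\<lambda>u. L u v t) has_derivative (\<lambda>h. h \<bullet> L1 u v t)) (at u)"
    and cont_L: "continuous_on (UNIV \<times> UNIV \<times> {a..b}) (\<lambda>(u, v, t). L u v t)"
    and cont_L1: "continuous_on (UNIV \<times> UNIV \<times> {a..b}) (\<lambda>(u, v, t). L1 u v t)"
    and minimal: "\<And>h0 v E. E \<in> sets lebesgue \<Longrightarrow> E \<subseteq> {a..b} \<Longrightarrow>
      \<phi> (x a) (x b) + (LINT t|lebesgue. frac_kernel \<beta> t b * (indicator {a..b} t * L (x t) (Y t) t))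
      \<le> \<phi> (x a + h0) (x b + (h0 + needle \<alpha> E b *\<^sub>R v)) + (LINT t|lebesgue. frac_kernel \<beta> t b *
          (indicator {a..b} t * L (x t + (h0 + needle \<alpha> E t *\<^sub>R v)) (Y t + indicator E t *\<^sub>R v) t))"
begin

text \<open>
  The weighted gradient of \<open>L\<close> in the state variable along the minimizer, extended by zero.
\<close>

definition state_force :: "real \<Rightarrow> 'v" where
  "state_force t = frac_kernel \<beta> t b *\<^sub>R (indicator {a..b} t *\<^sub>R L1 (x t) (Y t) t)"

definition weight :: "real \<Rightarrow> real" where
  "weight t = frac_kernel \<beta> t b *\<^sub>R (indicator {a..b} t *\<^sub>R 1)"

lemma weight_nonneg: "0 \<le> weight t"
  using \<beta> by (simp add: weight_def)

lemma state_force_eq: "state_force t = weight t *\<^sub>R L1 (x t) (Y t) t"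
  by (simp add: state_force_def weight_def)

lemma Y_Linf: "Linfinity_on a b Y"
  unfolding Linfinity_on_def set_borel_measurable_def
  using Y by (auto intro!: borel_measurable_scaleR exI[of _ R])

lemma indicator_Linf: "E \<in> sets lebesgue \<Longrightarrow> Linfinity_on a b (\<lambda>t. indicator E t *\<^sub>R (v::'v))"
  unfolding Linfinity_on_def set_borel_measurable_def
  by (auto intro!: borel_measurable_scaleR exI[of _ "norm v"] simp: indicator_def)

lemma weighted_integrable:
  fixes K :: "'v \<Rightarrow> 'v \<Rightarrow> real \<Rightarrow> 'w::euclidean_space"
  assumes "continuous_on (UNIV \<times> UNIV \<times> {a..b}) (\<lambda>(u, v, t). K u v t)"
    and "continuous_on {a..b} X" and "Linfinity_on a b Z"
  shows "integrable lebesgue (\<lambda>t. weight t *\<^sub>R K (X t) (Z t) t)"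
  using integrable_frac_kernel_Linfinity[OF \<beta> Linfinity_on_compose[OF less_imp_le[OF ab] assms]]
  by (simp add: weight_def)

lemma state_force_integrable: "integrable lebesgue state_force"
  using weighted_integrable[OF cont_L1 x(1) Y_Linf] by (simp add: state_force_eq[abs_def])

lemma weight_integrable: "integrable lebesgue weight"
  using weighted_integrable[OF _ x(1) Y_Linf, of "\<lambda>_ _ _. 1::real"] by simp

lemma weighted_L_integrable:
  assumes "continuous_on {a..b} X" "Linfinity_on a b Z"
  shows "integrable lebesgue (\<lambda>t. weight t * L (X t) (Z t) t)"
  using weighted_integrable[OF cont_L assms] by simp

lemma weighted_L_eq: "frac_kernel \<beta> t b * (indicator {a..b} t * r) = weight t * r"
  by (simp add: weight_def)

text \<open>
  First order upper bound for the change of the cost under the variation with displacement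
  \<open>h0 + needle \<alpha> E t *\<^sub>R v\<close>. Outside \<open>E\<close> the integrand is linearized in the state. On \<open>E\<close> its
  velocity jumps by \<open>v\<close>, which gives the difference of values of \<open>L\<close>, and replacing the gradient at the
  new velocity by the one at the old velocity costs the last term. The term with \<open>\<eta>\<close> is the error of
  linearization.
\<close>

definition variation_bound :: "real \<Rightarrow> real \<Rightarrow> 'v \<Rightarrow> 'v \<Rightarrow> real set \<Rightarrow> real" where
  "variation_bound \<eta> C h0 v E = h0 \<bullet> d1 + (h0 + needle \<alpha> E b *\<^sub>R v) \<bullet> d2
        + (LINT t|lebesgue. (h0 + needle \<alpha> E t *\<^sub>R v) \<bullet> state_force t)
        + \<eta> * (norm h0 + norm (h0 + needle \<alpha> E b *\<^sub>R v) + (LINT t|lebesgue. weight t * norm (h0 + needle \<alpha> E t *\<^sub>R v)))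
        + (LINT t|lebesgue. indicator E t * (weight t * (L (x t) (Y t + v) t - L (x t) (Y t) t)))
        + 2 * C * (LINT t|lebesgue. indicator E t * (weight t * norm (h0 + needle \<alpha> E t *\<^sub>R v)))"

lemma variation_inequality:
  assumes \<eta>: "\<eta> > 0"
  shows "\<exists>C\<ge>0. \<exists>\<delta>>0. \<forall>h0. \<forall>E\<in>sets lebesgue. E \<subseteq> {a..b} \<longrightarrow>
      (\<forall>t\<in>{a..b}. norm (h0 + needle \<alpha> E t *\<^sub>R v) \<le> \<delta>) \<longrightarrow> 0 \<le> variation_bound \<eta> C h0 v E"
proof -
  have le: "a \<le> b" using ab by simp
  let ?K = "cball 0 R \<times> cball 0 (R + norm v) \<times> {a..b} :: ('v \<times> 'v \<times> real) set"
  have "compact ((\<lambda>(u, v, t). L1 u v t) ` ?K)"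
    by (intro compact_continuous_image continuous_on_subset[OF cont_L1] compact_Times) auto
  then obtain B where B: "\<And>z. z \<in> (\<lambda>(u, v, t). L1 u v t) ` ?K \<Longrightarrow> norm z \<le> B"
    using compact_imp_bounded bounded_iff by metis
  define C where "C = max 0 B"
  have C: "0 \<le> C" "norm (L1 p q t) \<le> C" if "norm p \<le> R" "norm q \<le> R + norm v" "t \<in> {a..b}" for p q t
  proof -
    have "L1 p q t \<in> (\<lambda>(u, v, t). L1 u v t) ` ?K"
      using that by (intro image_eqI[of _ _ "(p, q, t)"]) auto
    then show "norm (L1 p q t) \<le> C" using B by (fastforce simp: C_def)
  qed (simp add: C_def)
  have C0: "0 \<le> C" by (simp add: C_def)
  obtain \<delta>1 where \<delta>1: "\<delta>1 > 0" "\<And>p q t h. \<lbrakk>norm p \<le> R + norm v; norm q \<le> R + norm v; t \<in> {a..b}; norm h \<le> \<delta>1\<rbrakk> \<Longrightarrow>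
      \<bar>L (p + h) q t - L p q t - h \<bullet> L1 p q t\<bar> \<le> \<eta> * norm h"
    using uniform_first_order_expansion[OF deriv_L cont_L1 compact_Icc \<eta>, of "R + norm v"] by blast
  obtain \<delta>2 where \<delta>2: "\<delta>2 > 0" "\<And>z. norm (z - (x a, x b)) < \<delta>2 \<Longrightarrow>
      norm ((\<lambda>(u, v). \<phi> u v) z - (\<lambda>(u, v). \<phi> u v) (x a, x b) - (\<lambda>(h, k). h \<bullet> d1 + k \<bullet> d2) (z - (x a, x b)))
        \<le> \<eta> * norm (z - (x a, x b))"
    using deriv_\<phi> \<eta> unfolding has_derivative_at_alt by blast
  have \<phi>_le: "\<phi> (x a + h) (x b + k) \<le> \<phi> (x a) (x b) + (h \<bullet> d1 + k \<bullet> d2) + \<eta> * (norm h + norm k)"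
    if "norm h \<le> \<delta>2 / 3" "norm k \<le> \<delta>2 / 3" for h k
  proof -
    have n: "norm (h, k) \<le> norm h + norm k"
      by (rule norm_Pair_le)
    then have "norm ((x a + h, x b + k) - (x a, x b)) < \<delta>2" using that \<delta>2(1) by simp
    from \<delta>2(2)[OF this] have "\<bar>\<phi> (x a + h) (x b + k) - \<phi> (x a) (x b) - (h \<bullet> d1 + k \<bullet> d2)\<bar> \<le> \<eta> * norm (h, k)"
      by simp
    also have "\<dots> \<le> \<eta> * (norm h + norm k)" using n \<eta> by (intro mult_left_mono) auto
    finally show ?thesis by linarith
  qed
  show ?thesis
  proof (rule exI[of _ C], rule conjI[OF C0], rule exI[of _ "min \<delta>1 (\<delta>2 / 3)"],
      intro conjI allI ballI impI)
    fix h0 E assume E: "E \<in> sets lebesgue" "E \<subseteq> {a..b}"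
      and small: "\<forall>t\<in>{a..b}. norm (h0 + needle \<alpha> E t *\<^sub>R v) \<le> min \<delta>1 (\<delta>2 / 3)"
    define h where "h t = h0 + needle \<alpha> E t *\<^sub>R v" for t
    have small': "norm (h t) \<le> \<delta>1" "norm (h t) \<le> \<delta>2 / 3" if "t \<in> {a..b}" for t
      using small that by (simp_all add: h_def)
    have ha: "h a = h0" using needle_eq_0[OF \<alpha>(1) E, of a] by (simp add: h_def)
    have hc: "continuous_on UNIV h"
      unfolding h_def using needle_continuous[OF \<alpha>(1) E] by (intro continuous_intros)
    have hm [measurable]: "h \<in> borel_measurable lebesgue"
      using hc by (intro measurable_completion) (simp add: borel_measurable_continuous_onI)
    have [measurable]: "state_force \<in> borel_measurable lebesgue" "weight \<in> borel_measurable lebesgue"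
      using state_force_integrable weight_integrable by auto
    have xh: "continuous_on {a..b} (\<lambda>t. x t + h t)"
      using x(1) continuous_on_subset[OF hc, of "{a..b}"] by (intro continuous_intros) auto
    let ?\<Delta> = "\<lambda>t. weight t * (L (x t) (Y t + v) t - L (x t) (Y t) t)"
    have Yv: "Linfinity_on a b (\<lambda>t. Y t + v)"
      using Linfinity_on_add[OF Y_Linf continuous_imp_Linfinity_on[OF le continuous_on_const]] .
    have YE: "Linfinity_on a b (\<lambda>t. Y t + indicator E t *\<^sub>R v)"
      by (rule Linfinity_on_add[OF Y_Linf indicator_Linf[OF E(1)]])
    have i0: "integrable lebesgue (\<lambda>t. weight t * L (x t) (Y t) t)" by (rule weighted_L_integrable[OF x(1) Y_Linf])
    have i1: "integrable lebesgue (\<lambda>t. h t \<bullet> state_force t)"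
    proof (rule Bochner_Integration.integrable_bound)
      show "integrable lebesgue (\<lambda>t. \<delta>1 * norm (state_force t))" using state_force_integrable by simp
      show "AE t in lebesgue. norm (h t \<bullet> state_force t) \<le> norm (\<delta>1 * norm (state_force t))"
      proof (intro AE_I2)
        fix t
        show "norm (h t \<bullet> state_force t) \<le> norm (\<delta>1 * norm (state_force t))"
        proof (cases "t \<in> {a..b}")
          case True
          have "norm (h t \<bullet> state_force t) \<le> norm (h t) * norm (state_force t)" using Cauchy_Schwarz_ineq2 by simp
          also have "\<dots> \<le> \<delta>1 * norm (state_force t)" using small'[OF True] by (intro mult_right_mono) auto
          finally show ?thesis by simp
        qed (simp add: state_force_def)
      qed
    qed measurable
    have i2: "integrable lebesgue (\<lambda>t. weight t * norm (h t))"
    proof (rule Bochner_Integration.integrable_bound)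
      show "integrable lebesgue (\<lambda>t. \<delta>1 * weight t)" using weight_integrable by simp
      show "AE t in lebesgue. norm (weight t * norm (h t)) \<le> norm (\<delta>1 * weight t)"
      proof (intro AE_I2)
        fix t
        show "norm (weight t * norm (h t)) \<le> norm (\<delta>1 * weight t)"
        proof (cases "t \<in> {a..b}")
          case True
          have "weight t * norm (h t) \<le> weight t * \<delta>1" using small'[OF True] weight_nonneg by (intro mult_left_mono)
          then show ?thesis using weight_nonneg[of t] \<delta>1(1) by (simp add: mult.commute)
        qed (simp add: weight_def)
      qed
    qed measurable
    have i3: "integrable lebesgue (\<lambda>t. indicator E t * ?\<Delta> t)"
      using integrable_mult_indicator[OF E(1) Bochner_Integration.integrable_diff[OF weighted_L_integrable[OF x(1) Yv] i0]]
      by (simp add: right_diff_distrib)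
    have i4: "integrable lebesgue (\<lambda>t. indicator E t * (weight t * norm (h t)))"
      using integrable_mult_indicator[OF E(1) i2] by simp
    have i5: "integrable lebesgue (\<lambda>t. weight t * L (x t + h t) (Y t + indicator E t *\<^sub>R v) t)"
      by (rule weighted_L_integrable[OF xh YE])
    \<comment> \<open>integrand of \<open>variation_bound\<close> without its boundary terms, added to the old integrand\<close>
    let ?rhs = "\<lambda>t. weight t * L (x t) (Y t) t + h t \<bullet> state_force t + \<eta> * (weight t * norm (h t)) + indicator E t * ?\<Delta> t
      + 2 * C * (indicator E t * (weight t * norm (h t)))"
    have point: "weight t * L (x t + h t) (Y t + indicator E t *\<^sub>R v) t \<le> ?rhs t" for t
    proof (cases "t \<in> {a..b}")
      case True
      note expand = \<delta>1(2)[OF _ _ True small'(1)[OF True]]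
      have xt: "norm (x t) \<le> R + norm v" using x(2)[OF True] norm_ge_zero[of v] by linarith
      have Yt: "norm (Y t) \<le> R + norm v" using Y(2)[of t] norm_ge_zero[of v] by linarith
      have Yvt: "norm (Y t + v) \<le> R + norm v" using Y(2)[of t] norm_triangle_ineq[of "Y t" v] by linarith
      have "L (x t + h t) (Y t + indicator E t *\<^sub>R v) t \<le> L (x t) (Y t) t + h t \<bullet> L1 (x t) (Y t) t + \<eta> * norm (h t)
        + indicator E t * (L (x t) (Y t + v) t - L (x t) (Y t) t) + 2 * C * (indicator E t * norm (h t))"
      proof (cases "t \<in> E")
        case False
        then show ?thesis using expand[OF xt Yt] by simp
      next
        case tE: True
        have "h t \<bullet> (L1 (x t) (Y t + v) t - L1 (x t) (Y t) t)
            \<le> norm (h t) * norm (L1 (x t) (Y t + v) t - L1 (x t) (Y t) t)" by (rule norm_cauchy_schwarz)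
        also have "\<dots> \<le> norm (h t) * (2 * C)"
          using norm_triangle_ineq4[of "L1 (x t) (Y t + v) t" "L1 (x t) (Y t) t"]
            C(2)[OF x(2)[OF True] Yvt True] C(2)[OF x(2)[OF True] Yt True]
          by (intro mult_left_mono) auto
        finally have "h t \<bullet> L1 (x t) (Y t + v) t \<le> h t \<bullet> L1 (x t) (Y t) t + 2 * C * norm (h t)"
          by (simp add: inner_diff_right mult_ac)
        then show ?thesis using tE expand[OF xt Yvt] by simp
      qed
      then have "weight t * L (x t + h t) (Y t + indicator E t *\<^sub>R v) t \<le> weight t * (L (x t) (Y t) t + h t \<bullet> L1 (x t) (Y t) t + \<eta> * norm (h t)
        + indicator E t * (L (x t) (Y t + v) t - L (x t) (Y t) t) + 2 * C * (indicator E t * norm (h t)))"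
        by (rule mult_left_mono[OF _ weight_nonneg])
      also have "\<dots> = ?rhs t" by (simp add: state_force_eq algebra_simps)
      finally show ?thesis .
    next
      case False
      then have "weight t = 0" "state_force t = 0" by (simp_all add: weight_def state_force_def)
      then show ?thesis by simp
    qed
    have "\<phi> (x a) (x b) + (LINT t|lebesgue. weight t * L (x t) (Y t) t)
      \<le> \<phi> (x a + h0) (x b + h b) + (LINT t|lebesgue. weight t * L (x t + h t) (Y t + indicator E t *\<^sub>R v) t)"
      using minimal[OF E, of h0 v] unfolding h_def[symmetric] weighted_L_eq .
    also have "(LINT t|lebesgue. weight t * L (x t + h t) (Y t + indicator E t *\<^sub>R v) t) \<le> (LINT t|lebesgue. ?rhs t)"
      using i0 i1 i2 i3 i4 i5 point by (intro integral_mono Bochner_Integration.integrable_add integrable_mult_right)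
    also have "(LINT t|lebesgue. ?rhs t) = (LINT t|lebesgue. weight t * L (x t) (Y t) t) + (LINT t|lebesgue. h t \<bullet> state_force t)
      + \<eta> * (LINT t|lebesgue. weight t * norm (h t)) + (LINT t|lebesgue. indicator E t * ?\<Delta> t)
      + 2 * C * (LINT t|lebesgue. indicator E t * (weight t * norm (h t)))"
      using i0 i1 i2 i3 i4 by simp
    also have "\<phi> (x a + h0) (x b + h b) \<le> \<phi> (x a) (x b) + (h0 \<bullet> d1 + h b \<bullet> d2) + \<eta> * (norm h0 + norm (h b))"
      using small'(2)[of a] small'(2)[of b] ab ha by (intro \<phi>_le) auto
    finally show "0 \<le> variation_bound \<eta> C h0 v E"
      unfolding variation_bound_def h_def[symmetric] by (simp add: algebra_simps)
  qed (use \<delta>1 \<delta>2 C0 in auto)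
qed

text \<open>
  For constant shifts \<open>h0\<close> the bound is linear in \<open>h0\<close> up to a multiple of \<open>\<eta> * norm h0\<close>. Testing with a small
  negative multiple of the linear coefficient shows that the coefficient vanishes.
\<close>

lemma natural_boundary_condition: "d1 + d2 + (LINT t|lebesgue. state_force t) = 0"
proof -
  define S where "S = d1 + d2 + (LINT t|lebesgue. state_force t)"
  define W where "W = (LINT t|lebesgue. weight t)"
  have W: "0 \<le> W" unfolding W_def using weight_nonneg by (intro Bochner_Integration.integral_nonneg)
  have bound: "norm S \<le> \<eta> * (2 + W)" if \<eta>: "\<eta> > 0" for \<eta>
  proof -
    obtain C \<delta> where \<delta>: "\<delta> > 0" and ineq: "\<forall>h0. \<forall>E\<in>sets lebesgue. E \<subseteq> {a..b} \<longrightarrow>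
      (\<forall>t\<in>{a..b}. norm (h0 + needle \<alpha> E t *\<^sub>R 0) \<le> \<delta>) \<longrightarrow> 0 \<le> variation_bound \<eta> C h0 0 E"
      using variation_inequality[OF \<eta>, of 0] by (elim exE conjE)
    define \<epsilon> where "\<epsilon> = \<delta> / (norm S + 1)"
    have \<epsilon>: "\<epsilon> > 0" using \<delta> by (simp add: \<epsilon>_def add_nonneg_pos)
    have "\<epsilon> * norm S \<le> \<epsilon> * (norm S + 1)" using \<epsilon> by (intro mult_left_mono) auto
    also have "\<dots> = \<delta>" by (simp add: \<epsilon>_def add_nonneg_eq_0_iff)
    finally have small: "norm (- \<epsilon> *\<^sub>R S) \<le> \<delta>" using \<epsilon> by simp
    have [simp]: "needle \<alpha> {} t = 0" for t by (simp add: needle_def)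
    have "0 \<le> variation_bound \<eta> C (- \<epsilon> *\<^sub>R S) 0 {}"
      using small ineq by simp
    then have "0 \<le> (- \<epsilon> *\<^sub>R S) \<bullet> d1 + (- \<epsilon> *\<^sub>R S) \<bullet> d2 + (LINT t|lebesgue. (- \<epsilon> *\<^sub>R S) \<bullet> state_force t)
      + \<eta> * (norm (- \<epsilon> *\<^sub>R S) + norm (- \<epsilon> *\<^sub>R S) + (LINT t|lebesgue. weight t * norm (- \<epsilon> *\<^sub>R S)))"
      unfolding variation_bound_def by simp
    also have "(LINT t|lebesgue. (- \<epsilon> *\<^sub>R S) \<bullet> state_force t) = (- \<epsilon> *\<^sub>R S) \<bullet> (LINT t|lebesgue. state_force t)"
      using state_force_integrable by (intro integral_inner_right)
    also have "(LINT t|lebesgue. weight t * norm (- \<epsilon> *\<^sub>R S)) = W * norm (- \<epsilon> *\<^sub>R S)"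
      by (simp add: W_def)
    also have "norm (- \<epsilon> *\<^sub>R S) = \<epsilon> * norm S" using \<epsilon> by simp
    finally have "0 \<le> (- \<epsilon> *\<^sub>R S) \<bullet> d1 + (- \<epsilon> *\<^sub>R S) \<bullet> d2 + (- \<epsilon> *\<^sub>R S) \<bullet> (LINT t|lebesgue. state_force t)
      + \<eta> * (\<epsilon> * norm S + \<epsilon> * norm S + W * (\<epsilon> * norm S))" .
    moreover have "(- \<epsilon> *\<^sub>R S) \<bullet> S
      = (- \<epsilon> *\<^sub>R S) \<bullet> d1 + (- \<epsilon> *\<^sub>R S) \<bullet> d2 + (- \<epsilon> *\<^sub>R S) \<bullet> (LINT t|lebesgue. state_force t)"
      by (simp only: S_def inner_add_right)
    moreover have "\<eta> * (\<epsilon> * norm S + \<epsilon> * norm S + W * (\<epsilon> * norm S)) = \<eta> * ((2 + W) * (\<epsilon> * norm S))"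
      by (simp add: algebra_simps)
    ultimately have "0 \<le> (- \<epsilon> *\<^sub>R S) \<bullet> S + \<eta> * ((2 + W) * (\<epsilon> * norm S))" by linarith
    then have "\<epsilon> * (norm S * norm S) \<le> \<epsilon> * (\<eta> * (2 + W) * norm S)"
      by (simp add: power2_norm_eq_inner[symmetric] power2_eq_square mult_ac)
    then have "norm S * norm S \<le> \<eta> * (2 + W) * norm S" using \<epsilon> by simp
    then show ?thesis using \<eta> W by (cases "S = 0") auto
  qed
  have "norm S \<le> 0 + e" if "e > 0" for e
    using bound[of "e / (2 + W)"] W that by simp
  then have "norm S \<le> 0" by (rule field_le_epsilon)
  then show ?thesis by (simp add: S_def)
qed

text \<open>
  The coefficient of a small change of velocity at time \<open>s\<close> in the first order change of the cost that is
  transmitted through the later states: the boundary term and the right fractional integral of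
  \<open>state_force\<close>.
\<close>

definition adjoint_density :: "real \<Rightarrow> 'v" where
  "adjoint_density s = frac_kernel \<alpha> s b *\<^sub>R d2 + (right_frac \<alpha> state_force s)"

definition excess :: "'v \<Rightarrow> real \<Rightarrow> real" where
  "excess v s = weight s * (L (x s) (Y s + v) s - L (x s) (Y s) s) + v \<bullet> adjoint_density s"

lemma needle_force_integrable:
  assumes E: "E \<in> sets lebesgue" "E \<subseteq> {a..b}"
  shows "integrable lebesgue (\<lambda>t. needle \<alpha> E t *\<^sub>R state_force t)"
proof -
  obtain \<delta> where "\<And>F t. \<lbrakk>F \<in> sets lebesgue; F \<subseteq> {a..b}\<rbrakk> \<Longrightarrow> needle \<alpha> F t
      \<le> 1 powr \<alpha> / Gamma (\<alpha> + 1) + 1 powr (\<alpha> - 1) / Gamma \<alpha> * measure lebesgue F"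
    using needle_le[OF \<alpha>(1) _ _ \<alpha>(2) zero_less_one] by metis
  then obtain C where C: "\<And>t. needle \<alpha> E t \<le> C" using E by metis
  have [measurable]: "state_force \<in> borel_measurable lebesgue" using state_force_integrable by auto
  have [measurable]: "needle \<alpha> E \<in> borel_measurable lebesgue"
    using needle_continuous[OF \<alpha>(1) E] by (intro measurable_completion) (simp add: borel_measurable_continuous_onI)
  show ?thesis
  proof (rule Bochner_Integration.integrable_bound)
    show "integrable lebesgue (\<lambda>t. C * norm (state_force t))" using state_force_integrable by simp
    show "AE t in lebesgue. norm (needle \<alpha> E t *\<^sub>R state_force t) \<le> norm (C * norm (state_force t))"
    proof (intro AE_I2)
      fix t
      have "needle \<alpha> E t * norm (state_force t) \<le> C * norm (state_force t)" using C by (intro mult_right_mono) auto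
      then show "norm (needle \<alpha> E t *\<^sub>R state_force t) \<le> norm (C * norm (state_force t))"
        using needle_nonneg[OF \<alpha>(1) E, of t] by simp
    qed
  qed measurable
qed

text \<open>
  By \<open>needle_duality\<close> the terms of \<open>variation_bound\<close> that are linear in the displacement become an
  integral over \<open>E\<close>.
\<close>

lemma excess_parts:
  assumes E: "E \<in> sets lebesgue" "E \<subseteq> {a..b}"
  shows "integrable lebesgue (\<lambda>s. indicator E s * excess v s)"
    and "(LINT s|lebesgue. indicator E s * excess v s)
      = (LINT s|lebesgue. indicator E s * (weight s * (L (x s) (Y s + v) s - L (x s) (Y s) s)))
        + (needle \<alpha> E b *\<^sub>R v) \<bullet> d2 + (LINT t|lebesgue. (needle \<alpha> E t *\<^sub>R v) \<bullet> state_force t)"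
proof -
  have le: "a \<le> b" using ab by simp
  have fm: "state_force \<in> borel_measurable lebesgue" using state_force_integrable by auto
  let ?Q = "\<lambda>s. LINT t|lebesgue. frac_kernel \<alpha> s t *\<^sub>R state_force t"
  let ?\<Delta> = "\<lambda>t. weight t * (L (x t) (Y t + v) t - L (x t) (Y t) t)"
  have Yv: "Linfinity_on a b (\<lambda>t. Y t + v)"
    using Linfinity_on_add[OF Y_Linf continuous_imp_Linfinity_on[OF le continuous_on_const]] .
  have i1: "integrable lebesgue (\<lambda>t. indicator E t * ?\<Delta> t)"
    using integrable_mult_indicator[OF E(1) Bochner_Integration.integrable_diff[OF
        weighted_L_integrable[OF x(1) Yv] weighted_L_integrable[OF x(1) Y_Linf]]]
    by (simp add: right_diff_distrib)
  have i2: "integrable lebesgue (\<lambda>s. (frac_kernel \<alpha> s b * indicator E s) * (v \<bullet> d2))"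
    using needle_integrable[OF \<alpha>(1) E] by (intro integrable_mult_left)
  note dual = needle_duality[OF \<alpha>(1) E needle_force_integrable[OF E] fm]
  have i3: "integrable lebesgue (\<lambda>s. v \<bullet> (indicator E s *\<^sub>R ?Q s))"
    using dual(1) by (intro integrable_inner_right)
  have eq: "indicator E s * excess v s
      = indicator E s * ?\<Delta> s + (frac_kernel \<alpha> s b * indicator E s) * (v \<bullet> d2) + v \<bullet> (indicator E s *\<^sub>R ?Q s)" for s
    by (simp add: excess_def adjoint_density_def inner_add_right algebra_simps)
  show "integrable lebesgue (\<lambda>s. indicator E s * excess v s)"
    unfolding eq using i1 i2 i3 by (intro Bochner_Integration.integrable_add)
  have "(LINT s|lebesgue. indicator E s * excess v s) = (LINT s|lebesgue. indicator E s * ?\<Delta> s)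
      + (LINT s|lebesgue. (frac_kernel \<alpha> s b * indicator E s) * (v \<bullet> d2))
      + (LINT s|lebesgue. v \<bullet> (indicator E s *\<^sub>R ?Q s))"
    unfolding eq using i1 i2 i3 by simp
  also have "(LINT s|lebesgue. (frac_kernel \<alpha> s b * indicator E s) * (v \<bullet> d2)) = (needle \<alpha> E b *\<^sub>R v) \<bullet> d2"
    by (simp add: needle_def)
  also have "(LINT s|lebesgue. v \<bullet> (indicator E s *\<^sub>R ?Q s)) = v \<bullet> (LINT s|lebesgue. indicator E s *\<^sub>R ?Q s)"
    using dual(1) by (intro integral_inner_right)
  also have "\<dots> = v \<bullet> (LINT t|lebesgue. needle \<alpha> E t *\<^sub>R state_force t)" using dual(2) by simp
  also have "\<dots> = (LINT t|lebesgue. v \<bullet> (needle \<alpha> E t *\<^sub>R state_force t))"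
    using needle_force_integrable[OF E] by (intro integral_inner_right[symmetric])
  finally show "(LINT s|lebesgue. indicator E s * excess v s)
      = (LINT s|lebesgue. indicator E s * ?\<Delta> s)
        + (needle \<alpha> E b *\<^sub>R v) \<bullet> d2 + (LINT t|lebesgue. (needle \<alpha> E t *\<^sub>R v) \<bullet> state_force t)"
    by simp
qed

lemma weighted_needle_norm:
  assumes E: "E \<in> sets lebesgue" "E \<subseteq> {a..b}"
  shows "(LINT t|lebesgue. weight t * norm (needle \<alpha> E t *\<^sub>R v))
     = (LINT s|lebesgue. frac_kernel (\<alpha> + \<beta>) s b * indicator E s) * norm v"
proof -
  have eq: "weight t * norm (needle \<alpha> E t *\<^sub>R v) = (frac_kernel \<beta> t b * needle \<alpha> E t) * norm v" for t
    using needle_eq_0[OF \<alpha>(1) E, of t] needle_nonneg[OF \<alpha>(1) E, of t]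
    by (cases "t \<in> {a..b}") (auto simp: weight_def frac_kernel_def)
  show ?thesis unfolding eq weighted_needle_integral(2)[OF \<alpha>(1) E \<beta>, symmetric] by simp
qed

text \<open>
  On \<open>{a..c}\<close> with \<open>c < b\<close> the kernels \<open>frac_kernel \<gamma> s b\<close> are bounded, so every error term of
  \<open>variation_bound\<close> is at most \<open>\<eta>0 / 2\<close> times the measure of \<open>E\<close> once \<open>E\<close> is small.
\<close>

lemma weierstrass_on_initial_interval:
  assumes c: "c < b"
  shows "AE s\<in>{a..c} in lebesgue. 0 \<le> excess v s"
proof (rule AE_nonneg_if_small_set_integrals_almost_nonneg)
  have cb: "{a..c} \<subseteq> {a..b}" using c by auto
  show "set_integrable lebesgue {a..c} (excess v)"
    using excess_parts(1)[OF _ cb] by (simp add: set_integrable_def)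
  fix \<eta>0 :: real assume \<eta>0: "\<eta>0 > 0"
  obtain C3 where C3: "0 \<le> C3" "\<And>s. s \<in> {a..c} \<Longrightarrow> frac_kernel \<alpha> s b \<le> C3"
    using frac_kernel_bounded_left_of[OF \<alpha>(1) c] by blast
  obtain C4 where C4: "0 \<le> C4" "\<And>s. s \<in> {a..c} \<Longrightarrow> frac_kernel (\<alpha> + \<beta>) s b \<le> C4"
    using frac_kernel_bounded_left_of[OF add_pos_pos[OF \<alpha>(1) \<beta>] c] by blast
  obtain C5 where C5: "0 \<le> C5" "\<And>s. s \<in> {a..c} \<Longrightarrow> frac_kernel \<beta> s b \<le> C5"
    using frac_kernel_bounded_left_of[OF \<beta> c] by blast
  have half: "z / (2 * p) * p = z / 2" if "p \<noteq> 0" for z p :: real using that by simp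
  define \<eta> where "\<eta> = \<eta>0 / (2 * (norm v * (C3 + C4) + 1))"
  have pos: "norm v * (C3 + C4) + 1 > 0" using C3 C4 by (intro add_nonneg_pos mult_nonneg_nonneg) auto
  then have \<eta>: "\<eta> > 0" using \<eta>0 by (simp add: \<eta>_def)
  obtain C \<delta> where C: "0 \<le> C" and \<delta>: "\<delta> > 0" and ineq: "\<forall>h0. \<forall>E\<in>sets lebesgue. E \<subseteq> {a..b} \<longrightarrow>
      (\<forall>t\<in>{a..b}. norm (h0 + needle \<alpha> E t *\<^sub>R v) \<le> \<delta>) \<longrightarrow> 0 \<le> variation_bound \<eta> C h0 v E"
    using variation_inequality[OF \<eta>, of v] by (elim exE conjE)
  define D where "D = 2 * C * norm v * C5"
  have D: "0 \<le> D" using C C5 by (simp add: D_def)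
  define \<epsilon> where "\<epsilon> = min (\<delta> / (norm v + 1)) (\<eta>0 / (2 * (D + 1)))"
  have \<epsilon>: "\<epsilon> > 0" using \<delta> \<eta>0 D by (simp add: \<epsilon>_def add_nonneg_pos)
  have \<epsilon>v: "\<epsilon> * norm v \<le> \<delta>"
  proof -
    have "\<epsilon> * norm v \<le> \<delta> / (norm v + 1) * (norm v + 1)"
      using \<epsilon> \<delta> by (intro mult_mono) (auto simp: \<epsilon>_def)
    also have "\<dots> = \<delta>" using norm_ge_zero[of v] by (simp add: add_nonneg_eq_0_iff)
    finally show ?thesis .
  qed
  have \<epsilon>D: "D * \<epsilon> \<le> \<eta>0 / 2"
  proof -
    have "D * \<epsilon> \<le> (D + 1) * (\<eta>0 / (2 * (D + 1)))"
      using \<epsilon> D by (intro mult_mono) (auto simp: \<epsilon>_def)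
    also have "\<dots> = \<eta>0 / 2" using half[of "D + 1" \<eta>0] D by (simp only: mult.commute[of "D + 1"])
    finally show ?thesis .
  qed
  obtain \<delta>' where \<delta>': "\<delta>' > 0" "\<And>E t a c. \<lbrakk>E \<in> sets lebesgue; E \<subseteq> {a..c}; measure lebesgue E \<le> \<delta>'\<rbrakk> \<Longrightarrow> needle \<alpha> E t \<le> \<epsilon>"
    using needle_small[OF \<alpha> \<epsilon>] by blast
  show "\<exists>\<delta>>0. \<forall>E\<in>sets lebesgue. E \<subseteq> {a..c} \<longrightarrow> measure lebesgue E \<le> \<delta> \<longrightarrow>
        - \<eta>0 * measure lebesgue E \<le> (LINT s|lebesgue. indicator E s * excess v s)"
  proof (intro exI[of _ \<delta>'] conjI ballI impI)
    fix E :: "real set" assume E: "E \<in> sets lebesgue" "E \<subseteq> {a..c}" and m: "measure lebesgue E \<le> \<delta>'"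
    have Eb: "E \<subseteq> {a..b}" using E cb by auto
    let ?m = "measure lebesgue E"
    have n_le: "needle \<alpha> E t \<le> \<epsilon>" for t using \<delta>'(2)[OF E m] .
    note n_nonneg = needle_nonneg[OF \<alpha>(1) E]
    have "norm (0 + needle \<alpha> E t *\<^sub>R v) \<le> \<delta>" for t
      using n_nonneg[of t] n_le[of t] \<epsilon>v mult_right_mono[OF n_le[of t] norm_ge_zero[of v]] by simp
    then have "0 \<le> variation_bound \<eta> C 0 v E" using ineq E(1) Eb by blast
    then have main: "0 \<le> (needle \<alpha> E b *\<^sub>R v) \<bullet> d2 + (LINT t|lebesgue. (needle \<alpha> E t *\<^sub>R v) \<bullet> state_force t)
        + \<eta> * (norm (needle \<alpha> E b *\<^sub>R v) + (LINT t|lebesgue. weight t * norm (needle \<alpha> E t *\<^sub>R v)))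
        + (LINT t|lebesgue. indicator E t * (weight t * (L (x t) (Y t + v) t - L (x t) (Y t) t)))
        + 2 * C * (LINT t|lebesgue. indicator E t * (weight t * norm (needle \<alpha> E t *\<^sub>R v)))"
      unfolding variation_bound_def by (simp only: inner_zero_left add_0 norm_zero)
    have b1: "norm (needle \<alpha> E b *\<^sub>R v) \<le> C3 * ?m * norm v"
    proof -
      have "needle \<alpha> E b \<le> C3 * ?m"
        unfolding needle_def by (rule integral_kernel_on_support_le[OF \<alpha>(1) E \<alpha>(1) C3(2)])
      from mult_right_mono[OF this norm_ge_zero[of v]] show ?thesis using n_nonneg[of b] by simp
    qed
    have b2: "(LINT t|lebesgue. weight t * norm (needle \<alpha> E t *\<^sub>R v)) \<le> C4 * ?m * norm v"
      unfolding weighted_needle_norm[OF E(1) Eb]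
      by (intro mult_right_mono integral_kernel_on_support_le[OF \<alpha>(1) E _ C4(2)]) (use \<alpha> \<beta> in auto)
    have b3: "(LINT t|lebesgue. indicator E t * (weight t * norm (needle \<alpha> E t *\<^sub>R v))) \<le> \<epsilon> * norm v * (C5 * ?m)"
    proof -
      have int: "integrable lebesgue (\<lambda>t. \<epsilon> * norm v * (frac_kernel \<beta> t b * indicator E t))"
        by (intro integrable_mult_right kernel_indicator_integrable[OF \<alpha>(1) E] \<beta>)
      have "(LINT t|lebesgue. indicator E t * (weight t * norm (needle \<alpha> E t *\<^sub>R v)))
         \<le> (LINT t|lebesgue. \<epsilon> * norm v * (frac_kernel \<beta> t b * indicator E t))"
      proof (rule integral_mono'[OF int])
        fix t
        have "frac_kernel \<beta> t b * (needle \<alpha> E t * norm v) \<le> frac_kernel \<beta> t b * (\<epsilon> * norm v)"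
          using \<beta> n_le by (intro mult_left_mono mult_right_mono) auto
        then show "indicator E t * (weight t * norm (needle \<alpha> E t *\<^sub>R v)) \<le> \<epsilon> * norm v * (frac_kernel \<beta> t b * indicator E t)"
          using Eb n_nonneg[of t] by (auto simp: indicator_def weight_def mult_ac)
        show "0 \<le> \<epsilon> * norm v * (frac_kernel \<beta> t b * indicator E t)"
          using \<epsilon> \<beta> by simp
      qed
      also have "\<dots> = \<epsilon> * norm v * (LINT t|lebesgue. frac_kernel \<beta> t b * indicator E t)" by simp
      also have "\<dots> \<le> \<epsilon> * norm v * (C5 * ?m)"
        using \<epsilon> by (intro mult_left_mono integral_kernel_on_support_le[OF \<alpha>(1) E \<beta> C5(2)]) auto
      finally show ?thesis .
    qed
    have e1: "\<eta> * (norm (needle \<alpha> E b *\<^sub>R v) + (LINT t|lebesgue. weight t * norm (needle \<alpha> E t *\<^sub>R v))) \<le> \<eta>0 / 2 * ?m"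
    proof -
      have "\<eta> * (norm (needle \<alpha> E b *\<^sub>R v) + (LINT t|lebesgue. weight t * norm (needle \<alpha> E t *\<^sub>R v)))
        \<le> \<eta> * (C3 * ?m * norm v + C4 * ?m * norm v)"
        using b1 b2 \<eta> by (intro mult_left_mono add_mono) auto
      also have "\<dots> = \<eta> * (norm v * (C3 + C4)) * ?m" by (simp add: algebra_simps)
      also have "\<dots> \<le> \<eta> * (norm v * (C3 + C4) + 1) * ?m"
        using \<eta> by (intro mult_right_mono mult_left_mono) auto
      also have "\<eta> * (norm v * (C3 + C4) + 1) = \<eta>0 / 2"
        unfolding \<eta>_def using pos by (intro half) simp
      finally show ?thesis .
    qed
    have e2: "2 * C * (LINT t|lebesgue. indicator E t * (weight t * norm (needle \<alpha> E t *\<^sub>R v))) \<le> \<eta>0 / 2 * ?m"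
    proof -
      have "2 * C * (LINT t|lebesgue. indicator E t * (weight t * norm (needle \<alpha> E t *\<^sub>R v)))
        \<le> 2 * C * (\<epsilon> * norm v * (C5 * ?m))"
        using b3 C by (intro mult_left_mono) auto
      also have "\<dots> = D * \<epsilon> * ?m" by (simp add: D_def mult_ac)
      also have "\<dots> \<le> \<eta>0 / 2 * ?m" using \<epsilon>D by (intro mult_right_mono) auto
      finally show ?thesis .
    qed
    show "- \<eta>0 * ?m \<le> (LINT s|lebesgue. indicator E s * excess v s)"
      unfolding excess_parts(2)[OF E(1) Eb] using main e1 e2 by linarith
  qed (rule \<delta>')
qed

text \<open>
  The exceptional null set is made independent of \<open>v\<close> by taking \<open>v\<close> from a countable dense set and
  using continuity of the excess in \<open>v\<close>.
\<close>

lemma weierstrass_condition: "AE s\<in>{a..<b} in lebesgue. \<forall>v. 0 \<le> excess v s"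
proof -
  obtain D :: "'v set" where D: "countable D" "\<And>X. open X \<Longrightarrow> X \<noteq> {} \<Longrightarrow> \<exists>d\<in>D. d \<in> X"
    using countable_dense_setE by blast
  define c where "c n = b - inverse (real (Suc n))" for n
  have cb: "c n < b" for n by (simp add: c_def)
  have "AE s in lebesgue. \<forall>n. \<forall>v\<in>D. s \<in> {a..c n} \<longrightarrow> 0 \<le> excess v s"
    unfolding AE_all_countable
    by (intro allI, subst AE_ball_countable[OF D(1)]) (use weierstrass_on_initial_interval[OF cb] in blast)
  then show ?thesis
  proof eventually_elim
    case (elim s)
    show ?case
    proof (intro impI allI)
      fix v assume s: "s \<in> {a..<b}"
      have "(\<lambda>n. c n) \<longlonglongrightarrow> b - 0" unfolding c_def
        by (intro tendsto_intros LIMSEQ_inverse_real_of_nat)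
      then have "eventually (\<lambda>n. s < c n) sequentially" using s by (intro order_tendstoD(1)) auto
      then obtain n where "s < c n" by (auto simp: eventually_sequentially)
      then have "s \<in> {a..c n}" using s by simp
      then have *: "0 \<le> excess v s" if "v \<in> D" for v using elim that by blast
      have sab: "s \<in> {a..b}" using s by auto
      have "continuous_on UNIV (\<lambda>v. L (x s) (Y s + v) s)"
      proof -
        have "continuous_on UNIV (\<lambda>v. (x s, Y s + v, s))" by (intro continuous_intros)
        from continuous_on_compose2[OF cont_L this] sab show ?thesis by (simp add: image_subset_iff)
      qed
      then have "continuous_on UNIV (\<lambda>v. excess v s)"
        unfolding excess_def by (intro continuous_intros)
      then have "open {v. excess v s < 0}" by (intro open_Collect_less continuous_on_const)
      then have "{v. excess v s < 0} = {}" using D(2)[of "{v. excess v s < 0}"] * by fastforce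
      then show "0 \<le> excess v s" by (meson Collect_empty_eq not_le)
    qed
  qed
qed

lemma weierstrass_imp_stationary:
  assumes excess: "\<And>v. 0 \<le> excess v s"
    and L2: "\<And>q. ((\<lambda>q. L (x s) q s) has_derivative (\<lambda>h. h \<bullet> g q)) (at q)"
  shows "weight s *\<^sub>R g (Y s) = - adjoint_density s"
    and "(g has_derivative H) (at (Y s)) \<Longrightarrow> 0 \<le> weight s * (v \<bullet> H v)"
proof -
  let ?\<psi> = "\<lambda>q. weight s * L (x s) q s + q \<bullet> adjoint_density s"
  let ?g = "\<lambda>q. weight s *\<^sub>R g q + adjoint_density s"
  have \<psi>: "(?\<psi> has_derivative (\<lambda>h. h \<bullet> ?g q)) (at q)" for q
    by (rule has_derivative_eq_rhs) (auto intro!: derivative_eq_intros L2 simp: inner_add_right)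
  have min: "?\<psi> (Y s) \<le> ?\<psi> q" for q
    using excess[of "q - Y s"] by (simp add: excess_def inner_diff_left algebra_simps)
  have "(\<lambda>h. h \<bullet> ?g (Y s)) = (\<lambda>h. 0)"
    using min by (intro has_derivative_local_min[OF \<psi>]) simp
  then have zero: "?g (Y s) = 0" by (metis inner_eq_zero_iff)
  then show "weight s *\<^sub>R g (Y s) = - adjoint_density s" by (simp add: eq_neg_iff_add_eq_0)
  assume H: "(g has_derivative H) (at (Y s))"
  then have "(?g has_derivative (\<lambda>h. weight s *\<^sub>R H h)) (at (Y s))"
    by (auto intro!: derivative_eq_intros)
  from second_derivative_nonneg_at_minimum[OF \<psi> this, of v] min[of "Y s + _"] zero
  show "0 \<le> weight s * (v \<bullet> H v)" by simp
qed

end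

section \<open>The necessary conditions\<close>

text \<open>
  The semigroup law gives \<open>frac_kernel 1 t b *\<^sub>R d\<close> and the ordinary integral of \<open>f\<close> over \<open>{t..b}\<close>.
  At \<open>t = b\<close> the literal integral is zero, whereas the continuous representative has the value
  \<open>- d\<close>. For \<open>\<alpha> = 1\<close> no integral is taken and the right-hand side is the one in the hypothesis.
\<close>

lemma frac_int_right_of_stationary:
  fixes f p :: "real \<Rightarrow> 'v::euclidean_space"
  assumes ab: "a < b" and \<alpha>: "0 < \<alpha>" "\<alpha> \<le> 1"
    and f: "integrable lebesgue f" and supp: "\<And>t. t \<notin> {a..b} \<Longrightarrow> f t = 0"
    and p: "AE s\<in>{a..b} in lebesgue. p s = - (frac_kernel \<alpha> s b *\<^sub>R d + (right_frac \<alpha> f s))"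
    and t: "t \<in> {a..b}"
  shows "frac_int_right a b (1 - \<alpha>) p t = - d - (right_frac 1 f t)"
proof -
  define g where "g t = - d - (right_frac 1 f t)" for t
  have fm [measurable]: "f \<in> borel_measurable lebesgue" using f by auto
  have gc: "continuous_on {a..b} g"
    unfolding g_def indefinite_integral_right_eq[OF f]
    using abs_continuous_on_imp_continuous_on[OF indefinite_integral_abs_continuous[OF f]]
    by (intro continuous_intros)
  have nb: "AE t in lebesgue. t \<noteq> b" by (rule AE_I[of _ _ "{b}"]) auto
  define F where "F = (if 1 - \<alpha> = 0 then p
      else (\<lambda>t. LINT s:{t..b}|lebesgue. ((s - t) powr (1 - \<alpha> - 1) / Gamma (1 - \<alpha>)) *\<^sub>R p s))"
  have "AE t\<in>{a..b} in lebesgue. F t = g t"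
  proof (cases "\<alpha> = 1")
    case True
    then have Fp: "F = p" by (simp add: F_def)
    show ?thesis
      using p nb by eventually_elim (use True in \<open>auto simp: Fp g_def frac_kernel_one\<close>)
  next
    case False
    then have \<gamma>: "0 < 1 - \<alpha>" using \<alpha> by simp
    let ?Q = "\<lambda>s. LINT t|lebesgue. frac_kernel \<alpha> s t *\<^sub>R f t"
    have "F t = g t" if t: "t \<in> {a..b}" "t \<noteq> b" for t
    proof -
      have int1: "integrable lebesgue (\<lambda>r. frac_kernel (\<alpha> + (1 - \<alpha>)) t r *\<^sub>R f r)"
        by (rule Bochner_Integration.integrable_bound[OF f]) (auto simp: frac_kernel_one)
      note semi = frac_kernel_semigroup_right[OF \<alpha>(1) \<gamma> fm int1]
      note intQ = integrable_frac_kernel_comp_right[OF \<alpha>(1) \<gamma> fm int1]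
      have nn: "(\<integral>\<^sup>+ s. ennreal (frac_kernel (1 - \<alpha>) t s * frac_kernel \<alpha> s b) \<partial>lebesgue) = ennreal 1"
        using nn_integral_frac_kernel_comp[OF \<gamma> \<alpha>(1), of t b] t
        by (simp add: nn_integral_completion frac_kernel_one)
      have nonneg: "0 \<le> frac_kernel (1 - \<alpha>) t s * frac_kernel \<alpha> s b" for s using \<alpha> \<gamma> by simp
      have intk: "integrable lebesgue (\<lambda>s. frac_kernel (1 - \<alpha>) t s * frac_kernel \<alpha> s b)"
        using nn nonneg by (intro integrableI_nonneg) auto
      have valk: "(LINT s|lebesgue. frac_kernel (1 - \<alpha>) t s * frac_kernel \<alpha> s b) = 1"
        using nn nonneg by (subst integral_eq_nn_integral) auto
      \<comment> \<open>the right-hand side vanishes beyond \<open>b\<close>, so the restriction to \<open>{a..b}\<close> is immaterial\<close>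
      have above: "frac_kernel \<alpha> s b *\<^sub>R d + ?Q s = 0" if "b < s" for s
      proof -
        have "frac_kernel \<alpha> s r *\<^sub>R f r = 0" for r
          using that supp[of r] by (cases "s < r") (auto simp: frac_kernel_def)
        then have "?Q s = 0" by (intro integral_eq_zero_AE AE_I2)
        then show ?thesis using that by (simp add: frac_kernel_def)
      qed
      have pm: "(\<lambda>s. frac_kernel (1 - \<alpha>) t s *\<^sub>R (frac_kernel \<alpha> s b *\<^sub>R d) + frac_kernel (1 - \<alpha>) t s *\<^sub>R ?Q s)
          \<in> borel_measurable lebesgue"
        using intk intQ by (intro borel_measurable_add borel_measurable_integrable)
          (simp_all add: integrable_scaleR_left)
      note pm' = borel_measurable_uminus[OF pm]
      have ae: "AE s in lebesgue. - (frac_kernel (1 - \<alpha>) t s *\<^sub>R (frac_kernel \<alpha> s b *\<^sub>R d) + frac_kernel (1 - \<alpha>) t s *\<^sub>R ?Q s)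
          = frac_kernel (1 - \<alpha>) t s *\<^sub>R (indicator {a..b} s *\<^sub>R p s)"
        using p
      proof eventually_elim
        case (elim s)
        consider "s \<in> {a..b}" | "s < a" | "b < s" by fastforce
        then show ?case
        proof cases
          case 1
          with elim show ?thesis by (simp add: scaleR_diff_right)
        next
          case 2
          then show ?thesis using t by (simp add: frac_kernel_def)
        next
          case 3
          have "frac_kernel (1 - \<alpha>) t s *\<^sub>R (frac_kernel \<alpha> s b *\<^sub>R d + ?Q s) = 0" using above[OF 3] by simp
          then show ?thesis using 3 by (simp add: scaleR_add_right)
        qed
      qed
      have "F t = right_frac (1 - \<alpha>) (\<lambda>s. indicator {a..b} s *\<^sub>R p s) t"
        using False t frac_int_right_kernel[of a t b "1 - \<alpha>" p] by (simp add: F_def del: scaleR_scaleR)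
      also have "\<dots> = (LINT s|lebesgue. - (frac_kernel (1 - \<alpha>) t s *\<^sub>R (frac_kernel \<alpha> s b *\<^sub>R d)
          + frac_kernel (1 - \<alpha>) t s *\<^sub>R ?Q s))"
        by (rule integral_cong_AE[symmetric, OF pm' borel_measurable_AE[OF pm' ae] ae])
      also have "\<dots> = - ((LINT s|lebesgue. (frac_kernel (1 - \<alpha>) t s * frac_kernel \<alpha> s b) *\<^sub>R d)
          + (right_frac (1 - \<alpha>) ?Q t))"
        using intk intQ by (simp add: integrable_scaleR_left)
      also have "(LINT s|lebesgue. (frac_kernel (1 - \<alpha>) t s * frac_kernel \<alpha> s b) *\<^sub>R d) = d"
        using intk valk by simp
      finally show ?thesis unfolding semi by (simp add: g_def)
    qed
    then show ?thesis using nb by (auto elim!: eventually_mono)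
  qed
  from cont_rep_eq[OF ab gc this t] show ?thesis by (simp add: frac_int_right_def F_def g_def)
qed

theorem theorem3p1:
  fixes a b \<alpha> \<beta> :: real
    and \<phi> :: "real ^ 'n \<Rightarrow> real ^ 'n \<Rightarrow> real"
    and L :: "real ^ 'n \<Rightarrow> real ^ 'n \<Rightarrow> real \<Rightarrow> real"
    and x :: "real \<Rightarrow> real ^ 'n"
  assumes "a < b" and "0 < \<alpha>" and "\<alpha> \<le> 1" and "0 < \<beta>"
    and "C2_on (\<lambda>(u, v). \<phi> u v) UNIV"
    and "C2_on (\<lambda>(u, v, t). L u v t) (UNIV \<times> UNIV \<times> {a..b})"
    and "x \<in> caputo_AC_inf_left a b \<alpha>"
    and "\<And>X. X \<in> caputo_AC_inf_left a b \<alpha> \<Longrightarrow> bolza a b \<alpha> \<beta> \<phi> L x \<le> bolza a b \<alpha> \<beta> \<phi> L X"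
  shows "let y = caputo_deriv_left a b \<alpha> x;
             w = (\<lambda>t. (b - t) powr (\<beta> - 1) / Gamma \<beta>);
             p = (\<lambda>t. w t *\<^sub>R gradient (\<lambda>v. L (x t) v t) (y t))
         in (p \<in> AC_right a b \<alpha> \<and>
             (AE t\<in>{a..b} in lebesgue.
                frac_deriv_right a b \<alpha> p t = - (w t *\<^sub>R gradient (\<lambda>u. L u (y t) t) (x t)))) \<and>
            (frac_int_right a b (1 - \<alpha>) p a = gradient (\<lambda>u. \<phi> u (x b)) (x a) \<and>
             - frac_int_right a b (1 - \<alpha>) p b = gradient (\<lambda>v. \<phi> (x a) v) (x b)) \<and>
            (AE t\<in>{a..b} in lebesgue.
                pos_semidefinite (w t *\<^sub>R hessian (\<lambda>v. L (x t) v t) (y t)))"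
proof -
  note ab = assms(1) and \<alpha> = assms(2,3) and \<beta> = assms(4)
  have le: "a \<le> b" using ab by simp
  define y where "y = caputo_deriv_left a b \<alpha> x"
  define d1 where "d1 = gradient (\<lambda>u. \<phi> u (x b)) (x a)"
  define d2 where "d2 = gradient (\<lambda>v. \<phi> (x a) v) (x b)"
  obtain L1 L2 H where L1: "\<And>u v t. t \<in> {a..b} \<Longrightarrow> ((\<lambda>u. L u v t) has_derivative (\<lambda>h. h \<bullet> L1 u v t)) (at u)"
    and L2: "\<And>u v t. t \<in> {a..b} \<Longrightarrow> ((\<lambda>v. L u v t) has_derivative (\<lambda>h. h \<bullet> L2 u v t)) (at v)"
    and H: "\<And>u v t. t \<in> {a..b} \<Longrightarrow> ((\<lambda>v. L2 u v t) has_derivative H u v t) (at v)"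
    and cont_L: "continuous_on (UNIV \<times> UNIV \<times> {a..b}) (\<lambda>(u, v, t). L u v t)"
    and cont_L1: "continuous_on (UNIV \<times> UNIV \<times> {a..b}) (\<lambda>(u, v, t). L1 u v t)"
    and cont_L2: "continuous_on (UNIV \<times> UNIV \<times> {a..b}) (\<lambda>(u, v, t). L2 u v t)"
    using C2_on_slab_partials[OF assms(6)] by blast
  have xc: "continuous_on {a..b} x" and yinf: "Linfinity_on a b y"
    using assms(7) by (auto simp: caputo_AC_inf_left_def caputo_AC_left_def y_def)
  obtain R1 where ym: "(\<lambda>s. indicator {a..b} s *\<^sub>R y s) \<in> borel_measurable lebesgue"
    and R1: "AE s in lebesgue. norm (indicator {a..b} s *\<^sub>R y s) \<le> R1"
    by (rule Linfinity_on_kernel_form[OF yinf])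
  have "bounded (x ` {a..b})" using xc by (intro compact_imp_bounded compact_continuous_image) auto
  then obtain R2 where R2: "\<And>t. t \<in> {a..b} \<Longrightarrow> norm (x t) \<le> R2"
    unfolding bounded_iff by blast
  define R where "R = max 0 (max R1 R2)"
  define z where "z s = indicator {a..b} s *\<^sub>R y s" for s
  have zm [measurable]: "z \<in> borel_measurable lebesgue" using ym by (simp add: z_def[abs_def])
  \<comment> \<open>a representative of \<open>y\<close> that is bounded everywhere\<close>
  define Y where "Y s = (if norm (z s) \<le> R then z s else 0)" for s
  have YR: "norm (Y s) \<le> R" for s by (simp add: Y_def R_def)
  have Ym: "Y \<in> borel_measurable lebesgue"
    unfolding Y_def[abs_def] by measurable
  have yY: "AE t\<in>{a..b} in lebesgue. y t = Y t"
    using R1 by eventually_elim (auto simp: Y_def z_def R_def)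
  interpret bolza_minimizer a b \<alpha> \<beta> R \<phi> d1 d2 L L1 x Y
  proof
    show "((\<lambda>(u, v). \<phi> u v) has_derivative (\<lambda>(h, k). h \<bullet> d1 + k \<bullet> d2)) (at (x a, x b))"
      unfolding d1_def d2_def by (rule C2_on_pair_derivative[OF assms(5)])
  next
    fix h0 v :: "real ^ 'n" and E :: "real set" assume E: "E \<in> sets lebesgue" "E \<subseteq> {a..b}"
    define u where "u s = indicator E s *\<^sub>R v" for s
    have um: "u \<in> borel_measurable lebesgue"
      unfolding u_def[abs_def] using E by (intro borel_measurable_scaleR) auto
    have ub: "norm (u s) \<le> norm v" and us: "s \<notin> {a..b} \<Longrightarrow> u s = 0" for s
      using E by (auto simp: u_def indicator_def)
    have Ju: "(left_frac \<alpha> u t) = needle \<alpha> E t *\<^sub>R v" for t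
      unfolding needle_def u_def using needle_integrable[OF \<alpha>(1) E, of t]
      by simp
    \<comment> \<open>the competitor, with Caputo derivative \<open>y + u\<close>\<close>
    define X where "X = (\<lambda>t. x t + (h0 + needle \<alpha> E t *\<^sub>R v))"
    have var: "X \<in> caputo_AC_inf_left a b \<alpha>"
      "AE t\<in>{a..b} in lebesgue. caputo_deriv_left a b \<alpha> X t = caputo_deriv_left a b \<alpha> x t + u t"
      unfolding X_def Ju[symmetric]
      by (rule caputo_variation[OF ab \<alpha> assms(7) um ub us], assumption)+
    have XZ: "AE t\<in>{a..b} in lebesgue. caputo_deriv_left a b \<alpha> X t = Y t + indicator E t *\<^sub>R v"
      using var(2) yY by eventually_elim (simp add: y_def u_def)
    have "bolza a b \<alpha> \<beta> \<phi> L x \<le> bolza a b \<alpha> \<beta> \<phi> L X" by (rule assms(8)[OF var(1)])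
    moreover have "needle \<alpha> E a = 0" using needle_eq_0[OF \<alpha>(1) E, of a] by simp
    ultimately show "\<phi> (x a) (x b) + (LINT t|lebesgue. frac_kernel \<beta> t b * (indicator {a..b} t * L (x t) (Y t) t))
      \<le> \<phi> (x a + h0) (x b + (h0 + needle \<alpha> E b *\<^sub>R v)) + (LINT t|lebesgue. frac_kernel \<beta> t b *
          (indicator {a..b} t * L (x t + (h0 + needle \<alpha> E t *\<^sub>R v)) (Y t + indicator E t *\<^sub>R v) t))"
      using bolza_eq[OF ab \<beta> cont_L assms(7) yY[unfolded y_def], of \<phi>]
        bolza_eq[OF ab \<beta> cont_L var(1) XZ, of \<phi>] by (simp add: X_def)
  qed (use ab \<alpha> \<beta> xc R2 YR Ym L1 cont_L cont_L1 in \<open>auto simp: R_def intro: max.coboundedI2\<close>)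
  define w' where "w' t = (b - t) powr (\<beta> - 1) / Gamma \<beta>" for t
  have ww: "w' t = weight t" if "t \<in> {a..b}" for t
    using that by (auto simp: w'_def weight_def frac_kernel_def)
  have grad1: "gradient (\<lambda>u. L u v t) u = L1 u v t" and grad2: "gradient (\<lambda>v. L u v t) v = L2 u v t"
    if "t \<in> {a..b}" for u v t
    using gradient_eq L1 L2 that by blast+
  define p where "p t = w' t *\<^sub>R gradient (\<lambda>v. L (x t) v t) (y t)" for t
  have nb: "AE t in lebesgue. t \<noteq> b" by (rule AE_I[of _ _ "{b}"]) auto
  have p_eq: "AE s\<in>{a..b} in lebesgue. p s = - adjoint_density s"
    using weierstrass_condition yY nb
  proof eventually_elim
    case (elim s)
    show ?case
    proof
      assume s: "s \<in> {a..b}"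
      with elim have "\<And>v. 0 \<le> excess v s" by simp
      from weierstrass_imp_stationary(1)[OF this L2[OF s]] show "p s = - adjoint_density s"
        using elim s by (simp add: p_def ww grad2)
    qed
  qed
  have int_p: "set_integrable lebesgue {a..b} p"
  proof -
    have "integrable lebesgue (\<lambda>t. weight t *\<^sub>R L2 (x t) (y t) t)" by (rule weighted_integrable[OF cont_L2 xc yinf])
    moreover have "weight t *\<^sub>R L2 (x t) (y t) t = indicator {a..b} t *\<^sub>R p t" for t
      by (cases "t \<in> {a..b}") (simp_all add: p_def ww grad2 weight_def)
    ultimately show ?thesis by (simp add: set_integrable_def)
  qed
  have f0: "state_force t = 0" if "t \<notin> {a..b}" for t using that by (simp add: state_force_def)
  have frac: "frac_int_right a b (1 - \<alpha>) p t = - d2 - (right_frac 1 state_force t)"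
    if "t \<in> {a..b}" for t
    by (rule frac_int_right_of_stationary[OF ab \<alpha> state_force_integrable f0 p_eq[unfolded adjoint_density_def] that])
  let ?I = "\<lambda>t. LINT r|lebesgue. frac_kernel 1 r t *\<^sub>R state_force r"
  let ?c = "- d2 - (LINT r|lebesgue. state_force r)"
  have frac': "frac_int_right a b (1 - \<alpha>) p t = ?c + ?I t" if "t \<in> {a..b}" for t
    using frac[OF that] indefinite_integral_right_eq[OF state_force_integrable, of t] by simp
  have AC: "abs_continuous_on a b (frac_int_right a b (1 - \<alpha>) p)"
    by (rule abs_continuous_on_dominated[OF indefinite_integral_abs_continuous[OF state_force_integrable, of a b]])
      (auto simp: frac')
  have euler_lagrange: "AE t\<in>{a..b} in lebesgue.
      frac_deriv_right a b \<alpha> p t = - (w' t *\<^sub>R gradient (\<lambda>u. L u (y t) t) (x t))"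
  proof -
    have "AE t in lebesgue. t \<noteq> a" by (rule AE_I[of _ _ "{a}"]) auto
    then show ?thesis
      using nb yY indefinite_integral_AE_derivative[OF state_force_integrable]
    proof eventually_elim
      case (elim t)
      show ?case
      proof
        assume t: "t \<in> {a..b}"
        then have t': "t \<in> {a<..<b}" using elim by auto
        have "((\<lambda>t. ?c + ?I t) has_vector_derivative state_force t) (at t)"
          using elim by (auto intro!: derivative_eq_intros)
        then have "(frac_int_right a b (1 - \<alpha>) p has_vector_derivative state_force t) (at t)"
          by (rule has_vector_derivative_transform_within_open[OF _ open_greaterThanLessThan t'])
            (simp add: frac')
        then show "frac_deriv_right a b \<alpha> p t = - (w' t *\<^sub>R gradient (\<lambda>u. L u (y t) t) (x t))"
          using elim t by (simp add: frac_deriv_right_def vector_derivative_at state_force_eq ww grad1)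
      qed
    qed
  qed
  have at_b: "(right_frac 1 state_force b) = 0"
    using f0 by (intro integral_eq_zero_AE AE_I2) (auto simp: frac_kernel_def)
  have at_a: "?I a = 0"
    using f0 by (intro integral_eq_zero_AE AE_I2) (auto simp: frac_kernel_def)
  have trans_a: "frac_int_right a b (1 - \<alpha>) p a = d1"
  proof -
    have "d1 = - (d2 + (LINT r|lebesgue. state_force r))"
      using natural_boundary_condition unfolding eq_neg_iff_add_eq_0 by (simp add: add.assoc)
    then show ?thesis using frac'[of a] at_a le by simp
  qed
  have trans_b: "- frac_int_right a b (1 - \<alpha>) p b = d2"
    using frac[of b] at_b le by simp
  have legendre: "AE t\<in>{a..b} in lebesgue. pos_semidefinite (w' t *\<^sub>R hessian (\<lambda>v. L (x t) v t) (y t))"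
    using weierstrass_condition yY nb
  proof eventually_elim
    case (elim s)
    show ?case
    proof
      assume s: "s \<in> {a..b}"
      with elim have "\<And>v. 0 \<le> excess v s" by simp
      from weierstrass_imp_stationary(2)[OF this L2[OF s] H[OF s]]
      show "pos_semidefinite (w' s *\<^sub>R hessian (\<lambda>v. L (x s) v s) (y s))"
        using elim s by (intro pos_semidefinite_scaleR_hessian[OF L2[OF s] H[OF s]]) (simp add: ww)
    qed
  qed
  have "p \<in> AC_right a b \<alpha>" using int_p AC by (simp add: AC_right_def)
  then show ?thesis
    using euler_lagrange trans_a trans_b legendre
    unfolding Let_def p_def[abs_def] w'_def[abs_def] y_def d1_def d2_def by blast
qed

end
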